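(* Let $M$ be a smooth manifold with algebra of densities $\mathcal F(M)$. Let $\widehat S$ be a symmetric contravariant rank-2 tensor field of weight $0$ on the extended manifold $\widehat M$, given in local coordinates $(x^i,t)$ by $$\widehat S(x,t)=\begin{pmatrix} S^{ik}(x) & B^i(x)t\\ B^k(x)t & C(x)t^2\end{pmatrix},$$ and let $\widehat\Delta_{\widehat S}$ be the canonical operator on the algebra of densities defined by $\widehat\Delta_{\widehat S}(\boldsymbol s)=\operatorname{div}(\widehat S\,d\boldsymbol s)$, where $\operatorname{div}$ is the canonical divergence; in local coordinates, $$\widehat\Delta_{\widehat S}=S^{ik}\partial_i\partial_k+\partial_kS^{ki}\,\partial_i+(2\widehat w-1)B^i\partial_i+\widehat w\,\partial_kB^k+\widehat w(\widehat w-1)C .$$ Then: 1. $\widehat\Delta_{\widehat S}$ is self-adjoint with respect to the canonical scalar product on densities, and satisfies the normalisation condition $\widehat\Delta_{\widehat S}(1)=0$. 2. Every second order differential operator $\widehat\Delta$ of weight $0$ on $\mathcal F(M)$ which is self-adjoint, $\widehat\Delta^*=\widehat\Delta$, and satisfies $\widehat\Delta(1)=0$ is uniquely determined by its principal symbol $\widehat S$; namely $\widehat\Delta=\widehat\Delta_{\widehat S}$.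
   Context: Densities. For $\lambda\in\mathbb R$, $\mathcal F_\lambda(M)$ is the space of smooth densities $\boldsymbol s=s(x)|Dx|^\lambda$ of weight $\lambda$ on $M$; $\mathcal F(M)=\bigoplus_\lambda\mathcal F_\lambda(M)$ is a commutative algebra under multiplication (weights add). The extended manifold $\widehat M$ is the frame bundle of the determinant bundle, with local coordinates $(x^i,t)$, where $t$ stands for $|Dx|$ and transforms as $t'=|\det(\partial x'/\partial x)|\,t$. Densities are identified with quasipolynomials $\sum_r s_r(x)t^{\lambda_r}$ on $\widehat M$. Weight operator. $\widehat w=t\,\partial/\partial t$, i.e. $\widehat w(\boldsymbol s)=\lambda\boldsymbol s$ for $\boldsymbol s\in\mathcal F_\lambda(M)$. Differential operators on $\mathcal F(M)$. Operators of order $0$ are multiplications by densities; $L$ has order $\le n+1$ if $[L,\boldsymbol s]$ has order $\le n$ for every density $\boldsymbol s$. An operator has weight $0$ if it maps each $\mathcal F_\lambda(M)$ to itself. A second order operator of weight $0$ has the local form $$\widehat\Delta=S^{ik}\partial_i\partial_k+2B^i\partial_i\widehat w+C\widehat w^2+D^i\partial_i+E\widehat w+F,$$ with coefficients functions of $x$, and its principal symbol is the symmetric contravariant tensor $\widehat S=\begin{pmatrix} S^{ik} & B^it\\ B^kt& Ct^2\end{pmatrix}$ on $\widehat M$. Canonical scalar product. For compactly supported $\boldsymbol s_1=s_1|Dx|^{\lambda_1}$, $\boldsymbol s_2=s_2|Dx|^{\lambda_2}$: $\langle\boldsymbol s_1,\boldsymbol s_2\rangle=\int_M s_1s_2|Dx|$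 if $\lambda_1+\lambda_2=1$, and $0$ otherwise. The adjoint is defined by $\langle\widehat\Delta\boldsymbol s_1,\boldsymbol s_2\rangle=\langle\boldsymbol s_1,\widehat\Delta^*\boldsymbol s_2\rangle$. In particular $\partial_i^*=-\partial_i$, $\widehat w^*=1-\widehat w$. Canonical divergence. For a vector field $\widehat{\mathbf X}=X^i(x,t)\partial_i+X^0(x,t)\widehat w$ on $\widehat M$, $\operatorname{div}\widehat{\mathbf X}=-(\widehat{\mathbf X}+\widehat{\mathbf X}^* )=\partial_iX^i(x,t)+(\widehat w-1)X^0(x,t)$. For a density $\boldsymbol s$, $d\boldsymbol s$ is its differential as a function on $\widehat M$ and $\widehat S\,d\boldsymbol s$ is the vector field on $\widehat M$ obtained by contracting with $\widehat S$. Summation over repeated indices is understood. *)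

theory Defs
  imports "HOL-Analysis.Analysis"
begin

section \<open>Smooth functions on open subsets of Euclidean space\<close>

definition partial_deriv :: "'m \<Rightarrow> (real^'m \<Rightarrow> real) \<Rightarrow> real^'m \<Rightarrow> real" where
  "partial_deriv i f x = frechet_derivative f (at x) (axis i 1)"

text \<open>All iterated partial derivatives exist and are differentiable. Only used for open sets,
  where this is the class of infinitely differentiable functions.\<close>

definition smooth_on :: "(real^'m) set \<Rightarrow> (real^'m \<Rightarrow> real) \<Rightarrow> bool" where
  "smooth_on U f \<longleftrightarrow> (\<forall>is. foldr partial_deriv is f differentiable_on U)"


section \<open>Smooth manifolds\<close>

text \<open>A chart is a pair of a domain and a coordinate map on it. The manifold is the whole
  (Hausdorff, second countable) type \<open>'a\<close>, with an arbitrary, not necessarily maximal, atlas.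
  The notions below are also used with charts whose points do not form a topological space type,
  namely for the charts of the extended manifold.\<close>

type_synonym ('p, 'm) chart = "'p set \<times> ('p \<Rightarrow> real^'m)"

abbreviation chart_image :: "('p, 'm::finite) chart \<Rightarrow> (real^'m) set" where
  "chart_image c \<equiv> snd c ` fst c"

definition chart_inv :: "('p, 'm::finite) chart \<Rightarrow> real^'m \<Rightarrow> 'p" where
  "chart_inv c = inv_into (fst c) (snd c)"

definition local_rep :: "('p, 'm::finite) chart \<Rightarrow> ('p \<Rightarrow> real) \<Rightarrow> real^'m \<Rightarrow> real" where
  "local_rep c f = f \<circ> chart_inv c"

definition transition :: "('p, 'm::finite) chart \<Rightarrow> ('p, 'm) chart \<Rightarrow> real^'m \<Rightarrow> real^'m" where
  "transition c d = snd d \<circ> chart_inv c"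

definition smooth_atlas :: "('a::{t2_space, second_countable_topology}, 'n::finite) chart set \<Rightarrow> bool" where
  "smooth_atlas A \<longleftrightarrow>
     (\<forall>c\<in>A. open (fst c) \<and> open (chart_image c) \<and>
            homeomorphism (fst c) (chart_image c) (snd c) (chart_inv c)) \<and>
     (\<Union>c\<in>A. fst c) = UNIV \<and>
     (\<forall>c\<in>A. \<forall>d\<in>A. \<forall>i. smooth_on (snd c ` (fst c \<inter> fst d)) (\<lambda>x. transition c d x $ i))"

definition smooth_function :: "('p, 'm::finite) chart set \<Rightarrow> ('p \<Rightarrow> real) \<Rightarrow> bool" where
  "smooth_function A f \<longleftrightarrow> (\<forall>c\<in>A. smooth_on (chart_image c) (local_rep c f))"


section \<open>The extended manifold\<close>

text \<open>A point over \<open>p\<close> is a frame of the determinant line at \<open>p\<close> (up to sign). It is recorded by the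
  values \<open>\<tau> c > 0\<close> that the coordinate \<open>t = |Dx|\<close> of each chart \<open>c\<close> around \<open>p\<close> takes on it; these
  are related by \<open>t' = |det (\<partial>x'/\<partial>x)| t\<close>. For all other \<open>c\<close> we put \<open>\<tau> c = 0\<close>.\<close>

type_synonym ('a, 'n) ext_point = "'a \<times> (('a, 'n) chart \<Rightarrow> real)"

definition ext_manifold :: "('a, 'n::finite) chart set \<Rightarrow> ('a, 'n) ext_point set" where
  "ext_manifold A = {(p, \<tau>).
     (\<forall>c. if c \<in> A \<and> p \<in> fst c then \<tau> c > 0 else \<tau> c = 0) \<and>
     (\<forall>c\<in>A. \<forall>d\<in>A. p \<in> fst c \<inter> fst d \<longrightarrow>
        \<tau> d = \<bar>det (jacobian (transition c d) (at (snd c p)))\<bar> * \<tau> c)}"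

text \<open>Coordinates \<open>(x\<^sup>i, t)\<close> are vectors indexed by \<open>'n option\<close>: \<open>Some i\<close> is the index of \<open>x\<^sup>i\<close> and
  \<open>None\<close> that of \<open>t\<close>.\<close>

definition ext_coords :: "real^'n::finite \<Rightarrow> real \<Rightarrow> real^('n option)" where
  "ext_coords x t = (\<chi> j. case j of None \<Rightarrow> t | Some i \<Rightarrow> x $ i)"

definition base_coords :: "real^('n::finite option) \<Rightarrow> real^'n" where
  "base_coords y = (\<chi> i. y $ Some i)"

definition ext_chart ::
  "('a, 'n::finite) chart set \<Rightarrow> ('a, 'n) chart \<Rightarrow> (('a, 'n) ext_point, 'n option) chart" where
  "ext_chart A c = ({(p, \<tau>) \<in> ext_manifold A. p \<in> fst c}, \<lambda>(p, \<tau>). ext_coords (snd c p) (\<tau> c))"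


section \<open>The algebra of densities\<close>

text \<open>Densities are functions on the extended manifold, extended by \<open>0\<close> to the whole type. Since
  \<open>t > 0\<close>, the functions \<open>t powr \<alpha>\<close> for distinct \<open>\<alpha>\<close> are linearly independent, so that
  quasipolynomials are the (internal) direct sum of the spaces of densities of weight \<open>\<alpha>\<close>.\<close>

definition densities :: "('a, 'n::finite) chart set \<Rightarrow> real \<Rightarrow> (('a, 'n) ext_point \<Rightarrow> real) set" where
  "densities A \<alpha> = {s. (\<forall>q. q \<notin> ext_manifold A \<longrightarrow> s q = 0) \<and>
     (\<forall>c\<in>A. \<exists>u. smooth_on (chart_image c) u \<and>
        (\<forall>(p, \<tau>) \<in> ext_manifold A. p \<in> fst c \<longrightarrow> s (p, \<tau>) = u (snd c p) * \<tau> c powr \<alpha>))}"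

definition is_decomposition ::
  "('a, 'n::finite) chart set \<Rightarrow> (('a, 'n) ext_point \<Rightarrow> real) \<Rightarrow>
   (real \<Rightarrow> ('a, 'n) ext_point \<Rightarrow> real) \<Rightarrow> bool" where
  "is_decomposition A s h \<longleftrightarrow>
     (\<forall>\<alpha>. h \<alpha> \<in> densities A \<alpha>) \<and> finite {\<alpha>. h \<alpha> \<noteq> (\<lambda>_. 0)} \<and>
     s = (\<lambda>q. \<Sum>\<alpha> | h \<alpha> \<noteq> (\<lambda>_. 0). h \<alpha> q)"

definition density_algebra :: "('a, 'n::finite) chart set \<Rightarrow> (('a, 'n) ext_point \<Rightarrow> real) set" where
  "density_algebra A = {s. \<exists>h. is_decomposition A s h}"

definition component ::
  "('a, 'n::finite) chart set \<Rightarrow> (('a, 'n) ext_point \<Rightarrow> real) \<Rightarrow> real \<Rightarrow> ('a, 'n) ext_point \<Rightarrow> real" where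
  "component A s = (THE h. is_decomposition A s h)"

definition unit_density :: "('a, 'n::finite) chart set \<Rightarrow> ('a, 'n) ext_point \<Rightarrow> real" where
  "unit_density A q = (if q \<in> ext_manifold A then 1 else 0)"

definition weight_op :: "(real^('n::finite option) \<Rightarrow> real) \<Rightarrow> real^('n option) \<Rightarrow> real" where
  "weight_op u y = y $ None * partial_deriv None u y"


section \<open>The canonical scalar product\<close>

definition base_support :: "(('a::topological_space, 'n) ext_point \<Rightarrow> real) \<Rightarrow> 'a set" where
  "base_support s = closure {p. \<exists>\<tau>. s (p, \<tau>) \<noteq> 0}"

text \<open>The integral over the manifold of a compactly supported density of weight \<open>1\<close>, by means of
  a smooth partition of unity on its support; \<open>local_rep (ext_chart A c) \<rho> (ext_coords x 1)\<close> is the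
  coefficient \<open>r(x)\<close> in \<open>\<rho> = r(x)|Dx|\<close>.\<close>

definition density_integral ::
  "('a::topological_space, 'n::finite) chart set \<Rightarrow> (('a, 'n) ext_point \<Rightarrow> real) \<Rightarrow> real" where
  "density_integral A \<rho> = (THE v. \<exists>I \<theta>. finite I \<and> I \<subseteq> A \<and>
     (\<forall>c\<in>I. smooth_function A (\<theta> c) \<and>
            compact (closure {p. \<theta> c p \<noteq> 0}) \<and> closure {p. \<theta> c p \<noteq> 0} \<subseteq> fst c) \<and>
     (\<forall>p\<in>base_support \<rho>. (\<Sum>c\<in>I. \<theta> c p) = 1) \<and>
     v = (\<Sum>c\<in>I. integral (chart_image c)
            (\<lambda>x. local_rep c (\<theta> c) x * local_rep (ext_chart A c) \<rho> (ext_coords x 1))))"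

definition scalar_product ::
  "('a::topological_space, 'n::finite) chart set \<Rightarrow> (('a, 'n) ext_point \<Rightarrow> real) \<Rightarrow>
   (('a, 'n) ext_point \<Rightarrow> real) \<Rightarrow> real" where
  "scalar_product A s\<^sub>1 s\<^sub>2 =
     (\<Sum>\<alpha> | component A s\<^sub>1 \<alpha> \<noteq> (\<lambda>_. 0). \<Sum>\<beta> | component A s\<^sub>2 \<beta> \<noteq> (\<lambda>_. 0).
        if \<alpha> + \<beta> = 1
        then density_integral A (\<lambda>q. component A s\<^sub>1 \<alpha> q * component A s\<^sub>2 \<beta> q)
        else 0)"


section \<open>Operators on the algebra of densities\<close>

type_synonym ('a, 'n) density_op = "(('a, 'n) ext_point \<Rightarrow> real) \<Rightarrow> ('a, 'n) ext_point \<Rightarrow> real"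

text \<open>Operators act on \<open>density_algebra A\<close> only; their values elsewhere are irrelevant.\<close>

definition linear_op :: "('a, 'n::finite) chart set \<Rightarrow> ('a, 'n) density_op \<Rightarrow> bool" where
  "linear_op A L \<longleftrightarrow>
     (\<forall>s\<in>density_algebra A. L s \<in> density_algebra A) \<and>
     (\<forall>s\<in>density_algebra A. \<forall>s'\<in>density_algebra A. L (\<lambda>q. s q + s' q) = (\<lambda>q. L s q + L s' q)) \<and>
     (\<forall>s\<in>density_algebra A. \<forall>a. L (\<lambda>q. a * s q) = (\<lambda>q. a * L s q))"

definition is_adjoint ::
  "('a::topological_space, 'n::finite) chart set \<Rightarrow> ('a, 'n) density_op \<Rightarrow> ('a, 'n) density_op \<Rightarrow> bool" where
  "is_adjoint A L L' \<longleftrightarrow> linear_op A L \<and> linear_op A L' \<and>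
     (\<forall>s\<^sub>1\<in>density_algebra A. \<forall>s\<^sub>2\<in>density_algebra A.
        compact (base_support s\<^sub>1) \<longrightarrow> compact (base_support s\<^sub>2) \<longrightarrow>
        scalar_product A (L s\<^sub>1) s\<^sub>2 = scalar_product A s\<^sub>1 (L' s\<^sub>2))"

definition self_adjoint :: "('a::topological_space, 'n::finite) chart set \<Rightarrow> ('a, 'n) density_op \<Rightarrow> bool" where
  "self_adjoint A L \<longleftrightarrow> is_adjoint A L L"

text \<open>\<open>diff_op A n L\<close>: \<open>L\<close> has order at most \<open>n\<close>.\<close>

primrec diff_op :: "('a, 'n::finite) chart set \<Rightarrow> nat \<Rightarrow> ('a, 'n) density_op \<Rightarrow> bool" where
  "diff_op A 0 L \<longleftrightarrow> linear_op A L \<and>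
     (\<exists>f\<in>density_algebra A. \<forall>s\<in>density_algebra A. L s = (\<lambda>q. f q * s q))"
| "diff_op A (Suc n) L \<longleftrightarrow> linear_op A L \<and>
     (\<forall>f\<in>density_algebra A. diff_op A n (\<lambda>s q. L (\<lambda>q. f q * s q) q - f q * L s q))"

definition weight_zero :: "('a, 'n::finite) chart set \<Rightarrow> ('a, 'n) density_op \<Rightarrow> bool" where
  "weight_zero A L \<longleftrightarrow> (\<forall>\<alpha>. \<forall>s\<in>densities A \<alpha>. L s \<in> densities A \<alpha>)"

type_synonym ('a, 'n) scalar_coeff = "('a, 'n) chart \<Rightarrow> real^'n \<Rightarrow> real"
type_synonym ('a, 'n) vector_coeff = "('a, 'n) chart \<Rightarrow> real^'n \<Rightarrow> real^'n"
type_synonym ('a, 'n) matrix_coeff = "('a, 'n) chart \<Rightarrow> real^'n \<Rightarrow> real^'n^'n"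

definition smooth_scalar :: "('a, 'n::finite) chart set \<Rightarrow> ('a, 'n) scalar_coeff \<Rightarrow> bool" where
  "smooth_scalar A C \<longleftrightarrow> (\<forall>c\<in>A. smooth_on (chart_image c) (C c))"

definition smooth_vector :: "('a, 'n::finite) chart set \<Rightarrow> ('a, 'n) vector_coeff \<Rightarrow> bool" where
  "smooth_vector A B \<longleftrightarrow> (\<forall>c\<in>A. \<forall>i. smooth_on (chart_image c) (\<lambda>x. B c x $ i))"

definition smooth_sym_matrix :: "('a, 'n::finite) chart set \<Rightarrow> ('a, 'n) matrix_coeff \<Rightarrow> bool" where
  "smooth_sym_matrix A S \<longleftrightarrow>
     (\<forall>c\<in>A. (\<forall>i k. smooth_on (chart_image c) (\<lambda>x. S c x $ i $ k)) \<and>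
            (\<forall>x\<in>chart_image c. transpose (S c x) = S c x))"

text \<open>The right hand side of the local form
  \<open>S\<^sup>i\<^sup>k \<partial>\<^sub>i \<partial>\<^sub>k + 2 B\<^sup>i \<partial>\<^sub>i w + C w\<^sup>2 + D\<^sup>i \<partial>\<^sub>i + E w + F\<close>, applied to a function \<open>u\<close> of \<open>(x, t)\<close>.\<close>

definition local_operator ::
  "(real^'n \<Rightarrow> real^'n^'n) \<Rightarrow> (real^'n \<Rightarrow> real^'n) \<Rightarrow> (real^'n \<Rightarrow> real) \<Rightarrow>
   (real^'n \<Rightarrow> real^'n) \<Rightarrow> (real^'n \<Rightarrow> real) \<Rightarrow> (real^'n \<Rightarrow> real) \<Rightarrow>
   (real^('n::finite option) \<Rightarrow> real) \<Rightarrow> real^('n option) \<Rightarrow> real" where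
  "local_operator S B C D E F u y = (let x = base_coords y in
     (\<Sum>i\<in>UNIV. \<Sum>k\<in>UNIV. S x $ i $ k * partial_deriv (Some i) (partial_deriv (Some k) u) y)
     + 2 * (\<Sum>i\<in>UNIV. B x $ i * partial_deriv (Some i) (weight_op u) y)
     + C x * weight_op (weight_op u) y
     + (\<Sum>i\<in>UNIV. D x $ i * partial_deriv (Some i) u y)
     + E x * weight_op u y
     + F x * u y)"

text \<open>\<open>S\<close>, \<open>B\<close>, \<open>C\<close> are the top order coefficients of \<open>L\<close>, chart by chart. That they are the
  components of a tensor on the extended manifold is not part of the definition.\<close>

definition has_principal_symbol ::
  "('a, 'n::finite) chart set \<Rightarrow> ('a, 'n) density_op \<Rightarrow>
   ('a, 'n) matrix_coeff \<Rightarrow> ('a, 'n) vector_coeff \<Rightarrow> ('a, 'n) scalar_coeff \<Rightarrow> bool" where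
  "has_principal_symbol A L S B C \<longleftrightarrow>
     smooth_sym_matrix A S \<and> smooth_vector A B \<and> smooth_scalar A C \<and>
     (\<exists>D E F. smooth_vector A D \<and> smooth_scalar A E \<and> smooth_scalar A F \<and>
        (\<forall>c\<in>A. \<forall>s\<in>density_algebra A. \<forall>y\<in>chart_image (ext_chart A c).
           local_rep (ext_chart A c) (L s) y =
           local_operator (S c) (B c) (C c) (D c) (E c) (F c) (local_rep (ext_chart A c) s) y))"

text \<open>The local form is not implied by the commutator condition: if \<open>a\<close> is an additive but not
  linear function on the reals, multiplication of densities of weight \<open>\<alpha>\<close> by \<open>a \<alpha>\<close> is a derivation
  of the algebra. Such operators are excluded by requiring the local form.\<close>

definition second_order_weight_zero :: "('a, 'n::finite) chart set \<Rightarrow> ('a, 'n) density_op \<Rightarrow> bool" where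
  "second_order_weight_zero A L \<longleftrightarrow>
     diff_op A 2 L \<and> weight_zero A L \<and> (\<exists>S B C. has_principal_symbol A L S B C)"


section \<open>Tensors on the extended manifold and the canonical operator\<close>

text \<open>Vector and tensor fields on the extended manifold are given by their components with respect
  to \<open>\<partial>/\<partial>x\<^sup>i\<close> and \<open>\<partial>/\<partial>t\<close> in each of the charts \<open>ext_chart A c\<close>.\<close>

type_synonym ('a, 'n) ext_vector = "('a, 'n) chart \<Rightarrow> real^('n option) \<Rightarrow> real^('n option)"
type_synonym ('a, 'n) ext_tensor = "('a, 'n) chart \<Rightarrow> real^('n option) \<Rightarrow> real^('n option)^('n option)"

definition contravariant_2_tensor :: "('a, 'n::finite) chart set \<Rightarrow> ('a, 'n) ext_tensor \<Rightarrow> bool" where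
  "contravariant_2_tensor A T \<longleftrightarrow>
     (\<forall>c\<in>A. \<forall>d\<in>A. \<forall>y \<in> snd (ext_chart A c) ` (fst (ext_chart A c) \<inter> fst (ext_chart A d)).
        let \<phi> = transition (ext_chart A c) (ext_chart A d); J = jacobian \<phi> (at y)
        in T d (\<phi> y) = J ** T c y ** transpose J)"

definition block_tensor ::
  "('a, 'n) matrix_coeff \<Rightarrow> ('a, 'n) vector_coeff \<Rightarrow> ('a, 'n) scalar_coeff \<Rightarrow> ('a, 'n::finite) ext_tensor" where
  "block_tensor S B C c y = (let x = base_coords y; t = y $ None in
     (\<chi> j l. case (j, l) of
        (Some i, Some k) \<Rightarrow> S c x $ i $ k
      | (Some i, None) \<Rightarrow> B c x $ i * t
      | (None, Some k) \<Rightarrow> B c x $ k * t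
      | (None, None) \<Rightarrow> C c x * t\<^sup>2))"

definition weight_zero_tensor ::
  "('a, 'n::finite) chart set \<Rightarrow> ('a, 'n) matrix_coeff \<Rightarrow> ('a, 'n) vector_coeff \<Rightarrow> ('a, 'n) scalar_coeff \<Rightarrow> bool" where
  "weight_zero_tensor A S B C \<longleftrightarrow>
     smooth_sym_matrix A S \<and> smooth_vector A B \<and> smooth_scalar A C \<and>
     contravariant_2_tensor A (block_tensor S B C)"

definition contract_differential ::
  "('a, 'n::finite) chart set \<Rightarrow> ('a, 'n) ext_tensor \<Rightarrow> (('a, 'n) ext_point \<Rightarrow> real) \<Rightarrow> ('a, 'n) ext_vector" where
  "contract_differential A T s c y = T c y *v (\<chi> j. partial_deriv j (local_rep (ext_chart A c) s) y)"

text \<open>The canonical divergence \<open>- (X + X\<^sup>*) = \<partial>\<^sub>i X\<^sup>i + (w - 1) X\<^sup>0\<close> of \<open>X = X\<^sup>i \<partial>\<^sub>i + X\<^sup>0 w\<close>. As \<open>w = t \<partial>/\<partial>t\<close>, the coefficient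
  \<open>X\<^sup>0\<close> is the \<open>\<partial>/\<partial>t\<close> component divided by \<open>t\<close>.\<close>

definition local_divergence ::
  "(real^('n::finite option) \<Rightarrow> real^('n option)) \<Rightarrow> real^('n option) \<Rightarrow> real" where
  "local_divergence X y =
     (let X0 = (\<lambda>z. X z $ None / z $ None)
      in (\<Sum>i\<in>UNIV. partial_deriv (Some i) (\<lambda>z. X z $ Some i) y) + weight_op X0 y - X0 y)"

text \<open>Evaluated in some chart around the point.\<close>

definition divergence ::
  "('a, 'n::finite) chart set \<Rightarrow> ('a, 'n) ext_vector \<Rightarrow> ('a, 'n) ext_point \<Rightarrow> real" where
  "divergence A X q =
     (if q \<in> ext_manifold A
      then let c = (SOME c. c \<in> A \<and> fst q \<in> fst c)
           in local_divergence (X c) (snd (ext_chart A c) q)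
      else 0)"

definition canonical_op :: "('a, 'n::finite) chart set \<Rightarrow> ('a, 'n) ext_tensor \<Rightarrow> ('a, 'n) density_op" where
  "canonical_op A T s = divergence A (contract_differential A T s)"

text \<open>\<open>S\<^sup>i\<^sup>k \<partial>\<^sub>i \<partial>\<^sub>k + \<partial>\<^sub>k S\<^sup>k\<^sup>i \<partial>\<^sub>i + (2w - 1) B\<^sup>i \<partial>\<^sub>i + w \<partial>\<^sub>k B\<^sup>k + w (w - 1) C\<close>, as a composition of operators
  on functions of \<open>(x, t)\<close>.\<close>

definition canonical_local_operator ::
  "(real^'n \<Rightarrow> real^'n^'n) \<Rightarrow> (real^'n \<Rightarrow> real^'n) \<Rightarrow> (real^'n \<Rightarrow> real) \<Rightarrow>
   (real^('n::finite option) \<Rightarrow> real) \<Rightarrow> real^('n option) \<Rightarrow> real" where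
  "canonical_local_operator S B C u y =
     (let x = base_coords y;
          Bu = (\<lambda>z. \<Sum>i\<in>UNIV. B (base_coords z) $ i * partial_deriv (Some i) u z);
          dBu = (\<lambda>z. (\<Sum>k\<in>UNIV. partial_deriv k (\<lambda>x. B x $ k) (base_coords z)) * u z);
          Cu = (\<lambda>z. C (base_coords z) * u z)
      in (\<Sum>i\<in>UNIV. \<Sum>k\<in>UNIV. S x $ i $ k * partial_deriv (Some i) (partial_deriv (Some k) u) y)
       + (\<Sum>i\<in>UNIV. \<Sum>k\<in>UNIV. partial_deriv k (\<lambda>x. S x $ k $ i) x * partial_deriv (Some i) u y)
       + (2 * weight_op Bu y - Bu y)
       + weight_op dBu y
       + weight_op (\<lambda>z. weight_op Cu z - Cu z) y)"

end

theory Submission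
  imports Defs
begin

text \<open>The proof rests on the weak form \<open>\<integral> div(S df) g = - \<integral> S(df, dg)\<close>, for densities \<open>f\<close>, \<open>g\<close> of weights
  \<open>\<alpha>\<close>, \<open>1 - \<alpha>\<close> of which one has compact support in a chart. Its right hand side is symmetric in \<open>f\<close> and
  \<open>g\<close>, and it is invariant under changes of charts since \<open>S\<close> is a tensor. Testing with all \<open>g\<close> shows
  that \<open>div(S df)\<close> does not depend on the chart either, and a partition of unity turns the local
  symmetry into self-adjointness. For uniqueness, the difference between a self-adjoint operator
  annihilating \<open>1\<close> and the canonical operator with the same symbol is \<open>D\<^sup>i \<partial>\<^sub>i + E w\<close> in each chart;
  its self-adjointness for all weights forces \<open>E = 0\<close> and then \<open>D = 0\<close>.\<close>

section \<open>Calculus of smooth functions\<close>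

text \<open>\<open>divergence\<close> is evaluated in a chart picked by a choice operator, so
  nothing global can be said about \<open>canonical_op\<close> before chart-independence is known. A
  direct check would have to differentiate the Jacobian determinant; the weak form needs only first
  derivatives and the change of variables formula. The weights \<alpha> and 1 - \<alpha> are forced:
  the product must have weight 1 to be integrated, and then the term (\<alpha> - 1) X0 of the
  divergence cancels against the t-part of S(df, dg). The extended manifold is reduced to functions
  of x: in weight \<alpha> the operator w is the number \<alpha>, and powers of t with distinct
  exponents are linearly independent, so operators in (x, t) become families of operators in x
  indexed by \<alpha>. In the uniqueness part the symbol is given chart by chart and is not known to
  be a tensor. The comparison of coefficients therefore stays inside one chart, where symmetry of S
  suffices. Only afterwards does polarisation, L (f g) - f L g - g L f = 2 S(df, dg), yield the
  tensor property; it relies on the zeroth order coefficient having been shown to vanish.\<close>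

lemma partial_deriv_eqI:
  "(f has_derivative f') (at x) \<Longrightarrow> partial_deriv i f x = f' (axis i 1)"
  unfolding partial_deriv_def by (metis frechet_derivative_at)

text \<open>Functions that agree near \<open>x\<close> have the same derivatives there, so the
  choice operator inside \<open>frechet_derivative\<close> returns the same value for both, whether
  or not a derivative exists.\<close>

lemma partial_deriv_cong:
  assumes "open U" "x \<in> U" "\<And>y. y \<in> U \<Longrightarrow> f y = g y"
  shows "partial_deriv i f x = partial_deriv i g x"
proof -
  have "(f has_derivative f') (at x) \<longleftrightarrow> (g has_derivative f') (at x)" for f'
    using has_derivative_transform_within_open[of f f' x UNIV U g]
      has_derivative_transform_within_open[of g f' x UNIV U f] assms by auto
  then show ?thesis unfolding partial_deriv_def frechet_derivative_def by simp
qed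

lemma differentiable_cong_open:
  assumes "open U" "x \<in> U" "\<And>y. y \<in> U \<Longrightarrow> f y = g y" "f differentiable at x"
  shows "g differentiable at x"
  using assms has_derivative_transform_within_open[of f _ x UNIV U g]
  unfolding differentiable_def by blast

lemma differentiable_on_cong:
  "(\<And>x. x \<in> U \<Longrightarrow> f x = g x) \<Longrightarrow> f differentiable_on U \<longleftrightarrow> g differentiable_on U"
  unfolding differentiable_on_def differentiable_def
  by (metis has_derivative_transform)

lemma differentiable_on_openD:
  "f differentiable_on U \<Longrightarrow> open U \<Longrightarrow> x \<in> U \<Longrightarrow> f differentiable at x"
  by (metis at_within_open differentiable_on_def)

lemma has_derivative_partial_deriv:
  assumes "f differentiable at x"
  shows "(f has_derivative (\<lambda>h. \<Sum>i\<in>UNIV. h $ i * partial_deriv i f x)) (at x)"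
proof -
  let ?D = "frechet_derivative f (at x)"
  have D: "(f has_derivative ?D) (at x)" using assms frechet_derivative_works by blast
  have lin: "linear ?D" using D has_derivative_linear by blast
  have "?D h = (\<Sum>i\<in>UNIV. h $ i * partial_deriv i f x)" for h
  proof -
    have "?D h = ?D (\<Sum>i\<in>UNIV. (h $ i) *\<^sub>R axis i 1)"
      using basis_expansion[of h] by (simp add: scalar_mult_eq_scaleR)
    also have "\<dots> = (\<Sum>i\<in>UNIV. h $ i * partial_deriv i f x)"
      using lin by (simp add: linear_sum linear_cmul partial_deriv_def)
    finally show ?thesis .
  qed
  then have "?D = (\<lambda>h. \<Sum>i\<in>UNIV. h $ i * partial_deriv i f x)" by auto
  with D show ?thesis by simp
qed

lemma partial_deriv_add:
  assumes "f differentiable at x" "g differentiable at x"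
  shows "partial_deriv i (\<lambda>y. f y + g y) x = partial_deriv i f x + partial_deriv i g x"
  using assms by (subst partial_deriv_eqI[OF has_derivative_add])
    (auto simp: partial_deriv_def frechet_derivative_works)

lemma partial_deriv_mult:
  fixes f g :: "real^'m::finite \<Rightarrow> real"
  assumes "f differentiable at x" "g differentiable at x"
  shows "partial_deriv i (\<lambda>y. f y * g y) x = f x * partial_deriv i g x + partial_deriv i f x * g x"
  using assms by (subst partial_deriv_eqI[OF has_derivative_mult])
    (auto simp: partial_deriv_def frechet_derivative_works)

lemma partial_deriv_const: "partial_deriv i (\<lambda>_. c) x = 0"
  by (subst partial_deriv_eqI[of _ "\<lambda>_. 0"]) auto

lemma partial_deriv_cmult:
  fixes f :: "real^'m::finite \<Rightarrow> real"
  assumes "f differentiable at x"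
  shows "partial_deriv i (\<lambda>y. c * f y) x = c * partial_deriv i f x"
  using partial_deriv_mult[of "\<lambda>_. c" x f i] assms by (simp add: partial_deriv_const)

lemma partial_deriv_sum:
  assumes "\<And>j. j \<in> J \<Longrightarrow> f j differentiable at x"
  shows "partial_deriv i (\<lambda>y. \<Sum>j\<in>J. f j y) x = (\<Sum>j\<in>J. partial_deriv i (f j) x)"
  using assms by (subst partial_deriv_eqI[OF has_derivative_sum])
    (auto simp: partial_deriv_def frechet_derivative_works)

lemma partial_deriv_nth: "partial_deriv i (\<lambda>y. y $ j) x = (if i = j then 1 else 0)"
  by (subst partial_deriv_eqI[OF bounded_linear.has_derivative[OF bounded_linear_vec_nth has_derivative_ident]])
    (simp add: axis_def)

lemma has_derivative_vec_components:
  fixes g :: "real^'m::finite \<Rightarrow> real^'k::finite"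
  assumes "\<And>j. ((\<lambda>x. g x $ j) has_derivative (\<lambda>h. g' h $ j)) (at x)"
  shows "(g has_derivative g') (at x)"
  using assms unfolding has_derivative_componentwise_within[where f = g]
  by (auto simp: Basis_vec_def inner_axis)

lemma differentiable_vec_components:
  fixes g :: "real^'m::finite \<Rightarrow> real^'k::finite"
  assumes "\<And>j. (\<lambda>x. g x $ j) differentiable at x"
  shows "g differentiable at x"
proof -
  have "\<exists>D. \<forall>j. ((\<lambda>x. g x $ j) has_derivative D j) (at x)"
    using assms unfolding differentiable_def by metis
  then obtain D where D: "\<And>j. ((\<lambda>x. g x $ j) has_derivative D j) (at x)" by auto
  have "(g has_derivative (\<lambda>h. \<chi> j. D j h)) (at x)"
    using D by (intro has_derivative_vec_components) simp
  then show ?thesis unfolding differentiable_def by blast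
qed

lemma partial_deriv_component:
  assumes "(g has_derivative g') (at x)"
  shows "partial_deriv i (\<lambda>x. g x $ j) x = g' (axis i 1) $ j"
  using bounded_linear.has_derivative[OF bounded_linear_vec_nth assms]
  by (rule partial_deriv_eqI)

lemma partial_deriv_compose:
  fixes g :: "real^'m::finite \<Rightarrow> real^'k::finite" and f :: "real^'k \<Rightarrow> real"
  assumes "g differentiable at x" "f differentiable at (g x)"
  shows "partial_deriv i (\<lambda>x. f (g x)) x
    = (\<Sum>j\<in>UNIV. partial_deriv j f (g x) * partial_deriv i (\<lambda>x. g x $ j) x)"
proof -
  obtain g' where g': "(g has_derivative g') (at x)" using assms(1) differentiable_def by blast
  note c = diff_chain_at[OF g' has_derivative_partial_deriv[OF assms(2)]]
  show ?thesis
    using partial_deriv_eqI[OF c[unfolded o_def]] partial_deriv_component[OF g']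
    by (simp add: mult.commute)
qed

lemma partial_deriv_compose_real:
  fixes g :: "real^'m::finite \<Rightarrow> real"
  assumes "g differentiable at x" "(h has_real_derivative h') (at (g x))"
  shows "partial_deriv i (\<lambda>x. h (g x)) x = h' * partial_deriv i g x"
    and "(\<lambda>x. h (g x)) differentiable at x"
proof -
  have "(h has_derivative (\<lambda>y. h' * y)) (at (g x))" using assms(2) has_field_derivative_def by blast
  note c = diff_chain_at[OF assms(1)[unfolded frechet_derivative_works] this, unfolded o_def]
  show "partial_deriv i (\<lambda>x. h (g x)) x = h' * partial_deriv i g x"
    using partial_deriv_eqI[OF c] by (simp add: partial_deriv_def)
  show "(\<lambda>x. h (g x)) differentiable at x"
    using c differentiable_def by blast
qed

text \<open>\<open>smooth_on\<close> quantifies over all lists of directions at once and offers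
  nothing to induct on. Bounding the order allows closure proofs by induction on \<open>k\<close>,
  with the function arbitrary because the step passes to its partial derivatives.\<close>

primrec Ck :: "nat \<Rightarrow> (real^'m::finite) set \<Rightarrow> (real^'m \<Rightarrow> real) \<Rightarrow> bool" where
  "Ck 0 U f \<longleftrightarrow> f differentiable_on U"
| "Ck (Suc k) U f \<longleftrightarrow> f differentiable_on U \<and> (\<forall>i. Ck k U (partial_deriv i f))"

text \<open>\<open>foldr\<close> applies the last entry of the list first, and \<open>Ck\<close>
  peels off the derivative that is taken first. The induction step therefore splits lists as
  \<open>is @ [i]\<close>.\<close>

lemma Ck_iff: "Ck k U f \<longleftrightarrow> (\<forall>is. length is \<le> k \<longrightarrow> foldr partial_deriv is f differentiable_on U)"
proof (induction k arbitrary: f)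
  case (Suc k)
  have "(\<forall>is. length is \<le> Suc k \<longrightarrow> foldr partial_deriv is f differentiable_on U) \<longleftrightarrow>
    f differentiable_on U \<and>
    (\<forall>i is. length is \<le> k \<longrightarrow> foldr partial_deriv (is @ [i]) f differentiable_on U)" (is "?L \<longleftrightarrow> ?R")
  proof
    assume L: ?L
    show ?R
      using L[rule_format, of "[]"] L[rule_format, of "_ @ [_]"] by auto
  next
    assume R: ?R
    show ?L
    proof (intro allI impI)
      fix "is" :: "'a list" assume "length is \<le> Suc k"
      then show "foldr partial_deriv is f differentiable_on U"
        using R by (cases "is" rule: rev_cases) auto
    qed
  qed
  then show ?case using Suc by simp
qed auto

lemma smooth_on_iff_Ck: "smooth_on U f \<longleftrightarrow> (\<forall>k. Ck k U f)"
  unfolding smooth_on_def Ck_iff by blast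

lemma smooth_on_differentiable: "smooth_on U f \<Longrightarrow> f differentiable_on U"
  unfolding smooth_on_iff_Ck by (metis Ck.simps(1))

lemma smooth_on_differentiable_at: "smooth_on U f \<Longrightarrow> open U \<Longrightarrow> x \<in> U \<Longrightarrow> f differentiable at x"
  using smooth_on_differentiable differentiable_on_openD by blast

lemma smooth_on_continuous: "smooth_on U f \<Longrightarrow> continuous_on U f"
  using smooth_on_differentiable differentiable_imp_continuous_on by blast

lemma smooth_on_partial_deriv: "smooth_on U f \<Longrightarrow> smooth_on U (partial_deriv i f)"
  unfolding smooth_on_iff_Ck by (metis Ck.simps(2))

lemma Ck_Suc_imp: "Ck (Suc k) U f \<Longrightarrow> Ck k U f"
  by (induction k arbitrary: f) auto

lemma Ck_cong:
  assumes "open U" "Ck k U f" "\<And>x. x \<in> U \<Longrightarrow> f x = g x"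
  shows "Ck k U g"
  using assms(2,3)
proof (induction k arbitrary: f g)
  case 0
  then show ?case using differentiable_on_cong[of U f g] by simp
next
  case (Suc k)
  have "Ck k U (partial_deriv i g)" for i
  proof (rule Suc.IH[of "partial_deriv i f"])
    show "Ck k U (partial_deriv i f)" using Suc.prems by simp
    show "partial_deriv i f x = partial_deriv i g x" if "x \<in> U" for x
      using partial_deriv_cong[OF assms(1) that] Suc.prems(2) by blast
  qed
  then show ?case using Suc.prems differentiable_on_cong[of U f g] by simp
qed

lemma smooth_on_cong:
  assumes "open U" "\<And>x. x \<in> U \<Longrightarrow> f x = g x"
  shows "smooth_on U f \<longleftrightarrow> smooth_on U g"
  unfolding smooth_on_iff_Ck using Ck_cong[OF assms(1)] assms(2) by metis

lemma Ck_subset: "Ck k U f \<Longrightarrow> V \<subseteq> U \<Longrightarrow> Ck k V f"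
  by (induction k arbitrary: f) (auto intro: differentiable_on_subset)

lemma smooth_on_subset: "smooth_on U f \<Longrightarrow> V \<subseteq> U \<Longrightarrow> smooth_on V f"
  unfolding smooth_on_iff_Ck using Ck_subset by blast

lemma smooth_on_Un:
  assumes "open U" "open V" "smooth_on U f" "smooth_on V f"
  shows "smooth_on (U \<union> V) f"
  using assms unfolding smooth_on_def differentiable_on_def
  by (metis UnE at_within_open open_Un)

lemma Ck_const: "Ck k U (\<lambda>_. a)"
proof (induction k arbitrary: a)
  case (Suc k)
  have "partial_deriv i (\<lambda>_::real^'a. a) = (\<lambda>_. 0)" for i
    by (rule ext) (rule partial_deriv_const)
  then show ?case using Suc by simp
qed simp

lemma Ck_add:
  assumes "open U" "Ck k U f" "Ck k U g"
  shows "Ck k U (\<lambda>x. f x + g x)"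
  using assms(2,3)
proof (induction k arbitrary: f g)
  case (Suc k)
  have "Ck k U (partial_deriv i (\<lambda>x. f x + g x))" for i
  proof (rule Ck_cong[OF assms(1)])
    show "Ck k U (\<lambda>x. partial_deriv i f x + partial_deriv i g x)"
      using Suc by (intro Suc.IH) auto
  qed (use Suc.prems assms(1) in \<open>auto simp: partial_deriv_add differentiable_on_openD\<close>)
  then show ?case using Suc.prems by simp
qed simp

lemma Ck_mult:
  assumes "open U" "Ck k U f" "Ck k U g"
  shows "Ck k U (\<lambda>x. f x * g x)"
  using assms(2,3)
proof (induction k arbitrary: f g)
  case (Suc k)
  have "Ck k U (partial_deriv i (\<lambda>x. f x * g x))" for i
  proof (rule Ck_cong[OF assms(1)])
    show "Ck k U (\<lambda>x. f x * partial_deriv i g x + partial_deriv i f x * g x)"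
      using Suc.prems Suc.prems[THEN Ck_Suc_imp] by (intro Ck_add Suc.IH assms(1)) auto
  qed (use Suc.prems assms(1) in \<open>auto simp: partial_deriv_mult differentiable_on_openD\<close>)
  then show ?case using Suc.prems by simp
qed simp

lemma Ck_sum:
  assumes "open U" "\<And>j. j \<in> J \<Longrightarrow> Ck k U (f j)"
  shows "Ck k U (\<lambda>x. \<Sum>j\<in>J. f j x)"
  using assms(2) by (induction J rule: infinite_finite_induct) (auto simp: Ck_const intro!: Ck_add assms(1))

text \<open>By the chain rule each partial derivative is a sum of products of a composition with the
  same \<open>g\<close> and a derivative of a component of \<open>g\<close>. Only the outer function
  changes, so it is the one generalised in the induction.\<close>

lemma Ck_compose:
  fixes g :: "real^'m::finite \<Rightarrow> real^'k::finite"
  assumes "open U" "open V" "Ck k V f" "\<And>j. Ck k U (\<lambda>x. g x $ j)" "g ` U \<subseteq> V"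
  shows "Ck k U (\<lambda>x. f (g x))"
  using assms(3,4)
proof (induction k arbitrary: f)
  case (0 f)
  have dg: "g differentiable at x" if "x \<in> U" for x
    using 0(2) assms(1) that by (auto intro!: differentiable_vec_components intro: differentiable_on_openD)
  have df: "f differentiable at y" if "y \<in> V" for y
    using 0(1) assms(2) that differentiable_on_openD by auto
  show ?case
    using differentiable_chain_at[OF dg df, unfolded o_def] assms(5)
    by (auto simp: image_subset_iff differentiable_on_def at_within_open[OF _ assms(1)])
next
  case (Suc k)
  have dg: "g differentiable at x" if "x \<in> U" for x
    using Suc.prems(2) assms(1) that by (auto intro!: differentiable_vec_components intro: differentiable_on_openD)
  have df: "f differentiable at y" if "y \<in> V" for y
    using Suc.prems(1) assms(2) that differentiable_on_openD by auto
  have "Ck k U (partial_deriv i (\<lambda>x. f (g x)))" for i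
  proof (rule Ck_cong[OF assms(1)])
    show "Ck k U (\<lambda>x. \<Sum>j\<in>UNIV. partial_deriv j f (g x) * partial_deriv i (\<lambda>x. g x $ j) x)"
    proof (intro Ck_sum Ck_mult assms(1))
      show "Ck k U (\<lambda>x. partial_deriv j f (g x))" for j
        by (rule Suc.IH) (use Suc.prems(1) Suc.prems(2)[THEN Ck_Suc_imp] in auto)
      show "Ck k U (partial_deriv i (\<lambda>x. g x $ j))" for j
        using Suc.prems(2)[of j] by simp
    qed
  qed (use dg df assms(5) in \<open>auto simp: partial_deriv_compose\<close>)
  moreover have "(\<lambda>x. f (g x)) differentiable_on U"
    using differentiable_chain_at[OF dg df, unfolded o_def] assms(5)
    by (auto simp: image_subset_iff differentiable_on_def at_within_open[OF _ assms(1)])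
  ultimately show ?case by simp
qed

text \<open>A single outer function does not survive the induction, since its derivative is a
  different one. A sequence closed under differentiation, each derivative being a combination of the
  next two members, covers both applications: powers with shifted exponents, where \<open>b\<close>
  is zero, and \<open>flat_fun\<close>.\<close>

lemma Ck_compose_real:
  fixes g :: "real^'m::finite \<Rightarrow> real" and h :: "nat \<Rightarrow> real \<Rightarrow> real"
  assumes "open U" "Ck k U g" "g ` U \<subseteq> W"
    and h: "\<And>n y. y \<in> W \<Longrightarrow> (h n has_real_derivative (a n * h (Suc n) y + b n * h (Suc (Suc n)) y)) (at y)"
  shows "Ck k U (\<lambda>x. h n (g x))"
  using assms(2)
proof (induction k arbitrary: n)
  case (0 n)
  have dg: "g differentiable at x" if "x \<in> U" for x
    using 0 assms(1) that differentiable_on_openD by auto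
  show ?case
    using partial_deriv_compose_real(2)[OF dg h] assms(3)
    by (auto simp: image_subset_iff differentiable_on_def at_within_open[OF _ assms(1)])
next
  case (Suc k)
  have dg: "g differentiable at x" if "x \<in> U" for x
    using Suc.prems(1) assms(1) that differentiable_on_openD by auto
  have "Ck k U (partial_deriv i (\<lambda>x. h n (g x)))" for i
  proof (rule Ck_cong[OF assms(1)])
    show "Ck k U (\<lambda>x. (a n * h (Suc n) (g x) + b n * h (Suc (Suc n)) (g x)) * partial_deriv i g x)"
      using Suc.prems Suc.prems[THEN Ck_Suc_imp]
      by (intro Ck_mult Ck_add Ck_const Suc.IH assms(1)) auto
  qed (use assms(3) partial_deriv_compose_real(1)[OF dg h] in \<open>auto simp: image_subset_iff\<close>)
  moreover have "(\<lambda>x. h n (g x)) differentiable_on U"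
    using partial_deriv_compose_real(2)[OF dg h] assms(3)
    by (auto simp: image_subset_iff differentiable_on_def at_within_open[OF _ assms(1)])
  ultimately show ?case by simp
qed

lemma Ck_nth: "Ck k U (\<lambda>x. x $ j)"
proof (cases k)
  case (Suc k)
  have "partial_deriv i (\<lambda>x. x $ j) = (\<lambda>_. if i = j then 1 else 0)" for i
    by (rule ext) (rule partial_deriv_nth)
  then show ?thesis using Suc by (simp add: Ck_const bounded_linear_vec_nth bounded_linear_imp_differentiable_on)
qed (simp add: bounded_linear_vec_nth bounded_linear_imp_differentiable_on)

lemma smooth_on_const: "smooth_on U (\<lambda>_. a)"
  by (simp add: smooth_on_iff_Ck Ck_const)

lemma smooth_on_nth: "smooth_on U (\<lambda>x. x $ j)"
  by (simp add: smooth_on_iff_Ck Ck_nth)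

lemma smooth_on_add: "open U \<Longrightarrow> smooth_on U f \<Longrightarrow> smooth_on U g \<Longrightarrow> smooth_on U (\<lambda>x. f x + g x)"
  by (simp add: smooth_on_iff_Ck Ck_add)

lemma smooth_on_mult: "open U \<Longrightarrow> smooth_on U f \<Longrightarrow> smooth_on U g \<Longrightarrow> smooth_on U (\<lambda>x. f x * g x)"
  by (simp add: smooth_on_iff_Ck Ck_mult)

lemma smooth_on_diff:
  "open U \<Longrightarrow> smooth_on U f \<Longrightarrow> smooth_on U g \<Longrightarrow> smooth_on U (\<lambda>x. f x - g x)"
  using smooth_on_add[of U f "\<lambda>x. (-1) * g x"] smooth_on_mult[of U "\<lambda>_. -1" g] smooth_on_const[of U "-1"]
  by simp

lemma smooth_on_sum:
  "open U \<Longrightarrow> (\<And>j. j \<in> J \<Longrightarrow> smooth_on U (f j)) \<Longrightarrow> smooth_on U (\<lambda>x. \<Sum>j\<in>J. f j x)"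
  by (simp add: smooth_on_iff_Ck Ck_sum)

lemma smooth_on_prod:
  assumes "open U" "\<And>j. j \<in> J \<Longrightarrow> smooth_on U (f j)"
  shows "smooth_on U (\<lambda>x. \<Prod>j\<in>J. f j x)"
  using assms(2)
  by (induction J rule: infinite_finite_induct) (auto simp: smooth_on_const intro!: smooth_on_mult assms(1))

lemma smooth_on_compose:
  fixes g :: "real^'m::finite \<Rightarrow> real^'k::finite"
  assumes "open U" "open V" "smooth_on V f" "\<And>j. smooth_on U (\<lambda>x. g x $ j)" "g ` U \<subseteq> V"
  shows "smooth_on U (\<lambda>x. f (g x))"
  using assms Ck_compose[of U V _ f g] by (simp add: smooth_on_iff_Ck)

lemma smooth_on_powr:
  assumes "open U" "smooth_on U g" "\<And>x. x \<in> U \<Longrightarrow> g x > 0"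
  shows "smooth_on U (\<lambda>x. g x powr r)"
proof -
  have "((\<lambda>y. y powr (r - real n)) has_real_derivative
      ((r - real n) * y powr (r - real (Suc n)) + 0 * y powr (r - real (Suc (Suc n))))) (at y)"
    if "y \<in> {0<..}" for n y
    using that by (auto intro!: derivative_eq_intros simp: algebra_simps)
  then have "Ck k U (\<lambda>x. g x powr (r - real 0))" for k
    using assms by (intro Ck_compose_real[where W = "{0<..}" and
      h = "\<lambda>n y. y powr (r - real n)" and a = "\<lambda>n. r - real n" and b = "\<lambda>_. 0"])
      (auto simp: smooth_on_iff_Ck)
  then show ?thesis by (simp add: smooth_on_iff_Ck)
qed

lemma smooth_on_det:
  fixes M :: "real^'m::finite \<Rightarrow> real^'k::finite^'k"
  assumes "open U" "\<And>i j. smooth_on U (\<lambda>x. M x $ i $ j)"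
  shows "smooth_on U (\<lambda>x. det (M x))"
  unfolding det_def
  by (intro smooth_on_sum smooth_on_mult smooth_on_const smooth_on_prod assms)

lemmas smooth_on_intros = smooth_on_const smooth_on_nth smooth_on_add smooth_on_mult smooth_on_diff
  smooth_on_sum smooth_on_partial_deriv

section \<open>Compactly supported functions\<close>

text \<open>Values outside \<open>V\<close> are ignored: coordinate expressions are meaningful only
  on the image of their chart and arbitrary elsewhere.\<close>

definition compact_support :: "(real^'m::finite) set \<Rightarrow> (real^'m \<Rightarrow> real) \<Rightarrow> bool" where
  "compact_support V g \<longleftrightarrow> (\<exists>K. compact K \<and> K \<subseteq> V \<and> (\<forall>x\<in>V - K. g x = 0))"

lemma compact_support_mult:
  "compact_support V f \<Longrightarrow> compact_support V (\<lambda>x. f x * g x)"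
  "compact_support V g \<Longrightarrow> compact_support V (\<lambda>x. f x * g x)"
  unfolding compact_support_def by force+

lemma compact_support_add:
  assumes "compact_support V f" "compact_support V g"
  shows "compact_support V (\<lambda>x. f x + g x)"
proof -
  obtain K L where "compact K" "K \<subseteq> V" "\<forall>x\<in>V - K. f x = 0" "compact L" "L \<subseteq> V" "\<forall>x\<in>V - L. g x = 0"
    using assms unfolding compact_support_def by metis
  then show ?thesis unfolding compact_support_def by (intro exI[of _ "K \<union> L"]) auto
qed

lemma compact_support_0: "(\<And>x. x \<in> V \<Longrightarrow> f x = 0) \<Longrightarrow> compact_support V f"
  unfolding compact_support_def by (intro exI[of _ "{}"]) auto

lemma compact_support_sum:
  "(\<And>j. j \<in> J \<Longrightarrow> compact_support V (f j)) \<Longrightarrow> compact_support V (\<lambda>x. \<Sum>j\<in>J. f j x)"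
proof (induction J rule: infinite_finite_induct)
  case (insert j J)
  then have "compact_support V (\<lambda>x. f j x + (\<Sum>j\<in>J. f j x))"
    by (intro compact_support_add) auto
  then show ?case using insert by simp
qed (auto intro: compact_support_0)

lemma compact_support_cong:
  "(\<And>x. x \<in> V \<Longrightarrow> f x = g x) \<Longrightarrow> compact_support V f \<longleftrightarrow> compact_support V g"
  unfolding compact_support_def by (metis DiffD1)

lemma compact_support_partial_deriv:
  assumes "open V" "compact_support V f"
  shows "compact_support V (partial_deriv i f)"
proof -
  obtain K where K: "compact K" "K \<subseteq> V" "\<forall>x\<in>V - K. f x = 0"
    using assms unfolding compact_support_def by metis
  have "partial_deriv i f x = 0" if "x \<in> V - K" for x
  proof -
    have "open (V - K)" using assms(1) K(1) by (simp add: compact_imp_closed open_Diff)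
    then have "partial_deriv i f x = partial_deriv i (\<lambda>_. 0) x"
      by (rule partial_deriv_cong[OF _ that]) (use K(3) in auto)
    then show ?thesis by (simp add: partial_deriv_const)
  qed
  with K show ?thesis unfolding compact_support_def by auto
qed

section \<open>Integrals of compactly supported functions and of their derivatives\<close>

lemma integral_eq_support:
  fixes g :: "'a::euclidean_space \<Rightarrow> real"
  assumes "K \<subseteq> V" "\<And>x. x \<in> V - K \<Longrightarrow> g x = 0"
  shows "integral V g = integral K g"
proof -
  have "(\<lambda>x. if x \<in> V then g x else 0) = (\<lambda>x. if x \<in> K then g x else 0)"
    using assms by fastforce
  then show ?thesis
    by (metis Henstock_Kurzweil_Integration.integral_restrict_UNIV)
qed

lemma absolutely_integrable_compact_support:
  assumes "continuous_on V g" "compact_support V g"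
  shows "g absolutely_integrable_on V"
proof -
  obtain K where K: "compact K" "K \<subseteq> V" "\<forall>x\<in>V - K. g x = 0"
    using assms unfolding compact_support_def by metis
  have "integrable lborel (\<lambda>x. indicator K x *\<^sub>R g x)"
    using K assms(1) by (intro borel_integrable_compact) (auto intro: continuous_on_subset)
  then have "integrable lebesgue (\<lambda>x. indicator K x *\<^sub>R g x)"
    by (intro integrable_completion[THEN iffD2]) auto
  moreover have "(\<lambda>x. indicator K x *\<^sub>R g x) = (\<lambda>x. indicator V x *\<^sub>R g x)"
    using K by (auto simp: indicator_def fun_eq_iff)
  ultimately show ?thesis unfolding set_integrable_def by simp
qed

lemma integrable_compact_support:
  "continuous_on V g \<Longrightarrow> compact_support V g \<Longrightarrow> g integrable_on V"
  by (simp add: absolutely_integrable_compact_support set_lebesgue_integral_eq_integral(1))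

text \<open>\<open>V\<close> and the complement of \<open>K\<close> are open and cover the space; on
  the first the extension is \<open>g\<close>, on the second it is 0.\<close>

lemma smooth_on_extend_zero:
  fixes g :: "real^'m::finite \<Rightarrow> real"
  assumes "open V" "smooth_on V g" "closed K" "K \<subseteq> V" "\<And>x. x \<in> V - K \<Longrightarrow> g x = 0"
  shows "smooth_on UNIV (\<lambda>x. if x \<in> V then g x else 0)"
proof -
  let ?g = "\<lambda>x. if x \<in> V then g x else 0"
  have "smooth_on V ?g" using smooth_on_cong[of V g ?g] assms by auto
  moreover have "smooth_on (- K) ?g"
    using smooth_on_cong[of "- K" "\<lambda>_. 0" ?g] assms smooth_on_const[of "- K" 0] by (auto simp: open_Compl)
  ultimately have "smooth_on (V \<union> - K) ?g" using assms by (intro smooth_on_Un) auto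
  moreover have "V \<union> - K = UNIV" using assms by auto
  ultimately show ?thesis by simp
qed

text \<open>The integrals of the translates of a compactly supported function do not depend on the
  translation; differentiate them under the integral sign.\<close>

lemma integral_partial_deriv_UNIV_eq_0:
  fixes g :: "real^'m::finite \<Rightarrow> real"
  assumes g: "smooth_on UNIV g" and K: "compact K" "\<And>x. x \<notin> K \<Longrightarrow> g x = 0"
  shows "integral UNIV (partial_deriv i g) = 0"
proof -
  let ?e = "axis i (1::real)"
  \<comment> \<open>Shifts of length at most 1 move the support only within \<open>L\<close>, so a
    single box serves all translates that occur.\<close>
  define L where "L = {x + y |x y. x \<in> K \<and> y \<in> cball 0 1}"
  have "compact L" unfolding L_def using K compact_cball by (intro compact_sums)
  then obtain b where b: "L \<subseteq> cbox (- b) b"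
    using bounded_subset_cbox_symmetric compact_imp_bounded by metis
  have L: "g (x + h *\<^sub>R ?e) = 0" if "x \<notin> cbox (-b) b" "\<bar>h\<bar> \<le> 1" for x h
  proof (rule ccontr)
    assume "g (x + h *\<^sub>R ?e) \<noteq> 0"
    then have "x + h *\<^sub>R ?e \<in> K" using K by blast
    moreover have "- (h *\<^sub>R ?e) \<in> cball 0 1" using that(2) by simp
    ultimately have "(x + h *\<^sub>R ?e) + - (h *\<^sub>R ?e) \<in> L" unfolding L_def by blast
    then show False using that b by auto
  qed
  have KL: "K \<subseteq> cbox (-b) b" using L[of _ 0] b unfolding L_def by (force)
  let ?F = "\<lambda>h. integral (cbox (-b) b) (\<lambda>x. g (x + h *\<^sub>R ?e))"
  have const: "?F h = integral UNIV g" if "h \<in> ball 0 1" for h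
  proof -
    let ?C = "cbox (- b + h *\<^sub>R ?e) (b + h *\<^sub>R ?e)"
    have "?F h = integral ?C g"
      using integral_shift_cbox_plus[of "-b" b g "h *\<^sub>R ?e"] by (simp add: o_def add.commute)
    also have "\<dots> = integral UNIV g"
    proof (rule integral_eq_support[symmetric])
      fix x assume "x \<in> UNIV - ?C"
      then have "x - h *\<^sub>R ?e \<notin> cbox (-b) b"
        by (auto simp: mem_box_cart algebra_simps not_le)
      from L[OF this, of h] that show "g x = 0" by simp
    qed simp
    finally show ?thesis .
  qed
  have dg: "g differentiable at x" for x using g smooth_on_differentiable_at by blast
  have cont: "continuous_on UNIV g" "continuous_on UNIV (partial_deriv i g)"
    using g smooth_on_continuous smooth_on_partial_deriv by blast+
  have "(?F has_field_derivative integral (cbox (-b) b) (\<lambda>x. partial_deriv i g (x + 0 *\<^sub>R ?e))) (at 0 within ball 0 1)"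
  proof (rule leibniz_rule_field_derivative)
    show "((\<lambda>h. g (x + h *\<^sub>R ?e)) has_field_derivative partial_deriv i g (x + h *\<^sub>R ?e)) (at h within ball 0 1)" for x h
    proof -
      have "((\<lambda>h. x + h *\<^sub>R ?e) has_derivative (\<lambda>k. k *\<^sub>R ?e)) (at h)"
        by (auto intro!: derivative_eq_intros)
      from diff_chain_at[OF this has_derivative_partial_deriv[OF dg]]
      have "((\<lambda>h. g (x + h *\<^sub>R ?e)) has_derivative
          (\<lambda>k. \<Sum>j\<in>UNIV. (k *\<^sub>R ?e) $ j * partial_deriv j g (x + h *\<^sub>R ?e))) (at h)"
        by (simp add: o_def)
      moreover have "(\<Sum>j\<in>UNIV. (k *\<^sub>R ?e) $ j * partial_deriv j g y) = partial_deriv i g y * k" for k y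
      proof -
        have "(\<Sum>j\<in>UNIV. (k *\<^sub>R ?e) $ j * partial_deriv j g y)
          = (\<Sum>j\<in>UNIV. if j = i then partial_deriv j g y * k else 0)"
          by (intro sum.cong) (auto simp: axis_def)
        then show ?thesis by simp
      qed
      ultimately show ?thesis
        by (simp add: has_field_derivative_def has_derivative_at_withinI)
    qed
    show "(\<lambda>x. g (x + h *\<^sub>R ?e)) integrable_on cbox (-b) b" for h
      by (intro integrable_continuous continuous_on_compose2[OF cont(1)] continuous_intros) auto
    show "continuous_on (ball 0 1 \<times> cbox (- b) b) (\<lambda>(h, x). partial_deriv i g (x + h *\<^sub>R ?e))"
      unfolding split_beta
      by (intro continuous_on_compose2[OF cont(2)] continuous_intros) auto
  qed auto
  moreover have "at (0::real) within ball 0 1 = at 0" by (rule at_within_open) auto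
  ultimately have "(?F has_field_derivative integral (cbox (-b) b) (partial_deriv i g)) (at 0)"
    by (simp only: scaleR_zero_left add_0_right)
  moreover have "(?F has_field_derivative 0) (at 0)"
    by (rule has_field_derivative_transform_within_open[OF DERIV_const[of "integral UNIV g"], where S = "ball 0 1"])
      (use const in auto)
  ultimately have "integral (cbox (-b) b) (partial_deriv i g) = 0"
    using DERIV_unique by blast
  moreover have "integral UNIV (partial_deriv i g) = integral (cbox (-b) b) (partial_deriv i g)"
  proof (rule integral_eq_support)
    fix x assume "x \<in> UNIV - cbox (-b) b"
    then have x: "x \<in> - cbox (-b) b" by simp
    have "partial_deriv i g x = partial_deriv i (\<lambda>_. 0) x"
      by (rule partial_deriv_cong[OF _ x]) (use K KL in auto)
    then show "partial_deriv i g x = 0" by (simp add: partial_deriv_const)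
  qed simp
  ultimately show ?thesis by simp
qed

lemma integral_partial_deriv_eq_0:
  assumes "open V" "smooth_on V g" "compact_support V g"
  shows "integral V (partial_deriv i g) = 0"
proof -
  obtain K where K: "compact K" "K \<subseteq> V" "\<forall>x\<in>V - K. g x = 0"
    using assms unfolding compact_support_def by metis
  let ?g = "\<lambda>x. if x \<in> V then g x else 0"
  have s: "smooth_on UNIV ?g"
    using assms K by (intro smooth_on_extend_zero[of V g K]) (auto simp: compact_imp_closed)
  have d: "partial_deriv i ?g x = (if x \<in> V then partial_deriv i g x else 0)" for x
  proof (cases "x \<in> V")
    case True
    then show ?thesis using partial_deriv_cong[OF assms(1) True, of ?g g] by auto
  next
    case False
    then have x: "x \<in> - K" using K by auto
    have "partial_deriv i ?g x = partial_deriv i (\<lambda>_. 0) x"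
      by (rule partial_deriv_cong[OF _ x]) (use K in \<open>auto simp: compact_imp_closed open_Compl\<close>)
    then show ?thesis using False by (simp add: partial_deriv_const)
  qed
  have "integral UNIV (partial_deriv i ?g) = 0"
    using s K by (intro integral_partial_deriv_UNIV_eq_0[of _ K]) auto
  moreover have "partial_deriv i ?g = (\<lambda>x. if x \<in> V then partial_deriv i g x else 0)"
    using d by auto
  ultimately show ?thesis by (simp add: Henstock_Kurzweil_Integration.integral_restrict_UNIV)
qed

section \<open>Flat functions, bump functions and the fundamental lemma of the calculus of
  variations\<close>

definition flat_fun :: "nat \<Rightarrow> real \<Rightarrow> real" where
  "flat_fun n y = (if y > 0 then (1 / y) ^ n * exp (- (1 / y)) else 0)"

lemma flat_fun_tendsto_0: "(flat_fun n \<longlongrightarrow> 0) (at 0)"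
proof -
  have "((\<lambda>y::real. y ^ n / exp y) \<longlongrightarrow> 0) at_top" by (rule tendsto_power_div_exp_0)
  then have "((\<lambda>y::real. (inverse y) ^ n / exp (inverse y)) \<longlongrightarrow> 0) (at_right 0)"
    by (rule filterlim_compose) (rule filterlim_inverse_at_top_right)
  then have r: "(flat_fun n \<longlongrightarrow> 0) (at_right 0)"
    by (rule Lim_transform_eventually)
      (auto simp: eventually_at_filter flat_fun_def exp_minus divide_inverse)
  have l: "(flat_fun n \<longlongrightarrow> 0) (at_left 0)"
    by (rule Lim_transform_eventually[OF tendsto_const])
      (auto simp: eventually_at_filter flat_fun_def)
  show ?thesis using l r by (simp add: filterlim_at_split)
qed

text \<open>Differentiating y^(-n) exp(-1/y) gives a combination of the members n + 1 and n + 2 of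
  the same family, which is the shape that \<open>Ck_compose_real\<close> requires. The point 0 is
  the only one where the two branches meet.\<close>

lemma flat_fun_deriv:
  "(flat_fun n has_real_derivative (- real n * flat_fun (Suc n) y + 1 * flat_fun (Suc (Suc n)) y)) (at y)"
proof -
  consider "y > 0" | "y < 0" | "y = 0" by linarith
  then show ?thesis
  proof cases
    case 1
    have "((\<lambda>y. (1 / y) ^ n * exp (- (1 / y))) has_real_derivative
      (- real n * flat_fun (Suc n) y + 1 * flat_fun (Suc (Suc n)) y)) (at y)"
    proof -
      have "((\<lambda>y. 1 / y) has_real_derivative - ((1 / y) * (1 / y))) (at y)"
        using 1 by (auto intro!: derivative_eq_intros)
      note d = DERIV_mult[OF DERIV_power[OF this] DERIV_fun_exp[OF DERIV_minus[OF this]], of n]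
      define w where "w = 1 / y"
      have "real n * (- (w * w) * w ^ (n - 1)) * exp (- w) + exp (- w) * - (- (w * w)) * w ^ n
        = - real n * (w ^ Suc n * exp (- w)) + 1 * (w ^ Suc (Suc n) * exp (- w))"
        by (cases n) (simp_all add: algebra_simps)
      then show ?thesis
        using 1 by (intro DERIV_cong[OF d]) (simp add: flat_fun_def w_def)
    qed
    then show ?thesis
      by (rule has_field_derivative_transform_within_open[of _ _ _ "{0<..}"]) (use 1 in \<open>auto simp: flat_fun_def\<close>)
  next
    case 2
    have "((\<lambda>y. 0) has_real_derivative (- real n * flat_fun (Suc n) y + 1 * flat_fun (Suc (Suc n)) y)) (at y)"
      using 2 by (simp add: flat_fun_def)
    then show ?thesis
      by (rule has_field_derivative_transform_within_open[of _ _ _ "{..<0}"]) (use 2 in \<open>auto simp: flat_fun_def\<close>)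
  next
    case 3
    \<comment> \<open>For h different from 0 the difference quotient at 0 is exactly
      \<open>flat_fun (Suc n) h\<close>.\<close>
    have "((\<lambda>h. (flat_fun n (0 + h) - flat_fun n 0) / h) \<longlongrightarrow> 0) (at 0)"
      by (rule Lim_transform_eventually[OF flat_fun_tendsto_0[of "Suc n"]])
        (auto simp: eventually_at_filter flat_fun_def)
    then have "(flat_fun n has_real_derivative 0) (at 0)" unfolding DERIV_def .
    moreover have "flat_fun k 0 = 0" for k by (simp add: flat_fun_def)
    ultimately show ?thesis using 3 by simp
  qed
qed

lemma smooth_on_flat_fun:
  assumes "open U" "smooth_on U g"
  shows "smooth_on U (\<lambda>x. flat_fun n (g x))"
  using assms Ck_compose_real[of U _ g UNIV flat_fun "\<lambda>n. - real n" "\<lambda>_. 1", OF _ _ _ flat_fun_deriv]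
  by (auto simp: smooth_on_iff_Ck)

text \<open>The usual quotient f(a) / (f(a) + f(1 - a)), where f(y) is exp(-1/y) for positive y and
  0 otherwise. The denominator is positive because a and 1 - a are never both non-positive. Division
  is written as a power with exponent -1, so that \<open>smooth_on_powr\<close> applies.\<close>

lemma bump_function:
  fixes x0 :: "real^'m::finite"
  assumes "open V" "x0 \<in> V"
  obtains \<phi> r where "r > 0" "smooth_on UNIV \<phi>" "\<And>x. 0 \<le> \<phi> x" "\<And>x. x \<in> cball x0 r \<Longrightarrow> \<phi> x = 1"
    "cball x0 (2 * r) \<subseteq> V" "\<And>x. x \<notin> cball x0 (2 * r) \<Longrightarrow> \<phi> x = 0"
proof -
  obtain e where e: "e > 0" "cball x0 e \<subseteq> V" using assms open_contains_cball by blast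
  define r where "r = e / 2"
  have r: "r > 0" "2 * r = e" using e by (auto simp: r_def)
  \<comment> \<open>The squared distance is a polynomial and hence smooth at \<open>x0\<close> as
    well. With the constant 2, a is at least 1 on the ball of radius r, where f(1 - a) vanishes, and
    negative outside the ball of radius 2 r, where f(a) vanishes.\<close>
  define a where "a = (\<lambda>x::real^'m. 2 - (1 / r\<^sup>2) * (\<Sum>j\<in>UNIV. (x $ j - x0 $ j) * (x $ j - x0 $ j)))"
  have a: "a x = 2 - (dist x0 x / r)\<^sup>2" for x
    by (simp add: a_def dist_norm norm_vec_def L2_set_def sum_nonneg power_divide
        norm_minus_commute[of x0 x] power2_eq_square[symmetric] power2_commute[of "x $ _"])
  define N where "N = (\<lambda>x. flat_fun 0 (a x) + flat_fun 0 (1 - a x))"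
  define \<phi> where "\<phi> = (\<lambda>x. flat_fun 0 (a x) * N x powr (-1))"
  have nn: "flat_fun 0 y \<ge> 0" for y by (simp add: flat_fun_def)
  have N: "N x > 0" for x
  proof (cases "a x > 0")
    case True
    then show ?thesis using nn[of "1 - a x"] by (simp add: N_def flat_fun_def add_pos_nonneg)
  qed (use nn in \<open>simp add: N_def flat_fun_def\<close>)
  have sa: "smooth_on UNIV a"
    unfolding a_def by (intro smooth_on_intros open_UNIV)
  have sN: "smooth_on UNIV N"
    unfolding N_def by (intro smooth_on_flat_fun smooth_on_intros sa open_UNIV)
  have s: "smooth_on UNIV \<phi>"
    unfolding \<phi>_def by (intro smooth_on_mult smooth_on_flat_fun sa smooth_on_powr sN open_UNIV) (rule N)
  have ge: "\<phi> x \<ge> 0" for x using nn by (simp add: \<phi>_def)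
  have one: "\<phi> x = 1" if "x \<in> cball x0 r" for x
  proof -
    have "dist x0 x / r \<le> 1" using that r by simp
    then have "(dist x0 x / r)\<^sup>2 \<le> 1" using r power_mono[of "dist x0 x / r" 1 2] by simp
    then have "a x \<ge> 1" by (simp add: a)
    then have "N x = flat_fun 0 (a x)" by (simp add: N_def flat_fun_def)
    then show ?thesis using N[of x] by (simp add: \<phi>_def powr_minus)
  qed
  have zero: "\<phi> x = 0" if "x \<notin> cball x0 (2 * r)" for x
  proof -
    have "dist x0 x / r \<ge> 2" using that r by (simp add: field_simps)
    then have "(dist x0 x / r)\<^sup>2 \<ge> 4" using power_mono[of 2 "dist x0 x / r" 2] by simp
    then show ?thesis by (simp add: \<phi>_def flat_fun_def a)
  qed
  show ?thesis by (rule that[of r \<phi>]) (use s r e ge one zero in auto)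
qed

text \<open>Squares are the test functions that arise from pairing a function with itself, and they
  are non-negative. A bump supported where \<open>h\<close> is positive gives a continuous
  non-negative integrand with integral 0, which must vanish at \<open>x0\<close> although both
  factors are positive there.\<close>

lemma fundamental_lemma_pos:
  fixes h :: "real^'m::finite \<Rightarrow> real"
  assumes V: "open V" and h: "continuous_on V h"
    and z: "\<And>\<phi>. smooth_on UNIV \<phi> \<Longrightarrow> compact_support V \<phi> \<Longrightarrow> integral V (\<lambda>x. h x * (\<phi> x * \<phi> x)) = 0"
    and x0: "x0 \<in> V"
  shows "h x0 \<le> 0"
proof (rule ccontr)
  assume "\<not> h x0 \<le> 0"
  define U where "U = {x \<in> V. h x \<in> {0<..}}"
  have U: "open U" unfolding U_def using continuous_open_preimage[OF h V, of "{0<..}"]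
    by (simp add: vimage_def Int_def)
  have "x0 \<in> U" using \<open>\<not> h x0 \<le> 0\<close> x0 by (simp add: U_def)
  from bump_function[OF U this] obtain \<phi> r where \<phi>: "r > 0" "smooth_on UNIV \<phi>" "\<And>x. 0 \<le> \<phi> x" "\<And>x. x \<in> cball x0 r \<Longrightarrow> \<phi> x = 1"
    "cball x0 (2 * r) \<subseteq> U" "\<And>x. x \<notin> cball x0 (2 * r) \<Longrightarrow> \<phi> x = 0" by metis
  let ?g = "\<lambda>x. h x * (\<phi> x * \<phi> x)"
  have cs: "compact_support V \<phi>" unfolding compact_support_def
    by (intro exI[of _ "cball x0 (2 * r)"]) (use \<phi> in \<open>auto simp: U_def\<close>)
  have c\<phi>: "continuous_on V \<phi>" using \<phi>(2) smooth_on_continuous continuous_on_subset by blast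
  have cg: "continuous_on V ?g" by (intro continuous_intros h c\<phi>)
  have int: "?g integrable_on V"
    by (intro integrable_compact_support cg compact_support_mult cs)
  have nn: "?g x \<ge> 0" if "x \<in> V" for x
  proof (cases "x \<in> cball x0 (2 * r)")
    case True
    then show ?thesis using \<phi>(5) unfolding U_def by auto
  qed (simp add: \<phi>(6))
  \<comment> \<open>The vanishing result is applied on a box. By non-negativity the integral over a
    box inside \<open>V\<close> lies between 0 and the integral over \<open>V\<close>.\<close>
  obtain a b where ab: "x0 \<in> box a b" "cbox a b \<subseteq> V"
    using open_contains_cbox[OF x0[THEN V[THEN open_contains_cbox]]] V x0
    by (metis open_contains_cbox)
  have i0: "integral (cbox a b) ?g \<le> integral V ?g"
    using ab int nn cg by (intro integral_subset_le integrable_continuous) (auto intro: continuous_on_subset)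
  have "integral (cbox a b) ?g \<ge> 0"
    using ab nn cg by (intro integral_nonneg integrable_continuous) (auto intro: continuous_on_subset)
  then have "integral (cbox a b) ?g = 0" using i0 z[OF \<phi>(2) cs] by simp
  moreover have "?g integrable_on cbox a b"
    using ab cg by (intro integrable_continuous) (auto intro: continuous_on_subset)
  ultimately have "(?g has_integral 0) (cbox a b)" by (metis integrable_integral)
  then have "?g x0 = 0"
    using ab nn cg box_subset_cbox[of a b]
    by (intro has_integral_0_cbox_imp_0[of a b ?g]) (auto intro: continuous_on_subset)
  moreover have "\<phi> x0 = 1" using \<phi> by simp
  ultimately show False using \<open>\<not> h x0 \<le> 0\<close> by simp
qed

lemma fundamental_lemma:
  fixes h :: "real^'m::finite \<Rightarrow> real"
  assumes V: "open V" and h: "continuous_on V h"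
    and z: "\<And>\<phi>. smooth_on UNIV \<phi> \<Longrightarrow> compact_support V \<phi> \<Longrightarrow> integral V (\<lambda>x. h x * (\<phi> x * \<phi> x)) = 0"
    and x0: "x0 \<in> V"
  shows "h x0 = 0"
proof -
  have "h x0 \<le> 0" by (rule fundamental_lemma_pos[OF V h z x0])
  moreover have "- h x0 \<le> 0"
    by (rule fundamental_lemma_pos[of V "\<lambda>x. - h x", OF V _ _ x0])
      (use z h in \<open>auto intro!: continuous_intros\<close>)
  ultimately show ?thesis by simp
qed

section \<open>Change of variables\<close>

text \<open>The change of variables theorem of the library requires a well-ordered index type.\<close>

typedef (overloaded) ('n::finite) index = "{..<CARD('n)}"
  by (rule exI[of _ 0]) simp

instantiation index :: (finite) wellorder
begin

definition less_eq_index :: "'a index \<Rightarrow> 'a index \<Rightarrow> bool" where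
  "less_eq_index a b \<longleftrightarrow> Rep_index a \<le> Rep_index b"

definition less_index :: "'a index \<Rightarrow> 'a index \<Rightarrow> bool" where
  "less_index a b \<longleftrightarrow> Rep_index a < Rep_index b"

instance
proof
  show "P a" if "\<And>x. (\<And>y. y < x \<Longrightarrow> P y) \<Longrightarrow> P x" for P and a :: "'a index"
  proof (induction a rule: measure_induct_rule[of Rep_index])
    case (less a)
    show ?case by (rule that) (use less in \<open>simp add: less_index_def\<close>)
  qed
qed (auto simp: less_eq_index_def less_index_def Rep_index_inject)

end

instance index :: (finite) finite
proof
  have "range (Rep_index :: 'a index \<Rightarrow> nat) \<subseteq> {..<CARD('a)}" using Rep_index by auto
  then have "finite (range (Rep_index :: 'a index \<Rightarrow> nat))" using finite_subset by blast
  then show "finite (UNIV :: 'a index set)"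
    by (rule finite_imageD) (simp add: inj_on_def Rep_index_inject)
qed

definition index_of :: "'n::finite index \<Rightarrow> 'n" where
  "index_of = (SOME f. bij f)"

lemma bij_index_of: "bij (index_of :: 'n::finite index \<Rightarrow> 'n)"
proof -
  have "card (UNIV :: 'n index set) = CARD('n)"
    using type_definition.card[OF type_definition_index] by simp
  then have "\<exists>f :: 'n index \<Rightarrow> 'n. bij f"
    by (metis finite_same_card_bij finite)
  then show ?thesis unfolding index_of_def by (rule someI_ex)
qed

definition reindex :: "real^'n::finite \<Rightarrow> real^('n index)" where
  "reindex x = (\<chi> a. x $ index_of a)"

definition unindex :: "real^('n::finite index) \<Rightarrow> real^'n" where
  "unindex y = (\<chi> i. y $ inv index_of i)"

lemma index_of_inv [simp]: "index_of (inv index_of i) = i" "inv index_of (index_of a) = a"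
  by (rule surj_f_inv_f[OF bij_is_surj[OF bij_index_of]], rule inv_f_f[OF bij_is_inj[OF bij_index_of]])

lemma reindex_unindex [simp]: "reindex (unindex y) = y" "unindex (reindex x) = x"
  by (simp_all add: reindex_def unindex_def vec_eq_iff)

lemma linear_reindex: "linear reindex" "linear unindex"
  by (auto intro!: linearI simp: reindex_def unindex_def vec_eq_iff)

lemma reindex_image: "reindex ` S = {y. unindex y \<in> S}" "unindex ` T = {x. reindex x \<in> T}"
  by (force simp: image_iff)+

lemma reindex_cbox: "reindex ` cbox a b = cbox (reindex a) (reindex b)"
  "unindex ` cbox c d = cbox (unindex c) (unindex d)"
proof -
  show "reindex ` cbox a b = cbox (reindex a) (reindex b)"
    unfolding reindex_image by (auto simp: mem_box_cart reindex_def unindex_def) (metis index_of_inv)+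
  show "unindex ` cbox c d = cbox (unindex c) (unindex d)"
    unfolding reindex_image by (auto simp: mem_box_cart reindex_def unindex_def) (metis index_of_inv)+
qed

lemma continuous_reindex: "continuous_on S reindex" "continuous_on T unindex"
  by (simp_all add: linear_reindex linear_continuous_on linear_conv_bounded_linear[symmetric])

lemma content_unindex: "measure lborel (unindex ` cbox c d) = measure lborel (cbox c d)"
proof (cases "cbox c d = {}")
  case False
  then have "unindex ` cbox c d \<noteq> {}" by simp
  then have "measure lborel (unindex ` cbox c d) = (\<Prod>i\<in>UNIV. unindex d $ i - unindex c $ i)"
    unfolding reindex_cbox by (rule content_cbox_cart)
  also have "\<dots> = (\<Prod>a\<in>UNIV. unindex d $ index_of a - unindex c $ index_of a)"
    by (rule prod.reindex_bij_betw[symmetric]) (rule bij_index_of)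
  also have "\<dots> = measure lborel (cbox c d)"
    using False by (simp add: content_cbox_cart unindex_def)
  finally show ?thesis .
qed simp

text \<open>Conjugation by \<open>index_of\<close> is a sign-preserving bijection between the
  permutations of the two index types, and it matches the two Leibniz sums term by term.\<close>

lemma det_reindex:
  fixes M :: "real^'n::finite^'n"
  shows "det (\<chi> a b. M $ index_of a $ index_of b) = det M"
proof -
  let ?\<pi> = "index_of :: 'n index \<Rightarrow> 'n"
  have b: "bij_betw ?\<pi> UNIV UNIV" by (rule bij_index_of)
  define mp where "mp = map_permutation UNIV ?\<pi>"
  have mp: "mp p (?\<pi> a) = ?\<pi> (p a)" for p a
    by (simp add: mp_def map_permutation_def restrict_id_def)
  have "bij_betw mp {p. p permutes UNIV} {p. p permutes UNIV}"
    unfolding bij_betw_def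
  proof
    show "inj_on mp {p. p permutes UNIV}"
      by (rule inj_onI) (metis (no_types) mp ext index_of_inv(2))
    show "mp ` {p. p permutes UNIV} = {p. p permutes UNIV}"
    proof (intro equalityI subsetI)
      fix q assume "q \<in> mp ` {p. p permutes UNIV}"
      then show "q \<in> {p. p permutes UNIV}"
        using map_permutation_permutes[OF b] by (auto simp: mp_def)
    next
      fix q :: "'n \<Rightarrow> 'n" assume q: "q \<in> {p. p permutes UNIV}"
      let ?p = "\<lambda>a. inv ?\<pi> (q (?\<pi> a))"
      have "bij ?p"
        using bij_comp[OF bij_comp[OF bij_index_of permutes_bij] bij_imp_bij_inv[OF bij_index_of]] q
        by (simp add: o_def)
      then have "?p permutes UNIV" by (intro bij_imp_permutes) auto
      moreover have "mp ?p = q"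
      proof
        fix i
        show "mp ?p i = q i" using mp[of ?p "inv ?\<pi> i"] by simp
      qed
      ultimately show "q \<in> mp ` {p. p permutes UNIV}"
        by (intro image_eqI[where x = ?p]) auto
    qed
  qed
  then have "det M = (\<Sum>p | p permutes UNIV. of_int (sign (mp p)) * (\<Prod>i\<in>UNIV. M $ i $ mp p i))"
    unfolding det_def by (rule sum.reindex_bij_betw[symmetric])
  also have "\<dots> = (\<Sum>p | p permutes UNIV. of_int (sign p) * (\<Prod>a\<in>UNIV. M $ ?\<pi> a $ ?\<pi> (p a)))"
  proof (intro sum.cong refl)
    fix p :: "'n index \<Rightarrow> 'n index" assume p: "p \<in> {p. p permutes UNIV}"
    have "sign (mp p) = sign p"
      unfolding mp_def by (rule sign_map_permutation) (use p b in \<open>auto simp: bij_betw_def\<close>)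
    moreover have "(\<Prod>i\<in>UNIV. M $ i $ mp p i) = (\<Prod>a\<in>UNIV. M $ ?\<pi> a $ mp p (?\<pi> a))"
      by (rule prod.reindex_bij_betw[symmetric]) (rule bij_index_of)
    ultimately show "of_int (sign (mp p)) * (\<Prod>i\<in>UNIV. M $ i $ mp p i) =
        of_int (sign p) * (\<Prod>a\<in>UNIV. M $ ?\<pi> a $ ?\<pi> (p a))" by (simp add: mp)
  qed
  also have "\<dots> = det (\<chi> a b. M $ ?\<pi> a $ ?\<pi> b)" unfolding det_def by simp
  finally show ?thesis by simp
qed

text \<open>Relabelling coordinates maps boxes to boxes of the same content, so
  \<open>has_integral_twiddle\<close> applies with factor 1. It works on a box, and compact support
  provides one: the integrand is extended by zero to a box around its support.\<close>

lemma integral_reindex: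
  fixes F :: "real^'n::finite \<Rightarrow> real"
  assumes F: "F integrable_on S" "compact_support S F"
  shows "integral (reindex ` S) (\<lambda>y. F (unindex y)) = integral S F"
proof -
  obtain K where K: "compact K" "\<forall>x\<in>S - K. F x = 0"
    using F(2) unfolding compact_support_def by metis
  obtain b where b: "K \<subseteq> cbox (- b) b"
    using bounded_subset_cbox_symmetric compact_imp_bounded K by metis
  let ?F = "\<lambda>x. if x \<in> S then F x else 0"
  let ?G = "\<lambda>y. if y \<in> reindex ` S then F (unindex y) else 0"
  have G: "?G y = ?F (unindex y)" for y by (simp add: reindex_image)
  have "?F integrable_on UNIV" using F(1) by (simp add: integrable_restrict_UNIV)
  then have "?F integrable_on cbox (-b) b" by (rule integrable_on_subcbox) simp
  moreover have "integral UNIV ?F = integral (cbox (-b) b) ?F"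
    by (rule integral_eq_support) (use K b in auto)
  moreover have "integral UNIV ?F = integral S F"
    by (rule Henstock_Kurzweil_Integration.integral_restrict_UNIV)
  ultimately have "(?F has_integral integral S F) (cbox (-b) b)"
    using integrable_integral[of ?F "cbox (-b) b"] by simp
  then have "((\<lambda>y. ?F (unindex y)) has_integral (1 / 1) *\<^sub>R integral S F) (reindex ` cbox (-b) b)"
  proof (rule has_integral_twiddle[rotated -1])
    show "continuous (at y) unindex" for y :: "real^('n index)"
      using continuous_reindex(2)[of UNIV] continuous_on_eq_continuous_at by blast
    show "\<exists>w z. unindex ` cbox u v = cbox w z" for u v :: "real^('n index)"
      unfolding reindex_cbox by blast
    show "\<exists>w z. reindex ` cbox u v = cbox w z" for u v :: "real^'n"
      unfolding reindex_cbox by blast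
  qed (simp_all add: content_unindex)
  then have "integral (reindex ` cbox (-b) b) ?G = integral S F"
    by (intro integral_unique) (simp add: G)
  moreover have "integral UNIV ?G = integral (reindex ` cbox (-b) b) ?G"
    by (rule integral_eq_support) (use K b in \<open>auto simp: reindex_image\<close>)
  moreover have "integral UNIV ?G = integral (reindex ` S) (\<lambda>y. F (unindex y))"
    by (rule Henstock_Kurzweil_Integration.integral_restrict_UNIV)
  ultimately show ?thesis by simp
qed

text \<open>The general theorem concerns functions with values in a space of vectors;
  \<open>f\<close> is regarded as a function into \<open>real^1\<close> and its only component is
  read off at the end.\<close>

lemma change_of_variables_wellorder:
  fixes \<psi> :: "real^'m::{finite,wellorder} \<Rightarrow> real^'m::_" and f :: "real^'m::_ \<Rightarrow> real"
  assumes "open S" "\<And>x. x \<in> S \<Longrightarrow> (\<psi> has_derivative \<psi>' x) (at x)" "inj_on \<psi> S"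
    and f: "f absolutely_integrable_on \<psi> ` S"
  shows "integral (\<psi> ` S) f = integral S (\<lambda>x. \<bar>det (matrix (\<psi>' x))\<bar> * f (\<psi> x))"
proof -
  let ?v = "vec :: real \<Rightarrow> real^1"
  have bl: "bounded_linear ?v"
    unfolding linear_conv_bounded_linear[symmetric] by (rule linearI) (simp_all add: vec_eq_iff)
  have vf: "(\<lambda>x. ?v (f x)) absolutely_integrable_on \<psi> ` S"
    using absolutely_integrable_linear[OF f bl] by (simp add: o_def)
  have S: "S \<in> sets lebesgue" using assms(1) by simp
  note cov = has_absolute_integral_change_of_variables[OF S has_derivative_at_withinI[OF assms(2)] assms(3),
      of "\<lambda>x. ?v (f x)" "integral (\<psi> ` S) (\<lambda>x. ?v (f x))"]
  let ?h = "\<lambda>x. \<bar>det (matrix (\<psi>' x))\<bar> *\<^sub>R ?v (f (\<psi> x))"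
  have h: "?h absolutely_integrable_on S" "integral S ?h = integral (\<psi> ` S) (\<lambda>x. ?v (f x))"
    using cov vf by auto
  have c: "integral T (\<lambda>x. g x $ 1) = integral T g $ 1" if "g absolutely_integrable_on T" for T and g :: "real^'m::_ \<Rightarrow> real^1"
    using that set_lebesgue_integral_eq_integral(1) by (intro integral_component_eq_cart) blast
  show ?thesis
    using c[OF h(1)] c[OF vf] h(2) by simp
qed

text \<open>Conjugation by \<open>reindex\<close> turns \<psi> into a map between spaces with
  well-ordered indices, and by \<open>det_reindex\<close> the Jacobian determinant is unchanged.
  Compact support is asked for on both sides because the integrals over \<open>S\<close> and over
  its image are relabelled separately.\<close>

lemma change_of_variables:
  fixes \<psi> :: "real^'n::finite \<Rightarrow> real^'n" and f :: "real^'n \<Rightarrow> real"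
  assumes S: "open S" "open (\<psi> ` S)" and d: "\<And>x. x \<in> S \<Longrightarrow> \<psi> differentiable at x" and inj: "inj_on \<psi> S"
    and J: "continuous_on S (\<lambda>x. det (jacobian \<psi> (at x)))"
    and f: "continuous_on (\<psi> ` S) f" "compact_support (\<psi> ` S) f" "compact_support S (\<lambda>x. f (\<psi> x))"
  shows "integral (\<psi> ` S) f = integral S (\<lambda>x. \<bar>det (jacobian \<psi> (at x))\<bar> * f (\<psi> x))"
proof -
  define \<theta> where "\<theta> = (\<lambda>y. reindex (\<psi> (unindex y)))"
  define \<theta>' where "\<theta>' = (\<lambda>y h. reindex (frechet_derivative \<psi> (at (unindex y)) (unindex h)))"
  let ?S = "reindex ` S"
  let ?f = "\<lambda>y. f (unindex y)"
  have im: "\<theta> ` ?S = reindex ` \<psi> ` S" unfolding \<theta>_def by (auto simp: image_image)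
  have opn: "open (reindex ` T)" if "open T" for T :: "(real^'n) set"
    using open_vimage[OF that continuous_reindex(2)[of UNIV]]
    by (simp add: reindex_image vimage_def)
  have det: "det (matrix (\<theta>' y)) = det (jacobian \<psi> (at (unindex y)))" for y
  proof -
    have ax: "unindex (axis a 1) = axis (index_of a) 1" for a :: "'n index"
      by (auto simp: unindex_def vec_eq_iff axis_def)
    have "matrix (\<theta>' y) = (\<chi> a b. jacobian \<psi> (at (unindex y)) $ index_of a $ index_of b)"
      by (simp add: vec_eq_iff matrix_def jacobian_def \<theta>'_def reindex_def ax)
    then show ?thesis by (simp add: det_reindex)
  qed
  have int: "f absolutely_integrable_on \<psi> ` S"
    by (rule absolutely_integrable_compact_support[OF f(1,2)])
  have "integral (\<psi> ` S) f = integral (reindex ` \<psi> ` S) ?f"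
    using integral_reindex[OF integrable_compact_support[OF f(1,2)] f(2)] by simp
  also have "\<dots> = integral (\<theta> ` ?S) ?f" by (simp add: im)
  also have "\<dots> = integral ?S (\<lambda>y. \<bar>det (matrix (\<theta>' y))\<bar> * ?f (\<theta> y))"
  proof (rule change_of_variables_wellorder)
    show "open ?S" using S opn by blast
    show "(\<theta> has_derivative \<theta>' y) (at y)" if "y \<in> ?S" for y
    proof -
      have "unindex y \<in> S" using that by auto
      then have "(\<psi> has_derivative frechet_derivative \<psi> (at (unindex y))) (at (unindex y))"
        using d frechet_derivative_works by blast
      from diff_chain_at[OF diff_chain_at[OF linear_imp_has_derivative[OF linear_reindex(2)] this]
          linear_imp_has_derivative[OF linear_reindex(1)]]
      show ?thesis by (simp add: \<theta>_def \<theta>'_def o_def)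
    qed
    show "inj_on \<theta> ?S"
      using inj unfolding inj_on_def \<theta>_def by (auto dest!: arg_cong[of _ _ unindex])
    have "compact_support (reindex ` \<psi> ` S) ?f"
    proof -
      obtain K where K: "compact K" "K \<subseteq> \<psi> ` S" "\<forall>x\<in>\<psi> ` S - K. f x = 0"
        using f(2) unfolding compact_support_def by metis
      show ?thesis unfolding compact_support_def
      proof (intro exI[of _ "reindex ` K"] conjI ballI)
        show "compact (reindex ` K)"
          by (rule compact_continuous_image[OF continuous_reindex(1) K(1)])
        show "reindex ` K \<subseteq> reindex ` \<psi> ` S" using K(2) by blast
        show "f (unindex y) = 0" if "y \<in> reindex ` \<psi> ` S - reindex ` K" for y
          using K(3) that by (auto simp: reindex_image)
      qed
    qed
    moreover have "continuous_on (reindex ` \<psi> ` S) ?f"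
      by (intro continuous_on_compose2[OF f(1)] continuous_reindex) auto
    ultimately show "?f absolutely_integrable_on \<theta> ` ?S"
      unfolding im by (intro absolutely_integrable_compact_support)
  qed
  also have "\<dots> = integral ?S (\<lambda>y. (\<lambda>x. \<bar>det (jacobian \<psi> (at x))\<bar> * f (\<psi> x)) (unindex y))"
    by (simp add: det \<theta>_def)
  also have "\<dots> = integral S (\<lambda>x. \<bar>det (jacobian \<psi> (at x))\<bar> * f (\<psi> x))"
  proof (rule integral_reindex)
    have cs: "compact_support S (\<lambda>x. \<bar>det (jacobian \<psi> (at x))\<bar> * f (\<psi> x))"
      by (rule compact_support_mult(2)[OF f(3)])
    moreover have "continuous_on S \<psi>"
      using d by (meson differentiable_imp_continuous_within continuous_at_imp_continuous_on)
    ultimately show "(\<lambda>x. \<bar>det (jacobian \<psi> (at x))\<bar> * f (\<psi> x)) integrable_on S"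
      by (intro integrable_compact_support continuous_intros J continuous_on_compose2[OF f(1)]) auto
    show "compact_support S (\<lambda>x. \<bar>det (jacobian \<psi> (at x))\<bar> * f (\<psi> x))" by (rule cs)
  qed
  finally show ?thesis .
qed

section \<open>Charts and transition functions\<close>

definition half_space :: "(real^'n::finite) set \<Rightarrow> (real^('n option)) set" where
  "half_space V = {y. base_coords y \<in> V \<and> y $ None > 0}"

lemma ext_coords_simps [simp]:
  "base_coords (ext_coords x t) = x" "ext_coords x t $ None = t" "ext_coords x t $ Some i = x $ i"
  by (simp_all add: base_coords_def ext_coords_def)

lemma ext_coords_base [simp]: "ext_coords (base_coords y) (y $ None) = y"
  by (simp add: vec_eq_iff ext_coords_def base_coords_def split: option.split)

lemma ext_coords_eq_iff: "ext_coords x t = ext_coords x' t' \<longleftrightarrow> x = x' \<and> t = t'"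
  by (metis ext_coords_simps(1,2))

lemma ext_coords_in_half_space [simp]: "ext_coords x t \<in> half_space V \<longleftrightarrow> x \<in> V \<and> t > 0"
  by (simp add: half_space_def)

lemma half_space_cases:
  assumes "y \<in> half_space V"
  obtains x t where "y = ext_coords x t" "x \<in> V" "t > 0"
  using assms ext_coords_base[of y] unfolding half_space_def by (metis mem_Collect_eq)

locale atlas =
  fixes A :: "('a::{t2_space, second_countable_topology}, 'n::finite) chart set"
  assumes smooth_atlas: "smooth_atlas A"
begin

definition overlap :: "('a, 'n) chart \<Rightarrow> ('a, 'n) chart \<Rightarrow> (real^'n) set" where
  "overlap c d = snd c ` (fst c \<inter> fst d)"

definition jdet :: "('a, 'n) chart \<Rightarrow> ('a, 'n) chart \<Rightarrow> real^'n \<Rightarrow> real" where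
  "jdet c d x = det (jacobian (transition c d) (at x))"

lemma open_chart: "c \<in> A \<Longrightarrow> open (fst c)" "c \<in> A \<Longrightarrow> open (chart_image c)"
  and homeomorphism_chart: "c \<in> A \<Longrightarrow> homeomorphism (fst c) (chart_image c) (snd c) (chart_inv c)"
  using smooth_atlas unfolding smooth_atlas_def by auto

lemma chart_cover: obtains c where "c \<in> A" "p \<in> fst c"
  using smooth_atlas unfolding smooth_atlas_def by blast

lemma chart_inv_chart: "c \<in> A \<Longrightarrow> p \<in> fst c \<Longrightarrow> chart_inv c (snd c p) = p"
  using homeomorphism_chart homeomorphism_apply1 by blast

lemma chart_chart_inv: "c \<in> A \<Longrightarrow> x \<in> chart_image c \<Longrightarrow> snd c (chart_inv c x) = x"
  using homeomorphism_chart homeomorphism_apply2 by blast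

lemma chart_inv_in: "c \<in> A \<Longrightarrow> x \<in> chart_image c \<Longrightarrow> chart_inv c x \<in> fst c"
  by (auto simp: chart_inv_chart)

lemma continuous_chart:
  assumes "c \<in> A"
  shows "continuous_on (fst c) (snd c)" "continuous_on (chart_image c) (chart_inv c)"
  using homeomorphism_chart[OF assms] homeomorphism_cont1 homeomorphism_cont2 by blast+

lemma overlap_iff: "c \<in> A \<Longrightarrow> x \<in> overlap c d \<longleftrightarrow> x \<in> chart_image c \<and> chart_inv c x \<in> fst d"
  unfolding overlap_def by (auto simp: chart_inv_chart)

lemma overlap_subset: "overlap c d \<subseteq> chart_image c"
  unfolding overlap_def by blast

lemma open_preimage_chart_inv:
  assumes "c \<in> A" "open W"
  shows "open {x \<in> chart_image c. chart_inv c x \<in> W}"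
  using continuous_open_preimage[OF continuous_chart(2)[OF assms(1)] open_chart(2)[OF assms(1)] assms(2)]
  by (simp add: vimage_def Int_def)

lemma open_overlap: assumes "c \<in> A" "d \<in> A" shows "open (overlap c d)"
proof -
  have "overlap c d = {x \<in> chart_image c. chart_inv c x \<in> fst d}"
    using overlap_iff[OF assms(1)] by blast
  then show ?thesis using open_preimage_chart_inv[OF assms(1) open_chart(1)[OF assms(2)]] by simp
qed

lemma transition_chart: "c \<in> A \<Longrightarrow> p \<in> fst c \<Longrightarrow> transition c d (snd c p) = snd d p"
  by (simp add: transition_def chart_inv_chart)

lemma transition_overlap: "c \<in> A \<Longrightarrow> x \<in> overlap c d \<Longrightarrow> transition c d x \<in> overlap d c"
  unfolding overlap_def by (auto simp: transition_chart)

lemma chart_inv_transition: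
  "c \<in> A \<Longrightarrow> d \<in> A \<Longrightarrow> x \<in> overlap c d \<Longrightarrow> chart_inv d (transition c d x) = chart_inv c x"
  unfolding overlap_def by (auto simp: transition_chart chart_inv_chart)

lemma transition_inverse:
  "c \<in> A \<Longrightarrow> d \<in> A \<Longrightarrow> x \<in> overlap c d \<Longrightarrow> transition d c (transition c d x) = x"
  unfolding overlap_def by (auto simp: transition_chart)

lemma transition_image: "c \<in> A \<Longrightarrow> d \<in> A \<Longrightarrow> transition c d ` overlap c d = overlap d c"
  by (force simp: overlap_def transition_chart)

lemma inj_on_transition: "c \<in> A \<Longrightarrow> d \<in> A \<Longrightarrow> inj_on (transition c d) (overlap c d)"
  by (rule inj_on_inverseI[of _ "transition d c"]) (rule transition_inverse)

lemma smooth_transition: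
  "c \<in> A \<Longrightarrow> d \<in> A \<Longrightarrow> smooth_on (overlap c d) (\<lambda>x. transition c d x $ i)"
  using smooth_atlas unfolding smooth_atlas_def overlap_def by blast

lemma differentiable_transition:
  assumes "c \<in> A" "d \<in> A" "x \<in> overlap c d"
  shows "transition c d differentiable at x"
  by (rule differentiable_vec_components)
    (rule smooth_on_differentiable_at[OF smooth_transition open_overlap]; use assms in blast)

lemma jacobian_component:
  fixes \<phi> :: "real^'m::finite \<Rightarrow> real^'k::finite"
  assumes "\<phi> differentiable at x"
  shows "jacobian \<phi> (at x) $ i $ j = partial_deriv j (\<lambda>x. \<phi> x $ i) x"
  using partial_deriv_component[OF assms[unfolded frechet_derivative_works]]
  by (simp add: jacobian_def matrix_def)

lemma smooth_jdet:
  assumes "c \<in> A" "d \<in> A"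
  shows "smooth_on (overlap c d) (jdet c d)"
proof -
  let ?M = "\<lambda>x. \<chi> i j. partial_deriv j (\<lambda>x. transition c d x $ i) x"
  have "smooth_on (overlap c d) (\<lambda>x. det (?M x))"
    using assms by (intro smooth_on_det open_overlap)
      (auto intro!: smooth_on_partial_deriv smooth_transition)
  moreover have "det (?M x) = jdet c d x" if "x \<in> overlap c d" for x
  proof -
    have "?M x = jacobian (transition c d) (at x)"
      using jacobian_component[OF differentiable_transition[OF assms that]] by (simp add: vec_eq_iff)
    then show ?thesis by (simp add: jdet_def)
  qed
  ultimately show ?thesis using smooth_on_cong[OF open_overlap[OF assms], of "\<lambda>x. det (?M x)" "jdet c d"] by simp
qed

lemma jdet_cocycle:
  assumes "c \<in> A" "d \<in> A" "e \<in> A" "p \<in> fst c" "p \<in> fst d" "p \<in> fst e"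
  shows "jdet c e (snd c p) = jdet d e (snd d p) * jdet c d (snd c p)"
proof -
  let ?x = "snd c p"
  have x: "?x \<in> overlap c d" "?x \<in> overlap c e" "snd d p \<in> overlap d e"
    using assms by (auto simp: overlap_def)
  have y: "transition c d ?x = snd d p" using assms by (simp add: transition_chart)
  have 1: "(transition c d has_derivative frechet_derivative (transition c d) (at ?x)) (at ?x)"
    using differentiable_transition[OF assms(1,2) x(1)] frechet_derivative_works by blast
  have 2: "(transition d e has_derivative frechet_derivative (transition d e) (at (snd d p))) (at (transition c d ?x))"
    using differentiable_transition[OF assms(2,3) x(3)] y unfolding frechet_derivative_works by simp
  let ?D = "frechet_derivative (transition d e) (at (snd d p)) \<circ> frechet_derivative (transition c d) (at ?x)"
  have "(transition d e \<circ> transition c d has_derivative ?D) (at ?x)" by (rule diff_chain_at[OF 1 2])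
  then have "(transition c e has_derivative ?D) (at ?x)"
  proof (rule has_derivative_transform_within_open[of _ _ _ _ "overlap c d"])
    show "(transition d e \<circ> transition c d) z = transition c e z" if "z \<in> overlap c d" for z
      using that assms by (auto simp: overlap_def transition_chart)
  qed (use assms x open_overlap in auto)
  then have "frechet_derivative (transition c e) (at ?x) = ?D" using frechet_derivative_at by metis
  then show ?thesis
    using matrix_compose[OF has_derivative_linear[OF 1] has_derivative_linear[OF 2]]
    by (simp add: jdet_def jacobian_def det_mul)
qed

lemma jdet_self:
  assumes "c \<in> A" "x \<in> chart_image c"
  shows "jdet c c x = 1"
proof -
  have "(transition c c has_derivative (\<lambda>h. h)) (at x)"
    by (rule has_derivative_transform_within_open[OF has_derivative_ident open_chart(2)[OF assms(1)] assms(2)])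
      (use assms in \<open>auto simp: transition_chart\<close>)
  then have "frechet_derivative (transition c c) (at x) = (\<lambda>h. h)" using frechet_derivative_at by metis
  then show ?thesis by (simp add: jdet_def jacobian_def matrix_id_mat_1[unfolded id_def])
qed

text \<open>The cocycle identity along \<open>c\<close>, \<open>d\<close>, \<open>c\<close> exhibits
  \<open>jdet d c\<close> as the reciprocal.\<close>

lemma jdet_nonzero:
  assumes "c \<in> A" "d \<in> A" "p \<in> fst c" "p \<in> fst d"
  shows "jdet c d (snd c p) \<noteq> 0"
proof -
  have "jdet d c (snd d p) * jdet c d (snd c p) = 1"
    using jdet_cocycle[OF assms(1,2,1,3,4,3)] jdet_self[OF assms(1)] assms(3) by auto
  then show ?thesis by auto
qed

lemma jdet_nonzero_overlap: "c \<in> A \<Longrightarrow> d \<in> A \<Longrightarrow> x \<in> overlap c d \<Longrightarrow> jdet c d x \<noteq> 0"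
  unfolding overlap_def using jdet_nonzero by blast


section \<open>Points of the extended manifold\<close>

text \<open>The point over \<open>p\<close> whose t-coordinate in the chart \<open>c\<close> is
  \<open>t\<close>; the transformation law forces its coordinates in all other charts. Every point
  of the extended manifold over the domain of \<open>c\<close> is of this form.\<close>

definition frame :: "('a, 'n) chart \<Rightarrow> 'a \<Rightarrow> real \<Rightarrow> ('a, 'n) ext_point" where
  "frame c p t = (p, \<lambda>d. if d \<in> A \<and> p \<in> fst d then \<bar>jdet c d (snd c p)\<bar> * t else 0)"

lemma ext_manifoldD:
  assumes "(p, \<tau>) \<in> ext_manifold A" "c \<in> A" "p \<in> fst c"
  shows "\<tau> c > 0" "d \<in> A \<Longrightarrow> p \<in> fst d \<Longrightarrow> \<tau> d = \<bar>jdet c d (snd c p)\<bar> * \<tau> c"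
proof -
  from assms(1) have e: "\<And>c. if c \<in> A \<and> p \<in> fst c then \<tau> c > 0 else \<tau> c = 0"
    "\<And>c d. c \<in> A \<Longrightarrow> d \<in> A \<Longrightarrow> p \<in> fst c \<inter> fst d \<Longrightarrow>
      \<tau> d = \<bar>det (jacobian (transition c d) (at (snd c p)))\<bar> * \<tau> c"
    unfolding ext_manifold_def mem_Collect_eq prod.case by blast+
  show "\<tau> c > 0" using e(1)[of c] assms(2,3) by simp
  show "\<tau> d = \<bar>jdet c d (snd c p)\<bar> * \<tau> c" if "d \<in> A" "p \<in> fst d"
    using e(2)[of c d] assms(2,3) that by (simp add: jdet_def)
qed

text \<open>Positivity in each chart is the non-vanishing of the Jacobian determinant, and
  compatibility between two further charts is the cocycle identity.\<close>

lemma frame_in_ext_manifold: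
  assumes "c \<in> A" "p \<in> fst c" "t > 0"
  shows "frame c p t \<in> ext_manifold A"
  unfolding frame_def ext_manifold_def mem_Collect_eq prod.case
proof (intro conjI ballI allI impI)
  fix d
  show "if d \<in> A \<and> p \<in> fst d then 0 < (if d \<in> A \<and> p \<in> fst d then \<bar>jdet c d (snd c p)\<bar> * t else 0)
    else (if d \<in> A \<and> p \<in> fst d then \<bar>jdet c d (snd c p)\<bar> * t else 0) = 0"
    using jdet_nonzero[OF assms(1) _ assms(2), of d] assms(3) by simp
next
  fix d e assume "d \<in> A" "e \<in> A" "p \<in> fst d \<inter> fst e"
  then show "(if e \<in> A \<and> p \<in> fst e then \<bar>jdet c e (snd c p)\<bar> * t else 0) =
      \<bar>det (jacobian (transition d e) (at (snd d p)))\<bar> *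
        (if d \<in> A \<and> p \<in> fst d then \<bar>jdet c d (snd c p)\<bar> * t else 0)"
    using jdet_cocycle[OF assms(1) _ _ assms(2), of d e] by (simp add: abs_mult jdet_def)
qed

lemma frame_coord: "c \<in> A \<Longrightarrow> p \<in> fst c \<Longrightarrow> snd (frame c p t) c = t"
  by (simp add: frame_def jdet_self)

lemma fst_frame [simp]: "fst (frame c p t) = p"
  by (simp add: frame_def)

lemma ext_point_eq_frame:
  assumes "(p, \<tau>) \<in> ext_manifold A" "c \<in> A" "p \<in> fst c"
  shows "(p, \<tau>) = frame c p (\<tau> c)"
proof -
  have "\<tau> d = (if d \<in> A \<and> p \<in> fst d then \<bar>jdet c d (snd c p)\<bar> * \<tau> c else 0)" for d
    using ext_manifoldD(2)[OF assms] assms(1)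
    unfolding ext_manifold_def mem_Collect_eq prod.case by metis
  then have "\<tau> = (\<lambda>d. if d \<in> A \<and> p \<in> fst d then \<bar>jdet c d (snd c p)\<bar> * \<tau> c else 0)" by (rule ext)
  then show ?thesis unfolding frame_def by (rule arg_cong)
qed

lemma ext_point_cases:
  assumes "q \<in> ext_manifold A" "c \<in> A" "fst q \<in> fst c"
  obtains t where "t > 0" "q = frame c (fst q) t"
  using ext_point_eq_frame[of "fst q" "snd q" c] ext_manifoldD(1)[of "fst q" "snd q" c] assms by auto

lemma snd_ext_chart_frame:
  "c \<in> A \<Longrightarrow> p \<in> fst c \<Longrightarrow> snd (ext_chart A c) (frame c p t) = ext_coords (snd c p) t"
  using frame_coord by (simp add: ext_chart_def split_beta)

lemma fst_ext_chart: "q \<in> fst (ext_chart A c) \<longleftrightarrow> q \<in> ext_manifold A \<and> fst q \<in> fst c"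
  by (auto simp: ext_chart_def)

lemma ext_chart_image:
  assumes "c \<in> A"
  shows "chart_image (ext_chart A c) = half_space (chart_image c)"
proof (intro equalityI subsetI)
  fix y assume "y \<in> chart_image (ext_chart A c)"
  then obtain q where q: "q \<in> ext_manifold A" "fst q \<in> fst c" "y = snd (ext_chart A c) q"
    by (auto simp: fst_ext_chart)
  from ext_point_cases[OF q(1) assms q(2)] obtain t where "t > 0" "q = frame c (fst q) t" .
  then show "y \<in> half_space (chart_image c)"
    using q snd_ext_chart_frame[OF assms q(2), of t] by auto
next
  fix y assume "y \<in> half_space (chart_image c)"
  then obtain x t where y: "y = ext_coords x t" "x \<in> chart_image c" "t > 0" by (rule half_space_cases)
  then obtain p where "p \<in> fst c" "x = snd c p" by auto
  then show "y \<in> chart_image (ext_chart A c)"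
    using y snd_ext_chart_frame[OF assms, of p t] frame_in_ext_manifold[OF assms, of p t]
    by (metis fst_ext_chart fst_frame image_eqI)
qed

lemma chart_inv_ext_chart:
  assumes "c \<in> A" "p \<in> fst c" "t > 0"
  shows "chart_inv (ext_chart A c) (ext_coords (snd c p) t) = frame c p t"
proof -
  have "inj_on (snd (ext_chart A c)) (fst (ext_chart A c))"
  proof (rule inj_onI)
    fix q q' assume q: "q \<in> fst (ext_chart A c)" "q' \<in> fst (ext_chart A c)"
      and eq: "snd (ext_chart A c) q = snd (ext_chart A c) q'"
    obtain t where t: "q = frame c (fst q) t"
      using q assms(1) ext_point_cases[of q c] by (auto simp: fst_ext_chart)
    obtain t' where t': "q' = frame c (fst q') t'"
      using q assms(1) ext_point_cases[of q' c] by (auto simp: fst_ext_chart)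
    have "ext_coords (snd c (fst q)) t = ext_coords (snd c (fst q')) t'"
      using eq t t' q snd_ext_chart_frame assms(1) by (metis fst_ext_chart)
    then have "snd c (fst q) = snd c (fst q')" "t = t'" by (auto simp: ext_coords_eq_iff)
    then show "q = q'" using t t' q chart_inv_chart[OF assms(1)] by (metis fst_ext_chart)
  qed
  moreover have "frame c p t \<in> fst (ext_chart A c)"
    using assms frame_in_ext_manifold by (simp add: fst_ext_chart)
  ultimately show ?thesis
    unfolding chart_inv_def using snd_ext_chart_frame[OF assms(1,2)] inv_into_f_f by metis
qed

lemma local_rep_frame:
  assumes "c \<in> A" "p \<in> fst c" "t > 0"
  shows "local_rep (ext_chart A c) s (ext_coords (snd c p) t) = s (frame c p t)"
  by (simp add: local_rep_def chart_inv_ext_chart[OF assms])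


section \<open>Densities\<close>

definition coef :: "('a, 'n) chart \<Rightarrow> (('a, 'n) ext_point \<Rightarrow> real) \<Rightarrow> real^'n \<Rightarrow> real" where
  "coef c s x = local_rep (ext_chart A c) s (ext_coords x 1)"

lemma coef_mult: "coef c (\<lambda>q. s q * s' q) x = coef c s x * coef c s' x"
  and coef_add: "coef c (\<lambda>q. s q + s' q) x = coef c s x + coef c s' x"
  and coef_cmult: "coef c (\<lambda>q. a * s q) x = a * coef c s x"
  and coef_sum: "coef c (\<lambda>q. \<Sum>j\<in>J. h j q) x = (\<Sum>j\<in>J. coef c (h j) x)"
  by (simp_all add: coef_def local_rep_def)

lemma coef_chart: "c \<in> A \<Longrightarrow> p \<in> fst c \<Longrightarrow> coef c s (snd c p) = s (frame c p 1)"
  by (simp add: coef_def local_rep_frame)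

lemma density_outside: "s \<in> densities A \<alpha> \<Longrightarrow> q \<notin> ext_manifold A \<Longrightarrow> s q = 0"
  unfolding densities_def mem_Collect_eq by blast

text \<open>Membership in \<open>densities\<close> only asserts that some coefficient function
  exists in each chart. Evaluation at the frames with t = 1 identifies it with \<open>coef\<close>
  on the chart image.\<close>

lemma
  assumes s: "s \<in> densities A \<alpha>" and c: "c \<in> A"
  shows density_eq: "q \<in> ext_manifold A \<Longrightarrow> fst q \<in> fst c \<Longrightarrow> s q = coef c s (snd c (fst q)) * snd q c powr \<alpha>"
    and smooth_coef: "smooth_on (chart_image c) (coef c s)"
proof -
  from s c obtain u where u: "smooth_on (chart_image c) u"
    "\<And>p \<tau>. (p, \<tau>) \<in> ext_manifold A \<Longrightarrow> p \<in> fst c \<Longrightarrow> s (p, \<tau>) = u (snd c p) * \<tau> c powr \<alpha>"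
    unfolding densities_def by fast
  have uc: "coef c s (snd c p) = u (snd c p)" if "p \<in> fst c" for p
    using u(2)[of "fst (frame c p 1)" "snd (frame c p 1)"] that c frame_in_ext_manifold[OF c that, of 1]
      frame_coord[OF c that, of 1] by (simp add: coef_chart frame_def)
  show "s q = coef c s (snd c (fst q)) * snd q c powr \<alpha>" if "q \<in> ext_manifold A" "fst q \<in> fst c"
    using u(2)[of "fst q" "snd q"] that by (simp add: uc)
  show "smooth_on (chart_image c) (coef c s)"
    by (subst smooth_on_cong[OF open_chart(2)[OF c], of _ u]) (use u(1) uc in auto)
qed

lemma density_frame:
  assumes "s \<in> densities A \<alpha>" "c \<in> A" "p \<in> fst c" "t > 0"
  shows "s (frame c p t) = coef c s (snd c p) * t powr \<alpha>"
  using density_eq[OF assms(1,2) frame_in_ext_manifold[OF assms(2-4)]] frame_coord[OF assms(2,3)] assms(3)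
  by simp

lemma local_rep_density:
  assumes "s \<in> densities A \<alpha>" "c \<in> A" "x \<in> chart_image c" "t > 0"
  shows "local_rep (ext_chart A c) s (ext_coords x t) = coef c s x * t powr \<alpha>"
  using assms by (auto simp: local_rep_frame density_frame)

lemma densitiesI:
  assumes "\<And>q. q \<notin> ext_manifold A \<Longrightarrow> s q = 0"
    and "\<And>c. c \<in> A \<Longrightarrow> smooth_on (chart_image c) (u c)"
    and "\<And>c q. c \<in> A \<Longrightarrow> q \<in> ext_manifold A \<Longrightarrow> fst q \<in> fst c \<Longrightarrow> s q = u c (snd c (fst q)) * snd q c powr \<alpha>"
  shows "s \<in> densities A \<alpha>"
  unfolding densities_def using assms by fastforce

lemma densities_add:
  assumes "s \<in> densities A \<alpha>" "s' \<in> densities A \<alpha>"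
  shows "(\<lambda>q. s q + s' q) \<in> densities A \<alpha>"
proof (rule densitiesI)
  show "smooth_on (chart_image c) (\<lambda>x. coef c s x + coef c s' x)" if "c \<in> A" for c
    using assms that by (intro smooth_on_add smooth_coef open_chart)
qed (use assms in \<open>auto simp: density_outside distrib_right density_eq[symmetric]\<close>)

lemma densities_mult:
  assumes "s \<in> densities A \<alpha>" "s' \<in> densities A \<beta>"
  shows "(\<lambda>q. s q * s' q) \<in> densities A (\<alpha> + \<beta>)"
proof (rule densitiesI)
  show "smooth_on (chart_image c) (\<lambda>x. coef c s x * coef c s' x)" if "c \<in> A" for c
    using assms that by (intro smooth_on_mult smooth_coef open_chart)
  show "s q * s' q = coef c s (snd c (fst q)) * coef c s' (snd c (fst q)) * snd q c powr (\<alpha> + \<beta>)"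
    if "c \<in> A" "q \<in> ext_manifold A" "fst q \<in> fst c" for c q
    using density_eq[OF assms(1) that] density_eq[OF assms(2) that] by (simp add: powr_add)
qed (use assms in \<open>auto simp: density_outside\<close>)

lemma densities_0: "(\<lambda>_. 0) \<in> densities A \<alpha>"
  by (rule densitiesI[of _ "\<lambda>_ _. 0"]) (auto simp: smooth_on_const)

lemma densities_cmult:
  assumes "s \<in> densities A \<alpha>"
  shows "(\<lambda>q. a * s q) \<in> densities A \<alpha>"
proof (rule densitiesI)
  show "smooth_on (chart_image c) (\<lambda>x. a * coef c s x)" if "c \<in> A" for c
    using assms that by (intro smooth_on_mult smooth_on_const smooth_coef open_chart)
qed (use assms in \<open>auto simp: density_outside density_eq[symmetric] mult.assoc\<close>)

lemma densities_sum:
  "(\<And>j. j \<in> J \<Longrightarrow> h j \<in> densities A \<alpha>) \<Longrightarrow> (\<lambda>q. \<Sum>j\<in>J. h j q) \<in> densities A \<alpha>"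
  by (induction J rule: infinite_finite_induct) (auto simp: densities_0 densities_add)

text \<open>The frame with t = 1 in \<open>c\<close> has t-coordinate |jdet c d x| in
  \<open>d\<close>.\<close>

lemma coef_transition:
  assumes "s \<in> densities A \<alpha>" "c \<in> A" "d \<in> A" "x \<in> overlap c d"
  shows "coef c s x = coef d s (transition c d x) * \<bar>jdet c d x\<bar> powr \<alpha>"
proof -
  obtain p where p: "p \<in> fst c" "p \<in> fst d" "x = snd c p" using assms(4) by (auto simp: overlap_def)
  have "s (frame c p 1) = coef d s (snd d p) * snd (frame c p 1) d powr \<alpha>"
    using density_eq[OF assms(1,3) frame_in_ext_manifold[OF assms(2) p(1)], of 1] p by simp
  then show ?thesis using p assms by (simp add: coef_chart transition_chart frame_def)
qed

lemma unit_density: "unit_density A \<in> densities A 0"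
proof (rule densitiesI[of _ "\<lambda>_ _. 1"])
  show "unit_density A q = 1 * snd q c powr 0" if "c \<in> A" "q \<in> ext_manifold A" "fst q \<in> fst c" for c q
    using ext_manifoldD(1)[of "fst q" "snd q" c] that by (simp add: unit_density_def)
qed (auto simp: unit_density_def smooth_on_const)

lemma coef_unit_density: "c \<in> A \<Longrightarrow> x \<in> chart_image c \<Longrightarrow> coef c (unit_density A) x = 1"
  by (auto simp: coef_chart unit_density_def frame_in_ext_manifold)

text \<open>Rewriting the function as (J * J) powr (\<alpha> / 2) removes the absolute value; the
  base is positive wherever J is non-zero, whatever its sign.\<close>

lemma smooth_abs_jdet_powr:
  assumes "c \<in> A" "d \<in> A"
  shows "smooth_on (overlap c d) (\<lambda>x. \<bar>jdet c d x\<bar> powr \<alpha>)"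
proof -
  have nz: "jdet c d x \<noteq> 0" if "x \<in> overlap c d" for x
    using that jdet_nonzero_overlap assms by blast
  have "smooth_on (overlap c d) (\<lambda>x. (jdet c d x * jdet c d x) powr (\<alpha> / 2))"
    using nz not_real_square_gt_zero
    by (intro smooth_on_powr smooth_on_mult open_overlap smooth_jdet assms) blast
  moreover have "(jdet c d x * jdet c d x) powr (\<alpha> / 2) = \<bar>jdet c d x\<bar> powr \<alpha>" for x
  proof -
    have "(jdet c d x * jdet c d x) = \<bar>jdet c d x\<bar> powr 2"
      by (cases "jdet c d x = 0") (simp_all add: powr_numeral power2_eq_square)
    then show ?thesis by (simp only: powr_powr) simp
  qed
  ultimately show ?thesis by simp
qed

section \<open>Extension by zero of densities given in one chart, supports, and integrals in two
  charts\<close>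

definition lift_density ::
  "('a, 'n) chart \<Rightarrow> real \<Rightarrow> (real^'n \<Rightarrow> real) \<Rightarrow> ('a, 'n) ext_point \<Rightarrow> real" where
  "lift_density c \<alpha> \<phi> q =
    (if q \<in> ext_manifold A \<and> fst q \<in> fst c then \<phi> (snd c (fst q)) * snd q c powr \<alpha> else 0)"

lemma compact_chart_inv_image:
  assumes "c \<in> A" "compact K" "K \<subseteq> chart_image c"
  shows "compact (chart_inv c ` K)" "chart_inv c ` K \<subseteq> fst c"
proof -
  show "compact (chart_inv c ` K)"
    using assms continuous_chart(2)[OF assms(1)] by (intro compact_continuous_image) (auto intro: continuous_on_subset)
  show "chart_inv c ` K \<subseteq> fst c" using assms chart_inv_in by blast
qed

text \<open>Smoothness in another chart \<open>d\<close>: its image is covered by the overlap, where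
  the transformation law gives the coefficient, and by the open set of points off the compact set
  that carries \<phi>, where the coefficient is 0.\<close>

lemma lift_density:
  assumes c: "c \<in> A" and \<phi>: "smooth_on (chart_image c) \<phi>" "compact_support (chart_image c) \<phi>"
  shows "lift_density c \<alpha> \<phi> \<in> densities A \<alpha>"
proof -
  obtain K where K: "compact K" "K \<subseteq> chart_image c" "\<forall>x\<in>chart_image c - K. \<phi> x = 0"
    using \<phi>(2) unfolding compact_support_def by metis
  \<comment> \<open>The manifold is Hausdorff, so this compact set is closed, and its complement is
    open in every chart.\<close>
  have clK: "closed (chart_inv c ` K)" using compact_chart_inv_image[OF c K(1,2)] compact_imp_closed by blast
  define u where "u = (\<lambda>d x. if x \<in> overlap d c then \<phi> (transition d c x) * \<bar>jdet d c x\<bar> powr \<alpha> else 0)"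
  show ?thesis
  proof (rule densitiesI)
    fix d assume d: "d \<in> A"
    let ?W = "{x \<in> chart_image d. chart_inv d x \<in> - chart_inv c ` K}"
    have "open ?W" using open_preimage_chart_inv[OF d, of "- chart_inv c ` K"] clK by blast
    have "u d x = 0" if "x \<in> ?W" for x
    proof (cases "x \<in> overlap d c")
      case True
      have "transition d c x \<in> chart_image c"
        using transition_overlap[OF d True] overlap_subset[of c d] by blast
      moreover have "transition d c x \<notin> K"
        using that chart_inv_transition[OF d c True] by force
      ultimately show ?thesis using K(3) by (simp add: u_def)
    qed (simp add: u_def)
    then have 1: "smooth_on ?W (u d)"
      using smooth_on_cong[OF \<open>open ?W\<close>, of "\<lambda>_. 0" "u d"] smooth_on_const by auto
    have im: "transition d c ` overlap d c \<subseteq> chart_image c"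
      using transition_image[OF d c] overlap_subset[of c d] by simp
    have "smooth_on (overlap d c) (\<lambda>x. \<phi> (transition d c x) * \<bar>jdet d c x\<bar> powr \<alpha>)"
      by (intro smooth_on_mult smooth_on_compose[OF open_overlap open_chart(2)[OF c] \<phi>(1) _ im]
          smooth_transition smooth_abs_jdet_powr open_overlap c d)
    then have 2: "smooth_on (overlap d c) (u d)"
      by (subst smooth_on_cong[OF open_overlap[OF d c]]) (auto simp: u_def)
    have "chart_image d = overlap d c \<union> ?W"
      using overlap_iff[OF d, of _ c] compact_chart_inv_image(2)[OF c K(1,2)] by blast
    then show "smooth_on (chart_image d) (u d)"
      using smooth_on_Un[OF open_overlap[OF d c] \<open>open ?W\<close> 2 1] by simp
  next
    fix d q assume d: "d \<in> A" and q: "q \<in> ext_manifold A" "fst q \<in> fst d"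
    show "lift_density c \<alpha> \<phi> q = u d (snd d (fst q)) * snd q d powr \<alpha>"
    proof (cases "fst q \<in> fst c")
      case True
      then have "snd d (fst q) \<in> overlap d c" using q by (auto simp: overlap_def)
      moreover have "snd q c = \<bar>jdet d c (snd d (fst q))\<bar> * snd q d"
        using ext_manifoldD(2)[of "fst q" "snd q" d c] q d c True by simp
      moreover have "snd q d > 0" using ext_manifoldD(1)[of "fst q" "snd q" d] q d by simp
      ultimately show ?thesis
        using True q d by (simp add: lift_density_def u_def transition_chart powr_mult mult.assoc)
    next
      case False
      then have "snd d (fst q) \<notin> overlap d c" using q overlap_iff[OF d] chart_inv_chart[OF d] by simp
      then show ?thesis using False by (simp add: lift_density_def u_def)
    qed
  qed (simp add: lift_density_def)
qed

lemma coef_lift_density: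
  assumes "c \<in> A" "x \<in> chart_image c"
  shows "coef c (lift_density c \<alpha> \<phi>) x = \<phi> x"
proof -
  obtain p where "p \<in> fst c" "x = snd c p" using assms(2) by blast
  then show ?thesis
    using assms(1) frame_in_ext_manifold[OF assms(1), of p 1] frame_coord[OF assms(1), of p 1]
    by (simp add: coef_chart lift_density_def)
qed

lemma base_support_subset_closed:
  "closed K \<Longrightarrow> (\<And>p \<tau>. p \<notin> K \<Longrightarrow> s (p, \<tau>) = 0) \<Longrightarrow> base_support s \<subseteq> K"
  unfolding base_support_def by (rule closure_minimal) auto

lemma not_in_base_support: "p \<notin> base_support s \<Longrightarrow> s (p, \<tau>) = 0"
  unfolding base_support_def using closure_subset[of "{p. \<exists>\<tau>. s (p, \<tau>) \<noteq> 0}"] by blast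

lemma closed_base_support: "closed (base_support s)"
  unfolding base_support_def by simp

lemma compact_base_support_subset: "base_support s \<subseteq> K \<Longrightarrow> compact K \<Longrightarrow> compact (base_support s)"
  using compact_Int_closed[OF _ closed_base_support, of K s] by (simp add: Int_absorb1)

lemma base_support_mono:
  "(\<And>p \<tau>. s' (p, \<tau>) \<noteq> 0 \<Longrightarrow> \<exists>\<tau>'. s (p, \<tau>') \<noteq> 0) \<Longrightarrow> base_support s' \<subseteq> base_support s"
  unfolding base_support_def by (rule closure_mono) auto

lemma notin_chart_image:
  assumes "c \<in> A" "p \<in> fst c" "p \<notin> K" "K \<subseteq> fst c"
  shows "snd c p \<notin> snd c ` K"
proof
  assume "snd c p \<in> snd c ` K"
  then obtain q where "q \<in> K" "snd c p = snd c q" by blast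
  then have "p = q" using assms chart_inv_chart[OF assms(1)] by (metis subsetD)
  then show False using \<open>q \<in> K\<close> assms(3) by blast
qed

lemma lift_density_support:
  assumes "c \<in> A" "K \<subseteq> fst c" "compact K" "\<And>x. x \<in> chart_image c - snd c ` K \<Longrightarrow> \<phi> x = 0"
  shows "base_support (lift_density c \<alpha> \<phi>) \<subseteq> K"
proof (rule base_support_subset_closed)
  show "lift_density c \<alpha> \<phi> (p, \<tau>) = 0" if "p \<notin> K" for p \<tau>
  proof (cases "p \<in> fst c")
    case True
    then have "snd c p \<notin> snd c ` K" using that notin_chart_image[OF assms(1) True _ assms(2)] by blast
    then show ?thesis using assms(4) True by (auto simp: lift_density_def)
  qed (simp add: lift_density_def)
qed (use assms(3) compact_imp_closed in blast)

lemma compact_chart_image: "c \<in> A \<Longrightarrow> K \<subseteq> fst c \<Longrightarrow> compact K \<Longrightarrow> compact (snd c ` K)"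
  by (meson compact_continuous_image continuous_chart(1) continuous_on_subset)

lemma coef_outside_base_support:
  assumes "c \<in> A" "x \<in> chart_image c - snd c ` base_support s"
  shows "coef c s x = 0"
proof -
  obtain p where "p \<in> fst c" "x = snd c p" "p \<notin> base_support s" using assms(2) by blast
  then show ?thesis using assms(1) not_in_base_support[of p s] by (simp add: coef_chart frame_def)
qed

lemma compact_support_coef:
  assumes "c \<in> A" "compact (base_support s)" "base_support s \<subseteq> fst c"
  shows "compact_support (chart_image c) (coef c s)"
  unfolding compact_support_def
  using compact_chart_image[OF assms(1,3,2)] assms(3) coef_outside_base_support[OF assms(1)]
  by (intro exI[of _ "snd c ` base_support s"]) auto

text \<open>The support lies in the domains of both charts, so the integral over the image of
  \<open>d\<close> reduces to the overlap, which the transition function parametrises from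
  \<open>c\<close>.\<close>

lemma integral_chart_change:
  assumes c: "c \<in> A" and d: "d \<in> A" and a: "continuous_on (chart_image d) a"
    and K: "compact K" "K \<subseteq> fst c" "K \<subseteq> fst d" "\<And>y. y \<in> chart_image d - snd d ` K \<Longrightarrow> a y = 0"
  shows "integral (chart_image d) a = integral (overlap c d) (\<lambda>x. \<bar>jdet c d x\<bar> * a (transition c d x))"
proof -
  have Kd: "snd d ` K \<subseteq> overlap d c" and Kc: "snd c ` K \<subseteq> overlap c d"
    using K(2,3) by (auto simp: overlap_def)
  have im: "transition c d ` overlap c d = overlap d c" by (rule transition_image[OF c d])
  have cs: "compact_support (overlap d c) a"
    unfolding compact_support_def using compact_chart_image[OF d K(3,1)] Kd K(4) overlap_subset[of d c]
    by (intro exI[of _ "snd d ` K"]) auto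
  have "integral (chart_image d) a = integral (overlap d c) a"
    by (rule integral_eq_support[OF overlap_subset], rule K(4)) (use Kd in blast)
  also have "\<dots> = integral (overlap c d) (\<lambda>x. \<bar>det (jacobian (transition c d) (at x))\<bar> * a (transition c d x))"
    unfolding im[symmetric]
  proof (rule change_of_variables)
    show "compact_support (overlap c d) (\<lambda>x. a (transition c d x))"
      unfolding compact_support_def
    proof (intro exI[of _ "snd c ` K"] conjI ballI)
      fix x assume x: "x \<in> overlap c d - snd c ` K"
      then obtain p where p: "p \<in> fst c" "p \<in> fst d" "x = snd c p" "p \<notin> K" by (auto simp: overlap_def)
      then have "snd d p \<notin> snd d ` K" using notin_chart_image[OF d _ _ K(3)] by blast
      then show "a (transition c d x) = 0" using p K(4) c by (simp add: transition_chart)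
    qed (use Kc compact_chart_image[OF c K(2,1)] in auto)
    show "continuous_on (overlap c d) (\<lambda>x. det (jacobian (transition c d) (at x)))"
      using smooth_on_continuous[OF smooth_jdet[OF c d]] unfolding jdet_def .
    show "continuous_on (transition c d ` overlap c d) a"
      unfolding im using a overlap_subset continuous_on_subset by blast
    show "compact_support (transition c d ` overlap c d) a" unfolding im by (rule cs)
  qed (use c d in \<open>auto simp: im open_overlap differentiable_transition inj_on_transition\<close>)
  finally show ?thesis by (simp add: jdet_def)
qed

text \<open>In weight 1 the factor in \<open>coef_transition\<close> is exactly the Jacobian factor
  of the substitution.\<close>

lemma integral_coef_chart_change:
  assumes c: "c \<in> A" and d: "d \<in> A" and \<rho>: "\<rho> \<in> densities A 1" "compact (base_support \<rho>)"
    "base_support \<rho> \<subseteq> fst c" "base_support \<rho> \<subseteq> fst d"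
  shows "integral (chart_image c) (coef c \<rho>) = integral (chart_image d) (coef d \<rho>)"
proof -
  have "integral (chart_image d) (coef d \<rho>)
    = integral (overlap c d) (\<lambda>x. \<bar>jdet c d x\<bar> * coef d \<rho> (transition c d x))"
    using smooth_on_continuous[OF smooth_coef[OF \<rho>(1) d]] coef_outside_base_support[OF d]
    by (rule integral_chart_change[OF c d _ \<rho>(2-4)])
  also have "\<dots> = integral (overlap c d) (coef c \<rho>)"
    using coef_transition[OF \<rho>(1) c d] by (intro integral_cong) simp
  also have "\<dots> = integral (chart_image c) (coef c \<rho>)"
  proof (rule integral_eq_support[symmetric])
    fix x assume "x \<in> chart_image c - overlap c d"
    then have "x \<in> chart_image c - snd c ` base_support \<rho>" using \<rho>(3,4) by (auto simp: overlap_def)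
    then show "coef c \<rho> x = 0" by (rule coef_outside_base_support[OF c])
  qed (rule overlap_subset)
  finally show ?thesis by simp
qed


section \<open>Partitions of unity and the integral of a density\<close>

definition subordinate :: "('a, 'n) chart \<Rightarrow> ('a \<Rightarrow> real) \<Rightarrow> bool" where
  "subordinate c \<theta> \<longleftrightarrow> smooth_function A \<theta> \<and>
     compact (closure {p. \<theta> p \<noteq> 0}) \<and> closure {p. \<theta> p \<noteq> 0} \<subseteq> fst c"

lemma subordinateI:
  assumes "smooth_function A \<theta>" "compact K" "K \<subseteq> fst c" "\<And>p. p \<notin> K \<Longrightarrow> \<theta> p = 0"
  shows "subordinate c \<theta>"
proof -
  have "closure {p. \<theta> p \<noteq> 0} \<subseteq> K"
    using assms(2,4) by (intro closure_minimal) (auto simp: compact_imp_closed)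
  then have "compact (closure {p. \<theta> p \<noteq> 0})"
    using compact_Int_closed[OF assms(2) closed_closure, of "{p. \<theta> p \<noteq> 0}"] by (simp add: Int_absorb1)
  then show ?thesis using assms \<open>closure {p. \<theta> p \<noteq> 0} \<subseteq> K\<close> unfolding subordinate_def by blast
qed

lemma subordinateE:
  assumes "subordinate c \<theta>"
  obtains K where "smooth_function A \<theta>" "compact K" "K \<subseteq> fst c" "\<And>p. p \<notin> K \<Longrightarrow> \<theta> p = 0"
  using assms closure_subset[of "{p. \<theta> p \<noteq> 0}"] unfolding subordinate_def by blast

lemma smooth_function_add:
  "smooth_function A f \<Longrightarrow> smooth_function A g \<Longrightarrow> smooth_function A (\<lambda>p. f p + g p)"
  unfolding smooth_function_def local_rep_def o_def by (auto intro!: smooth_on_add open_chart)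

lemma smooth_function_mult:
  "smooth_function A f \<Longrightarrow> smooth_function A g \<Longrightarrow> smooth_function A (\<lambda>p. f p * g p)"
  unfolding smooth_function_def local_rep_def o_def by (auto intro!: smooth_on_mult open_chart)

lemma smooth_function_diff:
  "smooth_function A f \<Longrightarrow> smooth_function A g \<Longrightarrow> smooth_function A (\<lambda>p. f p - g p)"
  unfolding smooth_function_def local_rep_def o_def by (auto intro!: smooth_on_diff open_chart)

lemma smooth_function_const: "smooth_function A (\<lambda>_. a)"
  unfolding smooth_function_def local_rep_def o_def by (simp add: smooth_on_const)

lemma smooth_function_sum:
  "(\<And>j. j \<in> J \<Longrightarrow> smooth_function A (f j)) \<Longrightarrow> smooth_function A (\<lambda>p. \<Sum>j\<in>J. f j p)"
  by (induction J rule: infinite_finite_induct) (auto simp: smooth_function_const smooth_function_add)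

lemma subordinate_add:
  assumes "subordinate c f" "subordinate c g"
  shows "subordinate c (\<lambda>p. f p + g p)"
proof -
  obtain K where K: "smooth_function A f" "compact K" "K \<subseteq> fst c" "\<And>p. p \<notin> K \<Longrightarrow> f p = 0"
    using subordinateE[OF assms(1)] by metis
  obtain L where L: "smooth_function A g" "compact L" "L \<subseteq> fst c" "\<And>p. p \<notin> L \<Longrightarrow> g p = 0"
    using subordinateE[OF assms(2)] by metis
  show ?thesis
    using K L by (intro subordinateI[of _ "K \<union> L"] smooth_function_add) auto
qed

lemma subordinate_mult:
  assumes "subordinate c f" "smooth_function A g"
  shows "subordinate c (\<lambda>p. f p * g p)"
proof -
  obtain K where K: "smooth_function A f" "compact K" "K \<subseteq> fst c" "\<And>p. p \<notin> K \<Longrightarrow> f p = 0"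
    using subordinateE[OF assms(1)] by metis
  show ?thesis using K assms(2) by (intro subordinateI[of _ K] smooth_function_mult) auto
qed

lemma subordinate_0: "subordinate c (\<lambda>_. 0)"
  by (rule subordinateI[of _ "{}"]) (auto simp: smooth_function_const)

lemma subordinate_bump:
  assumes c: "c \<in> A" and p: "p \<in> fst c"
  obtains \<theta> N where "subordinate c \<theta>" "open N" "p \<in> N" "\<And>q. q \<in> N \<Longrightarrow> \<theta> q = 1"
proof -
  obtain \<phi> r where \<phi>: "r > 0" "smooth_on UNIV \<phi>" "\<And>x. x \<in> cball (snd c p) r \<Longrightarrow> \<phi> x = 1"
    "cball (snd c p) (2 * r) \<subseteq> chart_image c" "\<And>x. x \<notin> cball (snd c p) (2 * r) \<Longrightarrow> \<phi> x = 0"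
    using bump_function[OF open_chart(2)[OF c], of "snd c p"] p by (metis imageI)
  let ?K = "cball (snd c p) (2 * r)"
  have cs: "compact_support (chart_image c) \<phi>"
    unfolding compact_support_def using \<phi>(4,5) by (intro exI[of _ ?K]) auto
  define \<theta> where "\<theta> q = (if q \<in> fst c then \<phi> (snd c q) else 0)" for q
  note K = compact_chart_inv_image[OF c compact_cball \<phi>(4)]
  have "smooth_function A \<theta>"
    unfolding smooth_function_def
  proof
    fix d assume d: "d \<in> A"
    \<comment> \<open>Smoothness of \<theta> in all charts is borrowed from the extension by zero in
      weight 0, whose coefficient in \<open>d\<close> is the coordinate expression of
      \<theta>.\<close>
    have "lift_density c 0 \<phi> \<in> densities A 0"
      using \<phi>(2) by (intro lift_density c cs) (auto intro: smooth_on_subset)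
    then have "smooth_on (chart_image d) (coef d (lift_density c 0 \<phi>))" using d by (rule smooth_coef)
    moreover have "coef d (lift_density c 0 \<phi>) y = local_rep d \<theta> y" if "y \<in> chart_image d" for y
    proof -
      from that obtain q where q: "q \<in> fst d" "y = snd d q" by blast
      show ?thesis
        using q d c frame_in_ext_manifold[OF d q(1), of 1] jdet_nonzero[OF d c q(1)]
        by (simp add: coef_chart local_rep_def chart_inv_chart \<theta>_def lift_density_def frame_def)
    qed
    ultimately show "smooth_on (chart_image d) (local_rep d \<theta>)"
      using smooth_on_cong[OF open_chart(2)[OF d], of "coef d (lift_density c 0 \<phi>)" "local_rep d \<theta>"] by blast
  qed
  then have sub: "subordinate c \<theta>"
  proof (rule subordinateI[OF _ K])
    show "\<theta> q = 0" if "q \<notin> chart_inv c ` ?K" for q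
    proof (cases "q \<in> fst c")
      case True
      then have "snd c q \<notin> ?K" using that chart_inv_chart[OF c True] by (metis imageI)
      then show ?thesis using \<phi>(5) True by (simp add: \<theta>_def)
    qed (simp add: \<theta>_def)
  qed
  let ?N = "{q \<in> fst c. snd c q \<in> ball (snd c p) r}"
  have "open ?N"
    using continuous_open_preimage[OF continuous_chart(1)[OF c] open_chart(1)[OF c] open_ball, of "snd c p" r]
    by (simp add: vimage_def Int_def)
  moreover have "\<theta> q = 1" if "q \<in> ?N" for q using that \<phi>(3)[of "snd c q"] by (simp add: \<theta>_def)
  ultimately show ?thesis using that[OF sub, of ?N] p \<phi>(1) by simp
qed

definition partition_on :: "'a set \<Rightarrow> ('a, 'n) chart set \<Rightarrow> (('a, 'n) chart \<Rightarrow> 'a \<Rightarrow> real) \<Rightarrow> bool" where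
  "partition_on K I \<theta> \<longleftrightarrow> finite I \<and> I \<subseteq> A \<and> (\<forall>c\<in>I. subordinate c (\<theta> c)) \<and> (\<forall>p\<in>K. (\<Sum>c\<in>I. \<theta> c p) = 1)"

text \<open>Expanding the product \<open>\<Prod>\<^sub>p (1 - f\<^sub>p)\<close> avoids dividing by the sum of the bumps \<open>f\<^sub>p\<close>.\<close>

lemma partition_of_unity_bumps:
  assumes "finite P" "\<And>p. p \<in> P \<Longrightarrow> c p \<in> B \<and> subordinate (c p) (f p)"
  shows "\<exists>I \<theta>. finite I \<and> I \<subseteq> B \<and> (\<forall>d\<in>I. subordinate d (\<theta> d)) \<and>
    (\<forall>q. (\<Sum>d\<in>I. \<theta> d q) = 1 - (\<Prod>p\<in>P. 1 - f p q))"
  using assms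
proof (induction P rule: finite_induct)
  case empty
  then show ?case by (intro exI[of _ "{}"]) auto
next
  case (insert p P)
  then obtain I \<theta> where I: "finite I" "I \<subseteq> B" "\<forall>d\<in>I. subordinate d (\<theta> d)"
    "\<forall>q. (\<Sum>d\<in>I. \<theta> d q) = 1 - (\<Prod>p\<in>P. 1 - f p q)" by auto
  let ?S = "\<lambda>q. \<Sum>d\<in>I. \<theta> d q"
  \<comment> \<open>With S the sum so far, 1 - (1 - f) (1 - S) = S + f (1 - S). The new term is
    added to the function of the chart \<open>c p\<close>, which may already belong to
    \<open>I\<close>.\<close>
  define \<eta> where "\<eta> d q = (if d \<in> I then \<theta> d q else 0) + (if d = c p then f p q * (1 - ?S q) else 0)" for d q
  have sm: "smooth_function A (\<lambda>q. 1 - ?S q)"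
    using I(3) by (intro smooth_function_diff smooth_function_const smooth_function_sum)
      (auto simp: subordinate_def)
  have sub: "subordinate d (\<eta> d)" if d: "d \<in> insert (c p) I" for d
  proof -
    have "subordinate d (\<lambda>q. if d \<in> I then \<theta> d q else 0)"
      using I(3) subordinate_0 by (cases "d \<in> I") auto
    moreover have "subordinate d (\<lambda>q. if d = c p then f p q * (1 - ?S q) else 0)"
      using insert.prems[of p] subordinate_0 subordinate_mult[OF _ sm, of "c p" "f p"] by (cases "d = c p") auto
    ultimately have "subordinate d (\<lambda>q. (if d \<in> I then \<theta> d q else 0) + (if d = c p then f p q * (1 - ?S q) else 0))"
      by (rule subordinate_add)
    then show ?thesis by (simp only: \<eta>_def[abs_def])
  qed
  have sum: "(\<Sum>d\<in>insert (c p) I. \<eta> d q) = 1 - (\<Prod>p\<in>insert p P. 1 - f p q)" for q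
  proof -
    have "(\<Sum>d\<in>insert (c p) I. \<eta> d q) = (\<Sum>d\<in>insert (c p) I. if d \<in> I then \<theta> d q else 0)
        + (\<Sum>d\<in>insert (c p) I. if d = c p then f p q * (1 - ?S q) else 0)"
      unfolding \<eta>_def by (rule sum.distrib)
    also have "(\<Sum>d\<in>insert (c p) I. if d \<in> I then \<theta> d q else 0) = ?S q"
      using I(1) by (intro sum.mono_neutral_cong_right) auto
    also have "(\<Sum>d\<in>insert (c p) I. if d = c p then f p q * (1 - ?S q) else 0) = f p q * (1 - ?S q)"
      using I(1) by (simp add: sum.delta)
    finally show ?thesis using I(4) insert.hyps by (simp add: algebra_simps)
  qed
  show ?case
    using I insert.prems[of p] sub sum by (intro exI[of _ "insert (c p) I"] exI[of _ \<eta>]) auto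
qed

lemma partition_of_unity:
  assumes K: "compact K" and B: "B \<subseteq> A" "K \<subseteq> (\<Union>c\<in>B. fst c)"
  obtains I \<theta> where "I \<subseteq> B" "partition_on K I \<theta>"
proof -
  have "\<forall>p\<in>K. \<exists>c f N. c \<in> B \<and> subordinate c f \<and> open N \<and> p \<in> N \<and> (\<forall>q\<in>N. f q = 1)"
  proof
    fix p assume "p \<in> K"
    then obtain c where c: "c \<in> B" "p \<in> fst c" using B by blast
    then have "c \<in> A" using B by blast
    from subordinate_bump[OF this c(2)]
    show "\<exists>c f N. c \<in> B \<and> subordinate c f \<and> open N \<and> p \<in> N \<and> (\<forall>q\<in>N. f q = 1)"
      using c(1) by metis
  qed
  then obtain c f N where cfN: "\<And>p. p \<in> K \<Longrightarrow>
      c p \<in> B \<and> subordinate (c p) (f p) \<and> open (N p) \<and> p \<in> N p \<and> (\<forall>q\<in>N p. f p q = 1)"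
    by metis
  obtain P where P: "P \<subseteq> K" "finite P" "K \<subseteq> (\<Union>p\<in>P. N p)"
    using compactE_image[OF K, of K N] cfN by (metis UN_I subsetI)
  have "\<And>p. p \<in> P \<Longrightarrow> c p \<in> B \<and> subordinate (c p) (f p)" using cfN P(1) by blast
  from partition_of_unity_bumps[OF P(2), of c B f, OF this]
  obtain I \<theta> where I: "finite I" "I \<subseteq> B" "\<forall>d\<in>I. subordinate d (\<theta> d)"
    "\<forall>q. (\<Sum>d\<in>I. \<theta> d q) = 1 - (\<Prod>p\<in>P. 1 - f p q)" by auto
  have "(\<Sum>d\<in>I. \<theta> d q) = 1" if q: "q \<in> K" for q
  proof -
    obtain p where "p \<in> P" "q \<in> N p" using q P(3) by auto
    \<comment> \<open>The bump \<open>f p\<close> equals 1 on \<open>N p\<close>, so one factor of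
      the product is 0.\<close>
    then have "(\<Prod>p\<in>P. 1 - f p q) = 0" using cfN[of p] P by (intro prod_zero) auto
    then show ?thesis using I(4) by simp
  qed
  then show ?thesis using that[of I \<theta>] I B unfolding partition_on_def by auto
qed

lemma densities_smooth_function_mult:
  assumes "smooth_function A \<theta>" "s \<in> densities A \<alpha>"
  shows "(\<lambda>q. \<theta> (fst q) * s q) \<in> densities A \<alpha>"
proof (rule densitiesI)
  show "smooth_on (chart_image c) (\<lambda>x. local_rep c \<theta> x * coef c s x)" if "c \<in> A" for c
    using assms that smooth_coef by (intro smooth_on_mult open_chart) (auto simp: smooth_function_def)
qed (use assms in \<open>auto simp: density_outside density_eq[symmetric] local_rep_def chart_inv_chart mult.assoc\<close>)

lemma coef_smooth_function_mult:
  assumes "c \<in> A" "x \<in> chart_image c"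
  shows "coef c (\<lambda>q. \<theta> (fst q) * s q) x = local_rep c \<theta> x * coef c s x"
  using assms by (auto simp: coef_chart local_rep_def chart_inv_chart)

lemma base_support_subordinate_mult:
  assumes "subordinate c \<theta>"
  shows "compact (base_support (\<lambda>q. \<theta> (fst q) * s q))" "base_support (\<lambda>q. \<theta> (fst q) * s q) \<subseteq> fst c"
proof -
  obtain K where K: "compact K" "K \<subseteq> fst c" "\<And>p. p \<notin> K \<Longrightarrow> \<theta> p = 0"
    using subordinateE[OF assms] by metis
  have "base_support (\<lambda>q. \<theta> (fst q) * s q) \<subseteq> K"
    using K by (intro base_support_subset_closed) (auto simp: compact_imp_closed)
  then show "compact (base_support (\<lambda>q. \<theta> (fst q) * s q))" "base_support (\<lambda>q. \<theta> (fst q) * s q) \<subseteq> fst c"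
    using K compact_base_support_subset by blast+
qed

lemma smooth_local_rep: "smooth_function A \<theta> \<Longrightarrow> c \<in> A \<Longrightarrow> smooth_on (chart_image c) (local_rep c \<theta>)"
  by (simp add: smooth_function_def)

lemma compact_support_subordinate:
  assumes "c \<in> A" "subordinate c \<theta>"
  shows "compact_support (chart_image c) (local_rep c \<theta>)"
proof -
  obtain K where K: "compact K" "K \<subseteq> fst c" "\<And>p. p \<notin> K \<Longrightarrow> \<theta> p = 0"
    using subordinateE[OF assms(2)] by metis
  have "compact (snd c ` K)"
    using K continuous_chart(1)[OF assms(1)] by (intro compact_continuous_image) (auto intro: continuous_on_subset)
  moreover have "local_rep c \<theta> x = 0" if x: "x \<in> chart_image c - snd c ` K" for x
  proof -
    from x obtain p where "p \<in> fst c" "x = snd c p" "p \<notin> K" by blast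
    then show ?thesis using K(3) by (simp add: local_rep_def chart_inv_chart[OF assms(1)])
  qed
  ultimately show ?thesis unfolding compact_support_def using K(2) by (intro exI[of _ "snd c ` K"]) auto
qed

section \<open>The integral of a density and its independence of the partition of unity\<close>

definition partition_integral ::
  "('a, 'n) chart set \<Rightarrow> (('a, 'n) chart \<Rightarrow> 'a \<Rightarrow> real) \<Rightarrow> (('a, 'n) ext_point \<Rightarrow> real) \<Rightarrow> real" where
  "partition_integral I \<theta> \<rho> = (\<Sum>c\<in>I. integral (chart_image c) (\<lambda>x. local_rep c (\<theta> c) x * coef c \<rho> x))"

text \<open>The second partition sums to 1 on the support of \<rho>, and off the support \<rho> is
  0, so it can be inserted everywhere. The resulting pieces are supported in two charts at
  once.\<close>

lemma partition_integral_refine: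
  assumes \<rho>: "\<rho> \<in> densities A 1" and I: "partition_on (base_support \<rho>) I \<theta>" and J: "partition_on (base_support \<rho>) J \<eta>"
  shows "partition_integral I \<theta> \<rho> =
    (\<Sum>c\<in>I. \<Sum>d\<in>J. integral (chart_image c) (coef c (\<lambda>q. \<eta> d (fst q) * (\<theta> c (fst q) * \<rho> q))))"
  unfolding partition_integral_def
proof (rule sum.cong[OF refl])
  fix c assume "c \<in> I"
  then have c: "c \<in> A" and sub: "subordinate c (\<theta> c)" using I by (auto simp: partition_on_def)
  have sJ: "d \<in> J \<Longrightarrow> subordinate d (\<eta> d)" "d \<in> J \<Longrightarrow> d \<in> A" for d using J by (auto simp: partition_on_def)
  let ?\<sigma> = "\<lambda>q. \<theta> c (fst q) * \<rho> q"
  have \<sigma>: "?\<sigma> \<in> densities A 1"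
    using sub \<rho> by (intro densities_smooth_function_mult) (auto simp: subordinate_def)
  have "(\<Sum>d\<in>J. integral (chart_image c) (coef c (\<lambda>q. \<eta> d (fst q) * ?\<sigma> q)))
    = integral (chart_image c) (\<lambda>x. \<Sum>d\<in>J. coef c (\<lambda>q. \<eta> d (fst q) * ?\<sigma> q) x)"
  proof (rule integral_sum[symmetric])
    show "finite J" using J by (simp add: partition_on_def)
    fix d assume d: "d \<in> J"
    show "coef c (\<lambda>q. \<eta> d (fst q) * ?\<sigma> q) integrable_on chart_image c"
    proof (rule integrable_compact_support)
      have "(\<lambda>q. \<eta> d (fst q) * ?\<sigma> q) \<in> densities A 1"
        using sJ[OF d] by (intro densities_smooth_function_mult \<sigma>) (auto simp: subordinate_def)
      then show "continuous_on (chart_image c) (coef c (\<lambda>q. \<eta> d (fst q) * ?\<sigma> q))"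
        using c smooth_coef smooth_on_continuous by blast
      have "compact_support (chart_image c) (\<lambda>x. local_rep c (\<eta> d) x * (local_rep c (\<theta> c) x * coef c \<rho> x))"
        using compact_support_subordinate[OF c sub] by (intro compact_support_mult)
      then show "compact_support (chart_image c) (coef c (\<lambda>q. \<eta> d (fst q) * ?\<sigma> q))"
        by (rule compact_support_cong[THEN iffD1, rotated])
          (simp add: coef_smooth_function_mult[OF c, where \<theta> = "\<eta> d"] coef_smooth_function_mult[OF c, where \<theta> = "\<theta> c"])
    qed
  qed
  also have "\<dots> = integral (chart_image c) (\<lambda>x. local_rep c (\<theta> c) x * coef c \<rho> x)"
  proof (rule integral_cong)
    fix x assume x: "x \<in> chart_image c"
    then obtain p where p: "p \<in> fst c" "x = snd c p" by blast
    have "(\<Sum>d\<in>J. coef c (\<lambda>q. \<eta> d (fst q) * ?\<sigma> q) x) = (\<Sum>d\<in>J. \<eta> d p) * (local_rep c (\<theta> c) x * coef c \<rho> x)"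
      using x c p by (simp add: coef_smooth_function_mult[OF c, where \<theta> = "\<eta> _"]
          coef_smooth_function_mult[OF c, where \<theta> = "\<theta> c"] local_rep_def chart_inv_chart sum_distrib_right)
    also have "\<dots> = local_rep c (\<theta> c) x * coef c \<rho> x"
    proof (cases "p \<in> base_support \<rho>")
      case True
      then show ?thesis using J by (simp add: partition_on_def)
    next
      case False
      then have "coef c \<rho> x = 0" using p c not_in_base_support[of p \<rho>] by (simp add: coef_chart frame_def)
      then show ?thesis by simp
    qed
    finally show "(\<Sum>d\<in>J. coef c (\<lambda>q. \<eta> d (fst q) * ?\<sigma> q) x) = local_rep c (\<theta> c) x * coef c \<rho> x" .
  qed
  finally show "integral (chart_image c) (\<lambda>x. local_rep c (\<theta> c) x * coef c \<rho> x) =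
     (\<Sum>d\<in>J. integral (chart_image c) (coef c (\<lambda>q. \<eta> d (fst q) * ?\<sigma> q)))" by simp
qed

text \<open>A piece supported in both \<open>c\<close> and \<open>d\<close> has the same integral in
  either chart by \<open>integral_coef_chart_change\<close>. After interchanging the sums, the
  double sum is the refinement of the other partition.\<close>

lemma partition_integral_unique:
  assumes \<rho>: "\<rho> \<in> densities A 1" and I: "partition_on (base_support \<rho>) I \<theta>" and J: "partition_on (base_support \<rho>) J \<eta>"
  shows "partition_integral I \<theta> \<rho> = partition_integral J \<eta> \<rho>"
proof -
  have "integral (chart_image c) (coef c (\<lambda>q. \<eta> d (fst q) * (\<theta> c (fst q) * \<rho> q)))
    = integral (chart_image d) (coef d (\<lambda>q. \<theta> c (fst q) * (\<eta> d (fst q) * \<rho> q)))"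
    if "c \<in> I" "d \<in> J" for c d
  proof -
    have sub: "c \<in> A" "d \<in> A" "subordinate c (\<theta> c)" "subordinate d (\<eta> d)"
      using that I J by (auto simp: partition_on_def)
    have eq: "(\<lambda>q. \<theta> c (fst q) * (\<eta> d (fst q) * \<rho> q)) = (\<lambda>q. \<eta> d (fst q) * (\<theta> c (fst q) * \<rho> q))"
      by (simp add: mult.left_commute)
    have "(\<lambda>q. \<eta> d (fst q) * (\<theta> c (fst q) * \<rho> q)) \<in> densities A 1"
      using sub \<rho> by (intro densities_smooth_function_mult) (auto simp: subordinate_def)
    then show ?thesis
      using integral_coef_chart_change[OF sub(1,2), of "\<lambda>q. \<eta> d (fst q) * (\<theta> c (fst q) * \<rho> q)"]
        base_support_subordinate_mult[OF sub(4), of "\<lambda>q. \<theta> c (fst q) * \<rho> q"]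
        base_support_subordinate_mult[OF sub(3), of "\<lambda>q. \<eta> d (fst q) * \<rho> q"]
      by (simp add: eq)
  qed
  then show ?thesis
    unfolding partition_integral_refine[OF \<rho> I J] partition_integral_refine[OF \<rho> J I]
    by (subst (2) sum.swap) (auto intro!: sum.cong)
qed

lemma density_integral_eq:
  assumes "\<rho> \<in> densities A 1" "partition_on (base_support \<rho>) I \<theta>"
  shows "density_integral A \<rho> = partition_integral I \<theta> \<rho>"
proof -
  have "density_integral A \<rho> = (THE v. \<exists>I \<theta>. partition_on (base_support \<rho>) I \<theta> \<and> v = partition_integral I \<theta> \<rho>)"
    unfolding density_integral_def partition_on_def subordinate_def partition_integral_def coef_def
    by (simp only: conj_assoc)
  also have "\<dots> = partition_integral I \<theta> \<rho>"
    using assms partition_integral_unique by (intro the_equality) blast+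
  finally show ?thesis .
qed

lemma density_integral_single_chart:
  assumes c: "c \<in> A" and \<rho>: "\<rho> \<in> densities A 1" and s: "compact (base_support \<rho>)" "base_support \<rho> \<subseteq> fst c"
  shows "density_integral A \<rho> = integral (chart_image c) (coef c \<rho>)"
proof -
  obtain I \<theta> where I: "I \<subseteq> {c}" "partition_on (base_support \<rho>) I \<theta>"
    using partition_of_unity[OF s(1), of "{c}"] c s(2) by auto
  \<comment> \<open>\<open>I\<close> can be empty only when the support is; any function subordinate
    to \<open>c\<close>, such as 0, then serves.\<close>
  define \<eta> where "\<eta> = (if I = {} then (\<lambda>_ _. 0) else \<theta>)"
  have "partition_on (base_support \<rho>) {c} \<eta>"
    using I c subordinate_0 by (cases "I = {}") (auto simp: partition_on_def \<eta>_def subset_singleton_iff)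
  then have p: "partition_on (base_support \<rho>) {c} \<eta>" .
  have "density_integral A \<rho> = integral (chart_image c) (\<lambda>x. local_rep c (\<eta> c) x * coef c \<rho> x)"
    using density_integral_eq[OF \<rho> p] by (simp add: partition_integral_def)
  also have "\<dots> = integral (chart_image c) (coef c \<rho>)"
  proof (rule integral_cong)
    fix x assume "x \<in> chart_image c"
    then obtain q where q: "q \<in> fst c" "x = snd c q" by blast
    show "local_rep c (\<eta> c) x * coef c \<rho> x = coef c \<rho> x"
    proof (cases "q \<in> base_support \<rho>")
      case True
      then have "\<eta> c q = 1" using p by (simp add: partition_on_def)
      then show ?thesis using q c by (simp add: local_rep_def chart_inv_chart)
    next
      case False
      then show ?thesis using q c not_in_base_support[of q \<rho>] by (simp add: coef_chart frame_def)
    qed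
  qed
  finally show ?thesis .
qed

lemma base_support_sum_subset:
  fixes h :: "'j \<Rightarrow> ('a, 'n) ext_point \<Rightarrow> real"
  assumes "finite J"
  shows "base_support (\<lambda>q. \<Sum>j\<in>J. h j q) \<subseteq> (\<Union>j\<in>J. base_support (h j))"
proof (rule base_support_subset_closed)
  show "closed (\<Union>j\<in>J. base_support (h j))"
    using assms by (intro closed_UN ballI closed_base_support)
  show "(\<Sum>j\<in>J. h j (p, \<tau>)) = 0" if "p \<notin> (\<Union>j\<in>J. base_support (h j))" for p \<tau>
    using that by (intro sum.neutral ballI not_in_base_support) blast
qed

text \<open>One partition of unity on the union of the supports serves all summands and their
  sum.\<close>

lemma density_integral_sum:
  assumes J: "finite J" and h: "\<And>j. j \<in> J \<Longrightarrow> h j \<in> densities A 1" "\<And>j. j \<in> J \<Longrightarrow> compact (base_support (h j))"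
  shows "density_integral A (\<lambda>q. \<Sum>j\<in>J. h j q) = (\<Sum>j\<in>J. density_integral A (h j))"
proof -
  let ?K = "\<Union>j\<in>J. base_support (h j)"
  have "compact ?K" using J h by (intro compact_UN) auto
  moreover have "?K \<subseteq> (\<Union>c\<in>A. fst c)" using chart_cover by blast
  ultimately obtain I \<theta> where I: "partition_on ?K I \<theta>" using partition_of_unity[of ?K A] by blast
  have "partition_on (base_support (\<lambda>q. \<Sum>j\<in>J. h j q)) I \<theta>"
    using I base_support_sum_subset[OF J, of h] unfolding partition_on_def by blast
  then have "density_integral A (\<lambda>q. \<Sum>j\<in>J. h j q) = partition_integral I \<theta> (\<lambda>q. \<Sum>j\<in>J. h j q)"
    using h(1) by (intro density_integral_eq densities_sum)
  also have "\<dots> = (\<Sum>c\<in>I. \<Sum>j\<in>J. integral (chart_image c) (\<lambda>x. local_rep c (\<theta> c) x * coef c (h j) x))"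
    unfolding partition_integral_def
  proof (rule sum.cong[OF refl])
    fix c assume "c \<in> I"
    then have c: "c \<in> A" "subordinate c (\<theta> c)" using I by (auto simp: partition_on_def)
    have "integral (chart_image c) (\<lambda>x. local_rep c (\<theta> c) x * coef c (\<lambda>q. \<Sum>j\<in>J. h j q) x)
      = integral (chart_image c) (\<lambda>x. \<Sum>j\<in>J. local_rep c (\<theta> c) x * coef c (h j) x)"
      by (simp add: coef_sum sum_distrib_left)
    also have "\<dots> = (\<Sum>j\<in>J. integral (chart_image c) (\<lambda>x. local_rep c (\<theta> c) x * coef c (h j) x))"
    proof (rule integral_sum[OF J])
      fix j assume "j \<in> J"
      show "(\<lambda>x. local_rep c (\<theta> c) x * coef c (h j) x) integrable_on chart_image c"
        using c compact_support_subordinate[OF c] smooth_coef[OF h(1)[OF \<open>j \<in> J\<close>] c(1)]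
        by (intro integrable_compact_support compact_support_mult(1) continuous_on_mult smooth_on_continuous smooth_local_rep)
          (auto simp: subordinate_def)
    qed
    finally show "integral (chart_image c) (\<lambda>x. local_rep c (\<theta> c) x * coef c (\<lambda>q. \<Sum>j\<in>J. h j q) x)
      = (\<Sum>j\<in>J. integral (chart_image c) (\<lambda>x. local_rep c (\<theta> c) x * coef c (h j) x))" .
  qed
  also have "\<dots> = (\<Sum>j\<in>J. partition_integral I \<theta> (h j))"
    unfolding partition_integral_def by (rule sum.swap)
  also have "\<dots> = (\<Sum>j\<in>J. density_integral A (h j))"
  proof (rule sum.cong[OF refl])
    fix j assume j: "j \<in> J"
    then have "partition_on (base_support (h j)) I \<theta>" using I unfolding partition_on_def by blast
    then show "partition_integral I \<theta> (h j) = density_integral A (h j)"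
      using density_integral_eq[OF h(1)[OF j]] by simp
  qed
  finally show ?thesis .
qed

end

section \<open>The canonical operator on densities of a fixed weight\<close>

text \<open>For f = u t^\<alpha>, the field S df is t^\<alpha> times the field with
  \<partial>/\<partial>x^i components \<open>flux\<close> and w coefficient \<open>flux0\<close>.
  The factor \<alpha> is the effect of w on f.\<close>

definition flux ::
  "(real^'n \<Rightarrow> real^'n^'n) \<Rightarrow> (real^'n \<Rightarrow> real^'n) \<Rightarrow> real \<Rightarrow> (real^'n \<Rightarrow> real) \<Rightarrow> 'n \<Rightarrow> real^'n::finite \<Rightarrow> real" where
  "flux S B \<alpha> u i x = (\<Sum>k\<in>UNIV. S x $ i $ k * partial_deriv k u x) + \<alpha> * (B x $ i * u x)"

definition flux0 ::
  "(real^'n \<Rightarrow> real^'n) \<Rightarrow> (real^'n \<Rightarrow> real) \<Rightarrow> real \<Rightarrow> (real^'n \<Rightarrow> real) \<Rightarrow> real^'n::finite \<Rightarrow> real" where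
  "flux0 B C \<alpha> u x = (\<Sum>k\<in>UNIV. B x $ k * partial_deriv k u x) + \<alpha> * (C x * u x)"

text \<open>With \<open>f = u t\<^sup>\<alpha>\<close> and \<open>g = v t\<^sup>\<beta>\<close>, \<open>canon\<close> is the coefficient of \<open>div (S df)\<close>, and \<open>form\<close> that of
  \<open>S(df, dg)\<close>.\<close>

definition canon ::
  "(real^'n \<Rightarrow> real^'n^'n) \<Rightarrow> (real^'n \<Rightarrow> real^'n) \<Rightarrow> (real^'n \<Rightarrow> real) \<Rightarrow> real \<Rightarrow> (real^'n \<Rightarrow> real) \<Rightarrow> real^'n::finite \<Rightarrow> real" where
  "canon S B C \<alpha> u x = (\<Sum>i\<in>UNIV. partial_deriv i (flux S B \<alpha> u i) x) + (\<alpha> - 1) * flux0 B C \<alpha> u x"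

definition form ::
  "(real^'n \<Rightarrow> real^'n^'n) \<Rightarrow> (real^'n \<Rightarrow> real^'n) \<Rightarrow> (real^'n \<Rightarrow> real) \<Rightarrow>
   real \<Rightarrow> (real^'n \<Rightarrow> real) \<Rightarrow> real \<Rightarrow> (real^'n \<Rightarrow> real) \<Rightarrow> real^'n::finite \<Rightarrow> real" where
  "form S B C \<alpha> u \<beta> v x = (\<Sum>i\<in>UNIV. flux S B \<alpha> u i x * partial_deriv i v x) + \<beta> * (flux0 B C \<alpha> u x * v x)"

text \<open>What \<open>local_operator\<close> does to the coefficient of a density of weight
  \<alpha>: w has become the number \<alpha>.\<close>

definition lop ::
  "(real^'n \<Rightarrow> real^'n^'n) \<Rightarrow> (real^'n \<Rightarrow> real^'n) \<Rightarrow> (real^'n \<Rightarrow> real) \<Rightarrow> (real^'n \<Rightarrow> real^'n) \<Rightarrow> (real^'n \<Rightarrow> real) \<Rightarrow>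
   (real^'n \<Rightarrow> real) \<Rightarrow> real \<Rightarrow> (real^'n \<Rightarrow> real) \<Rightarrow> real^'n::finite \<Rightarrow> real" where
  "lop S B C D E F \<alpha> u x = (\<Sum>i\<in>UNIV. \<Sum>k\<in>UNIV. S x $ i $ k * partial_deriv i (partial_deriv k u) x)
    + 2 * (\<Sum>i\<in>UNIV. B x $ i * (\<alpha> * partial_deriv i u x)) + C x * (\<alpha> * (\<alpha> * u x))
    + (\<Sum>i\<in>UNIV. D x $ i * partial_deriv i u x) + E x * (\<alpha> * u x) + F x * u x"

locale smooth_coefficients =
  fixes V :: "(real^'n::finite) set" and S :: "real^'n \<Rightarrow> real^'n^'n" and B :: "real^'n \<Rightarrow> real^'n" and C :: "real^'n \<Rightarrow> real"
  assumes V: "open V"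
    and S: "\<And>i k. smooth_on V (\<lambda>x. S x $ i $ k)"
    and B: "\<And>i. smooth_on V (\<lambda>x. B x $ i)"
    and C: "smooth_on V C"
begin

lemmas smooth_intros = smooth_on_add smooth_on_mult smooth_on_sum smooth_on_const smooth_on_diff
  smooth_on_partial_deriv V S B C

lemma smooth_flux: "smooth_on V u \<Longrightarrow> smooth_on V (flux S B \<alpha> u i)"
  unfolding flux_def[abs_def] by (intro smooth_intros) auto

lemma smooth_flux0: "smooth_on V u \<Longrightarrow> smooth_on V (flux0 B C \<alpha> u)"
  unfolding flux0_def[abs_def] by (intro smooth_intros) auto

lemma smooth_canon: "smooth_on V u \<Longrightarrow> smooth_on V (canon S B C \<alpha> u)"
  unfolding canon_def[abs_def] by (intro smooth_intros smooth_flux smooth_flux0) auto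

lemma smooth_form: "smooth_on V u \<Longrightarrow> smooth_on V v \<Longrightarrow> smooth_on V (form S B C \<alpha> u \<beta> v)"
  unfolding form_def[abs_def] by (intro smooth_intros smooth_flux smooth_flux0) auto

lemma compact_support_flux:
  assumes "compact_support V u"
  shows "compact_support V (flux S B \<alpha> u i)"
  unfolding flux_def[abs_def]
  by (intro compact_support_add compact_support_sum compact_support_mult(2) compact_support_partial_deriv V assms)

lemma compact_support_flux0:
  assumes "compact_support V u"
  shows "compact_support V (flux0 B C \<alpha> u)"
  unfolding flux0_def[abs_def]
  by (intro compact_support_add compact_support_sum compact_support_mult(2) compact_support_partial_deriv V assms)

text \<open>Integration by parts in the x-directions only: the divergence of \<open>flux\<close>
  times v is \<open>canon\<close> times v plus \<open>form\<close>. The terms (\<alpha> - 1)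
  \<open>flux0\<close> v and (1 - \<alpha>) \<open>flux0\<close> v cancel, which forces the second
  weight to be 1 - \<alpha>.\<close>

lemma integral_canon_mult:
  assumes u: "smooth_on V u" and v: "smooth_on V v" and cs: "compact_support V u \<or> compact_support V v"
  shows "integral V (\<lambda>x. canon S B C \<alpha> u x * v x) = - integral V (form S B C \<alpha> u (1 - \<alpha>) v)"
proof -
  let ?X = "flux S B \<alpha> u"
  have sm: "smooth_on V (\<lambda>x. ?X i x * v x)" for i
    by (intro smooth_on_mult V smooth_flux u v)
  have csX: "compact_support V (\<lambda>x. ?X i x * v x)" for i
    using cs by (auto intro: compact_support_mult compact_support_flux)
  have d: "partial_deriv i (\<lambda>x. ?X i x * v x) x = ?X i x * partial_deriv i v x + partial_deriv i (?X i) x * v x"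
    if "x \<in> V" for x i
    using that u v V by (intro partial_deriv_mult) (auto intro: smooth_on_differentiable_at smooth_flux)
  have int: "partial_deriv i (\<lambda>x. ?X i x * v x) integrable_on V" for i
    using sm csX V by (intro integrable_compact_support compact_support_partial_deriv smooth_on_continuous smooth_on_partial_deriv)
  have "integral V (\<lambda>x. \<Sum>i\<in>UNIV. partial_deriv i (\<lambda>x. ?X i x * v x) x) = 0"
    using integral_partial_deriv_eq_0[OF V sm csX] by (subst integral_sum) (auto simp: int)
  moreover have "(\<Sum>i\<in>UNIV. partial_deriv i (\<lambda>x. ?X i x * v x) x)
      = canon S B C \<alpha> u x * v x + form S B C \<alpha> u (1 - \<alpha>) v x" if "x \<in> V" for x
    using d[OF that] by (simp add: canon_def form_def sum.distrib sum_distrib_left sum_distrib_right algebra_simps)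
  ultimately have sum0: "integral V (\<lambda>x. canon S B C \<alpha> u x * v x + form S B C \<alpha> u (1 - \<alpha>) v x) = 0"
    using integral_cong[of V "\<lambda>x. \<Sum>i\<in>UNIV. partial_deriv i (\<lambda>x. ?X i x * v x) x"] by simp
  have csform: "compact_support V (form S B C \<alpha> u (1 - \<alpha>) v)"
    using cs
  proof
    assume "compact_support V u"
    then show ?thesis
      unfolding form_def[abs_def]
      by (intro compact_support_add compact_support_sum compact_support_flux[THEN compact_support_mult(1)]
          compact_support_flux0[THEN compact_support_mult(1), THEN compact_support_mult(2)])
  next
    assume "compact_support V v"
    then show ?thesis
      unfolding form_def[abs_def]
      by (intro compact_support_add compact_support_sum compact_support_mult(2) compact_support_partial_deriv V)
  qed
  have cscanon: "compact_support V (\<lambda>x. canon S B C \<alpha> u x * v x)"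
    using cs
  proof
    assume "compact_support V u"
    then have "compact_support V (canon S B C \<alpha> u)"
      unfolding canon_def[abs_def]
      by (intro compact_support_add compact_support_sum compact_support_mult(2) compact_support_partial_deriv V
          compact_support_flux compact_support_flux0)
    then show ?thesis by (rule compact_support_mult(1))
  qed (rule compact_support_mult(2))
  have "(\<lambda>x. canon S B C \<alpha> u x * v x) integrable_on V" "form S B C \<alpha> u (1 - \<alpha>) v integrable_on V"
    using csform cscanon smooth_on_mult[OF V smooth_canon[OF u, of \<alpha>] v] smooth_form[OF u v]
    by (auto intro!: integrable_compact_support intro: smooth_on_continuous)
  then show ?thesis using sum0 integral_add by force
qed

text \<open>In the expansion the two B-terms change places and the C-term is symmetric by itself;
  the remaining double sum uses the symmetry of the matrix.\<close>

lemma form_sym: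
  assumes "transpose (S x) = S x"
  shows "form S B C \<alpha> u \<beta> v x = form S B C \<beta> v \<alpha> u x"
proof -
  have s: "S x $ i $ k = S x $ k $ i" for i k
    using arg_cong[OF assms, of "\<lambda>M. M $ k $ i"] by (simp add: transpose_def)
  have e: "form S B C \<alpha> u \<beta> v x = (\<Sum>i\<in>UNIV. \<Sum>k\<in>UNIV. S x $ i $ k * partial_deriv k u x * partial_deriv i v x)
    + \<alpha> * (u x * (\<Sum>i\<in>UNIV. B x $ i * partial_deriv i v x)) + \<beta> * (v x * (\<Sum>i\<in>UNIV. B x $ i * partial_deriv i u x))
    + \<alpha> * \<beta> * C x * u x * v x" for \<alpha> u \<beta> v
    by (simp add: form_def flux_def flux0_def sum.distrib sum_distrib_left sum_distrib_right algebra_simps)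
  have "(\<Sum>i\<in>UNIV. \<Sum>k\<in>UNIV. S x $ i $ k * partial_deriv k u x * partial_deriv i v x)
    = (\<Sum>i\<in>UNIV. \<Sum>k\<in>UNIV. S x $ i $ k * partial_deriv k v x * partial_deriv i u x)"
    by (subst sum.swap) (intro sum.cong refl, simp add: s mult_ac)
  then show ?thesis unfolding e by (simp add: algebra_simps)
qed

lemma integral_canon_self_adjoint:
  assumes u: "smooth_on V u" and v: "smooth_on V v" and cs: "compact_support V u \<or> compact_support V v"
    and sym: "\<And>x. x \<in> V \<Longrightarrow> transpose (S x) = S x"
  shows "integral V (\<lambda>x. canon S B C \<alpha> u x * v x) = integral V (\<lambda>x. u x * canon S B C (1 - \<alpha>) v x)"
proof -
  have "integral V (form S B C \<alpha> u (1 - \<alpha>) v) = integral V (form S B C (1 - \<alpha>) v \<alpha> u)"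
    using form_sym[OF sym] by (intro integral_cong)
  then show ?thesis
    using integral_canon_mult[OF u v cs, of \<alpha>] integral_canon_mult[OF v u, of "1 - \<alpha>"] cs
    by (simp add: mult.commute[of "u _"] disj_commute)
qed

lemma partial_deriv_flux:
  assumes u: "smooth_on V u" and x: "x \<in> V"
  shows "partial_deriv i (flux S B \<alpha> u i) x =
    (\<Sum>k\<in>UNIV. S x $ i $ k * partial_deriv i (partial_deriv k u) x + partial_deriv i (\<lambda>x. S x $ i $ k) x * partial_deriv k u x)
    + \<alpha> * (B x $ i * partial_deriv i u x + partial_deriv i (\<lambda>x. B x $ i) x * u x)"
proof -
  have dS: "(\<lambda>x. S x $ i $ k) differentiable at x" and dB: "(\<lambda>x. B x $ i) differentiable at x"
    and du: "u differentiable at x" and dpu: "partial_deriv k u differentiable at x" for k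
    using S B u smooth_on_partial_deriv[OF u] V x smooth_on_differentiable_at by blast+
  show ?thesis
    unfolding flux_def[abs_def]
    using dS dB du dpu by (simp add: partial_deriv_add partial_deriv_sum partial_deriv_cmult partial_deriv_mult)
qed

text \<open>The product rule brings \<open>canon\<close> into the normal form of \<open>lop\<close>,
  so that another operator with the same symbol can be compared coefficient by coefficient. The
  corrections by B and C stem from the - 1 in the divergence.\<close>

lemma canon_expand:
  assumes u: "smooth_on V u" and x: "x \<in> V"
  shows "canon S B C \<alpha> u x =
    lop S B C (\<lambda>x. \<chi> i. (\<Sum>k\<in>UNIV. partial_deriv k (\<lambda>x. S x $ k $ i) x) - B x $ i)
      (\<lambda>x. (\<Sum>k\<in>UNIV. partial_deriv k (\<lambda>x. B x $ k) x) - C x) (\<lambda>_. 0) \<alpha> u x"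
proof -
  have "(\<Sum>i\<in>UNIV. \<Sum>k\<in>UNIV. partial_deriv i (\<lambda>x. S x $ i $ k) x * partial_deriv k u x)
    = (\<Sum>i\<in>UNIV. (\<Sum>k\<in>UNIV. partial_deriv k (\<lambda>x. S x $ k $ i) x) * partial_deriv i u x)"
    by (subst sum.swap) (simp add: sum_distrib_right)
  then show ?thesis
    using partial_deriv_flux[OF u x]
    by (simp add: canon_def lop_def flux0_def sum.distrib sum_distrib_left sum_distrib_right
        sum_subtractf algebra_simps)
qed

end


section \<open>Quasipolynomials\<close>

lemma linear_base_coords: "linear (base_coords :: real^('n::finite option) \<Rightarrow> real^'n)"
  by (rule linearI) (simp_all add: base_coords_def vec_eq_iff)

lemma open_half_space:
  fixes V :: "(real^'n::finite) set"
  assumes "open V"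
  shows "open (half_space V)"
proof -
  have "continuous_on UNIV (base_coords :: real^('n option) \<Rightarrow> real^'n)"
    by (intro linear_continuous_on linear_base_coords[unfolded linear_conv_bounded_linear])
  then have "open (base_coords -` V :: (real^('n option)) set)" by (rule open_vimage[OF assms])
  moreover have "open {y :: real^('n option). y $ None > 0}"
    by (rule open_Collect_less) (intro continuous_intros)+
  moreover have "half_space V = base_coords -` V \<inter> {y. y $ None > 0}" by (auto simp: half_space_def)
  ultimately show ?thesis by (metis open_Int)
qed

definition qp :: "real set \<Rightarrow> (real \<Rightarrow> real^'n \<Rightarrow> real) \<Rightarrow> real^('n::finite option) \<Rightarrow> real" where
  "qp F u y = (\<Sum>\<alpha>\<in>F. u \<alpha> (base_coords y) * y $ None powr \<alpha>)"

lemma qp_term: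
  fixes u :: "real^'n::finite \<Rightarrow> real" and y :: "real^('n option)"
  assumes u: "u differentiable at (base_coords y)" and t: "y $ None > 0"
  shows "(\<lambda>y. u (base_coords y) * y $ None powr \<alpha>) differentiable at y"
    and "partial_deriv (Some i) (\<lambda>y. u (base_coords y) * y $ None powr \<alpha>) y
      = partial_deriv i u (base_coords y) * y $ None powr \<alpha>"
    and "y $ None * partial_deriv None (\<lambda>y. u (base_coords y) * y $ None powr \<alpha>) y
      = \<alpha> * u (base_coords y) * y $ None powr \<alpha>"
proof -
  have db: "(base_coords :: real^('n option) \<Rightarrow> real^'n) differentiable at y"
    using linear_imp_differentiable[OF linear_base_coords] .
  have du: "(\<lambda>y. u (base_coords y)) differentiable at y"
    using differentiable_chain_at[OF db u] by (simp add: o_def)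
  have dn: "(\<lambda>y::real^('n option). y $ None) differentiable at y"
    by (rule linear_imp_differentiable) (simp add: linear_conv_bounded_linear bounded_linear_vec_nth)
  have h: "((\<lambda>t. t powr \<alpha>) has_real_derivative \<alpha> * y $ None powr (\<alpha> - 1)) (at (y $ None))"
    using t by (auto intro!: derivative_eq_intros)
  note pn = partial_deriv_compose_real[OF dn h]
  have p: "partial_deriv j (\<lambda>y. u (base_coords y)) y = (case j of None \<Rightarrow> 0 | Some i \<Rightarrow> partial_deriv i u (base_coords y))" for j
  proof -
    have "partial_deriv j (\<lambda>y. u (base_coords y)) y
      = (\<Sum>k\<in>UNIV. partial_deriv k u (base_coords y) * (if j = Some k then 1 else 0))"
      using partial_deriv_compose[OF db u, of j] by (simp add: base_coords_def partial_deriv_nth)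
    also have "\<dots> = (case j of None \<Rightarrow> 0 | Some i \<Rightarrow> partial_deriv i u (base_coords y))"
      by (simp split: option.split add: if_distrib[of "(*) _"] sum.delta' cong: if_cong)
    finally show ?thesis .
  qed
  show "(\<lambda>y. u (base_coords y) * y $ None powr \<alpha>) differentiable at y"
    using du pn(2) by (rule differentiable_mult)
  note m = partial_deriv_mult[OF du pn(2)]
  show "partial_deriv (Some i) (\<lambda>y. u (base_coords y) * y $ None powr \<alpha>) y
      = partial_deriv i u (base_coords y) * y $ None powr \<alpha>"
    by (simp add: m p pn(1) partial_deriv_nth)
  show "y $ None * partial_deriv None (\<lambda>y. u (base_coords y) * y $ None powr \<alpha>) y
      = \<alpha> * u (base_coords y) * y $ None powr \<alpha>"
    using t by (simp add: m p pn(1) partial_deriv_nth powr_diff)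
qed

text \<open>The closure properties of this relation compute the coefficients of a differential operator
  applied to a quasipolynomial.\<close>

definition is_qp :: "(real^'n::finite) set \<Rightarrow> real set \<Rightarrow> (real^('n option) \<Rightarrow> real) \<Rightarrow> (real \<Rightarrow> real^'n \<Rightarrow> real) \<Rightarrow> bool" where
  "is_qp V F g w \<longleftrightarrow> (\<forall>\<alpha>\<in>F. smooth_on V (w \<alpha>)) \<and> (\<forall>y\<in>half_space V. g y = qp F w y)"

lemma is_qp_value:
  "is_qp V F g w \<Longrightarrow> x \<in> V \<Longrightarrow> t > 0 \<Longrightarrow> g (ext_coords x t) = (\<Sum>\<alpha>\<in>F. w \<alpha> x * t powr \<alpha>)"
  by (simp add: is_qp_def qp_def)

lemma is_qp_cong:
  assumes "is_qp V F g w" "open V" "\<And>y. y \<in> half_space V \<Longrightarrow> g' y = g y"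
    and w: "\<And>\<alpha> x. \<alpha> \<in> F \<Longrightarrow> x \<in> V \<Longrightarrow> w' \<alpha> x = w \<alpha> x"
  shows "is_qp V F g' w'"
proof -
  have "smooth_on V (w' \<alpha>)" if "\<alpha> \<in> F" for \<alpha>
    using assms(1) that smooth_on_cong[OF assms(2), of "w' \<alpha>" "w \<alpha>"] w by (auto simp: is_qp_def)
  moreover have "g' y = qp F w' y" if "y \<in> half_space V" for y
    using assms(1,3) that w by (auto simp: is_qp_def qp_def half_space_def)
  ultimately show ?thesis by (simp add: is_qp_def)
qed

lemma is_qp_0: "is_qp V F (\<lambda>_. 0) (\<lambda>_ _. 0)"
  by (simp add: is_qp_def qp_def smooth_on_const)

lemma is_qp_add:
  "is_qp V F g w \<Longrightarrow> is_qp V F g' w' \<Longrightarrow> open V \<Longrightarrow> is_qp V F (\<lambda>y. g y + g' y) (\<lambda>\<alpha> x. w \<alpha> x + w' \<alpha> x)"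
  by (simp add: is_qp_def qp_def smooth_on_add sum.distrib distrib_right)

lemma is_qp_diff:
  "is_qp V F g w \<Longrightarrow> is_qp V F g' w' \<Longrightarrow> open V \<Longrightarrow> is_qp V F (\<lambda>y. g y - g' y) (\<lambda>\<alpha> x. w \<alpha> x - w' \<alpha> x)"
  by (simp add: is_qp_def qp_def smooth_on_diff sum_subtractf left_diff_distrib)

lemma is_qp_sum:
  assumes "\<And>j. j \<in> J \<Longrightarrow> is_qp V F (g j) (w j)" "open V"
  shows "is_qp V F (\<lambda>y. \<Sum>j\<in>J. g j y) (\<lambda>\<alpha> x. \<Sum>j\<in>J. w j \<alpha> x)"
  using assms(1)
  by (induction J rule: infinite_finite_induct) (auto simp: is_qp_0 intro!: is_qp_add assms(2))

lemma is_qp_mult: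
  "is_qp V F g w \<Longrightarrow> smooth_on V c \<Longrightarrow> open V \<Longrightarrow> is_qp V F (\<lambda>y. c (base_coords y) * g y) (\<lambda>\<alpha> x. c x * w \<alpha> x)"
  by (simp add: is_qp_def qp_def smooth_on_mult sum_distrib_left mult.assoc)

lemma is_qp_cmult:
  "is_qp V F g w \<Longrightarrow> open V \<Longrightarrow> is_qp V F (\<lambda>y. a * g y) (\<lambda>\<alpha> x. a * w \<alpha> x)"
  using is_qp_mult[OF _ smooth_on_const[of _ a]] .

lemma is_qp_differentiable:
  assumes g: "is_qp V F g w" and V: "open V" and y: "y \<in> half_space V"
  shows "g differentiable at y"
proof (rule differentiable_cong_open[OF open_half_space[OF V] y])
  show "qp F w z = g z" if "z \<in> half_space V" for z using g that by (simp add: is_qp_def)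
  show "qp F w differentiable at y"
    unfolding qp_def[abs_def]
  proof (cases "finite F")
    case True
    have "(\<lambda>y. w \<alpha> (base_coords y) * y $ None powr \<alpha>) differentiable at y" if "\<alpha> \<in> F" for \<alpha>
      using g that y smooth_on_differentiable_at[OF _ V]
      by (intro qp_term) (auto simp: is_qp_def half_space_def)
    with True show "(\<lambda>y. \<Sum>\<alpha>\<in>F. w \<alpha> (base_coords y) * y $ None powr \<alpha>) differentiable at y" by auto
  qed simp
qed

text \<open>Differentiation in x acts on the coefficients, and w multiplies the coefficient of
  t^\<alpha> by \<alpha>. No exponent changes, so operators built from these act on each weight
  separately.\<close>

lemma is_qp_partial_deriv:
  assumes g: "is_qp V F g w" and V: "open V"
  shows "is_qp V F (partial_deriv (Some i) g) (\<lambda>\<alpha>. partial_deriv i (w \<alpha>))"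
    and "is_qp V F (weight_op g) (\<lambda>\<alpha> x. \<alpha> * w \<alpha> x)"
proof -
  have d: "w \<alpha> differentiable at (base_coords y)" if "\<alpha> \<in> F" "y \<in> half_space V" for \<alpha> y
    using g that smooth_on_differentiable_at[OF _ V] by (auto simp: is_qp_def half_space_def)
  have t: "y $ None > 0" if "y \<in> half_space V" for y using that by (simp add: half_space_def)
  have eq: "partial_deriv j g y = (\<Sum>\<alpha>\<in>F. partial_deriv j (\<lambda>y. w \<alpha> (base_coords y) * y $ None powr \<alpha>) y)"
    if y: "y \<in> half_space V" for y j
  proof -
    have "partial_deriv j g y = partial_deriv j (qp F w) y"
      by (rule partial_deriv_cong[OF open_half_space[OF V] y]) (use g in \<open>simp add: is_qp_def\<close>)
    then show ?thesis
      unfolding qp_def[abs_def] using d y t by (subst (asm) partial_deriv_sum) (auto intro: qp_term(1))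
  qed
  show "is_qp V F (partial_deriv (Some i) g) (\<lambda>\<alpha>. partial_deriv i (w \<alpha>))"
    using g unfolding is_qp_def qp_def
    by (auto simp: eq qp_term(2) d t smooth_on_partial_deriv)
  show "is_qp V F (weight_op g) (\<lambda>\<alpha> x. \<alpha> * w \<alpha> x)"
    using g V unfolding is_qp_def qp_def weight_op_def
    by (auto simp: eq qp_term(3) d t sum_distrib_left intro!: smooth_on_mult smooth_on_const)
qed

context smooth_coefficients begin

lemmas is_qp_rules = is_qp_add is_qp_diff is_qp_sum is_qp_mult is_qp_cmult is_qp_partial_deriv V S B C

lemma is_qp_local_operator:
  assumes g: "is_qp V G g w" and D: "\<And>i. smooth_on V (\<lambda>x. D x $ i)" and E: "smooth_on V E" and F: "smooth_on V F"
  shows "is_qp V G (local_operator S B C D E F g) (\<lambda>\<alpha>. lop S B C D E F \<alpha> (w \<alpha>))"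
proof -
  \<comment> \<open>Spelled out so that the closure rules match term by term;
    \<open>is_qp_cong\<close> then passes to \<open>local_operator\<close> and
    \<open>lop\<close>.\<close>
  have "is_qp V G (\<lambda>y. (\<Sum>i\<in>UNIV. \<Sum>k\<in>UNIV. S (base_coords y) $ i $ k * partial_deriv (Some i) (partial_deriv (Some k) g) y)
     + 2 * (\<Sum>i\<in>UNIV. B (base_coords y) $ i * partial_deriv (Some i) (weight_op g) y)
     + C (base_coords y) * weight_op (weight_op g) y
     + (\<Sum>i\<in>UNIV. D (base_coords y) $ i * partial_deriv (Some i) g y)
     + E (base_coords y) * weight_op g y
     + F (base_coords y) * g y)
   (\<lambda>\<alpha> x. (\<Sum>i\<in>UNIV. \<Sum>k\<in>UNIV. S x $ i $ k * partial_deriv i (partial_deriv k (w \<alpha>)) x)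
     + 2 * (\<Sum>i\<in>UNIV. B x $ i * partial_deriv i (\<lambda>x. \<alpha> * w \<alpha> x) x) + C x * (\<alpha> * (\<alpha> * w \<alpha> x))
     + (\<Sum>i\<in>UNIV. D x $ i * partial_deriv i (w \<alpha>) x) + E x * (\<alpha> * w \<alpha> x) + F x * w \<alpha> x)"
    by (intro is_qp_rules g D E F)
  then show ?thesis
  proof (rule is_qp_cong[OF _ V])
    show "lop S B C D E F \<alpha> (w \<alpha>) x =
      (\<Sum>i\<in>UNIV. \<Sum>k\<in>UNIV. S x $ i $ k * partial_deriv i (partial_deriv k (w \<alpha>)) x)
     + 2 * (\<Sum>i\<in>UNIV. B x $ i * partial_deriv i (\<lambda>x. \<alpha> * w \<alpha> x) x) + C x * (\<alpha> * (\<alpha> * w \<alpha> x))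
     + (\<Sum>i\<in>UNIV. D x $ i * partial_deriv i (w \<alpha>) x) + E x * (\<alpha> * w \<alpha> x) + F x * w \<alpha> x"
      if "\<alpha> \<in> G" "x \<in> V" for \<alpha> x
    proof -
      have "w \<alpha> differentiable at x" using g that smooth_on_differentiable_at[OF _ V] by (auto simp: is_qp_def)
      then show ?thesis by (simp add: lop_def partial_deriv_cmult)
    qed
  qed (simp add: local_operator_def Let_def)
qed

text \<open>Links the explicit local formula to \<open>canon\<close>: with w replaced by \<alpha> it
  becomes the expansion in \<open>canon_expand\<close>.\<close>

lemma is_qp_canonical_local_operator:
  assumes g: "is_qp V G g w"
  shows "is_qp V G (canonical_local_operator S B C g) (\<lambda>\<alpha>. canon S B C \<alpha> (w \<alpha>))"
proof -
  have dB: "smooth_on V (\<lambda>x. \<Sum>k\<in>UNIV. partial_deriv k (\<lambda>x. B x $ k) x)"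
    by (intro smooth_intros)
  have dS: "smooth_on V (partial_deriv k (\<lambda>x. S x $ k $ i))" for i k by (intro smooth_intros)
  let ?Bg = "\<lambda>z. \<Sum>i\<in>UNIV. B (base_coords z) $ i * partial_deriv (Some i) g z"
  let ?dBg = "\<lambda>z. (\<Sum>k\<in>UNIV. partial_deriv k (\<lambda>x. B x $ k) (base_coords z)) * g z"
  let ?Cg = "\<lambda>z. C (base_coords z) * g z"
  have "is_qp V G (\<lambda>y. (\<Sum>i\<in>UNIV. \<Sum>k\<in>UNIV. S (base_coords y) $ i $ k * partial_deriv (Some i) (partial_deriv (Some k) g) y)
     + (\<Sum>i\<in>UNIV. \<Sum>k\<in>UNIV. partial_deriv k (\<lambda>x. S x $ k $ i) (base_coords y) * partial_deriv (Some i) g y)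
     + (2 * weight_op ?Bg y - ?Bg y) + weight_op ?dBg y + weight_op (\<lambda>z. weight_op ?Cg z - ?Cg z) y)
   (\<lambda>\<alpha> x. (\<Sum>i\<in>UNIV. \<Sum>k\<in>UNIV. S x $ i $ k * partial_deriv i (partial_deriv k (w \<alpha>)) x)
     + (\<Sum>i\<in>UNIV. \<Sum>k\<in>UNIV. partial_deriv k (\<lambda>x. S x $ k $ i) x * partial_deriv i (w \<alpha>) x)
     + (2 * (\<alpha> * (\<Sum>i\<in>UNIV. B x $ i * partial_deriv i (w \<alpha>) x)) - (\<Sum>i\<in>UNIV. B x $ i * partial_deriv i (w \<alpha>) x))
     + \<alpha> * ((\<Sum>k\<in>UNIV. partial_deriv k (\<lambda>x. B x $ k) x) * w \<alpha> x)
     + \<alpha> * (\<alpha> * (C x * w \<alpha> x) - C x * w \<alpha> x))"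
    by (intro is_qp_rules g dB dS)
  then show ?thesis
  proof (rule is_qp_cong[OF _ V])
    show "canon S B C \<alpha> (w \<alpha>) x =
      (\<Sum>i\<in>UNIV. \<Sum>k\<in>UNIV. S x $ i $ k * partial_deriv i (partial_deriv k (w \<alpha>)) x)
     + (\<Sum>i\<in>UNIV. \<Sum>k\<in>UNIV. partial_deriv k (\<lambda>x. S x $ k $ i) x * partial_deriv i (w \<alpha>) x)
     + (2 * (\<alpha> * (\<Sum>i\<in>UNIV. B x $ i * partial_deriv i (w \<alpha>) x)) - (\<Sum>i\<in>UNIV. B x $ i * partial_deriv i (w \<alpha>) x))
     + \<alpha> * ((\<Sum>k\<in>UNIV. partial_deriv k (\<lambda>x. B x $ k) x) * w \<alpha> x)
     + \<alpha> * (\<alpha> * (C x * w \<alpha> x) - C x * w \<alpha> x)"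
      if "\<alpha> \<in> G" "x \<in> V" for \<alpha> x
    proof -
      have "smooth_on V (w \<alpha>)" using g that by (simp add: is_qp_def)
      from canon_expand[OF this that(2)] show ?thesis
        by (simp add: lop_def sum_distrib_left sum_distrib_right sum_subtractf algebra_simps)
    qed
  qed (simp add: canonical_local_operator_def Let_def)
qed

end

section \<open>The canonical operator in charts\<close>

lemma sum_option: "(\<Sum>j\<in>UNIV. f j) = f None + (\<Sum>i\<in>UNIV. f (Some i))"
  for f :: "'i::finite option \<Rightarrow> 'b::comm_monoid_add"
proof -
  have "(\<Sum>j\<in>UNIV. f j) = f None + (\<Sum>j\<in>range Some. f j)"
    unfolding UNIV_option_conv by (rule sum.insert) auto
  then show ?thesis by (simp add: sum.reindex)
qed

lemma block_tensor_mult: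
  "(block_tensor S B C c y *v z) $ Some i =
    (\<Sum>k\<in>UNIV. S c (base_coords y) $ i $ k * z $ Some k) + B c (base_coords y) $ i * (y $ None * z $ None)"
  "(block_tensor S B C c y *v z) $ None =
    y $ None * ((\<Sum>k\<in>UNIV. B c (base_coords y) $ k * z $ Some k) + C c (base_coords y) * (y $ None * z $ None))"
  by (simp_all add: matrix_vector_mult_def block_tensor_def Let_def sum_option sum_distrib_left
      power2_eq_square algebra_simps)

locale weight_zero_coefficients = atlas A
  for A :: "('a::{t2_space, second_countable_topology}, 'n::finite) chart set" +
  fixes S :: "('a, 'n) matrix_coeff" and B :: "('a, 'n) vector_coeff" and C :: "('a, 'n) scalar_coeff"
  assumes S: "smooth_sym_matrix A S" and B: "smooth_vector A B" and C: "smooth_scalar A C"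
begin

lemma smooth_coefficients: "c \<in> A \<Longrightarrow> smooth_coefficients (chart_image c) (S c) (B c) (C c)"
  using S B C open_chart(2)
  by unfold_locales (auto simp: smooth_sym_matrix_def smooth_vector_def smooth_scalar_def)

lemma S_sym: "c \<in> A \<Longrightarrow> x \<in> chart_image c \<Longrightarrow> transpose (S c x) = S c x"
  using S by (auto simp: smooth_sym_matrix_def)

abbreviation T :: "('a, 'n) ext_tensor" where "T \<equiv> block_tensor S B C"

abbreviation K :: "('a, 'n) chart \<Rightarrow> real \<Rightarrow> (('a, 'n) ext_point \<Rightarrow> real) \<Rightarrow> real^'n \<Rightarrow> real" where
  "K c \<alpha> s \<equiv> canon (S c) (B c) (C c) \<alpha> (coef c s)"

text \<open>Links the geometric definition div(S ds) to \<open>canon\<close>, one chart at a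
  time.\<close>

lemma is_qp_divergence:
  assumes c: "c \<in> A" and g: "is_qp (chart_image c) F (local_rep (ext_chart A c) s) w"
  shows "is_qp (chart_image c) F (local_divergence (contract_differential A T s c))
    (\<lambda>\<alpha>. canon (S c) (B c) (C c) \<alpha> (w \<alpha>))"
proof -
  interpret smooth_coefficients "chart_image c" "S c" "B c" "C c" by (rule smooth_coefficients[OF c])
  let ?g = "local_rep (ext_chart A c) s"
  let ?X = "contract_differential A T s c"
  have X: "is_qp (chart_image c) F (\<lambda>z. ?X z $ Some i) (\<lambda>\<alpha>. flux (S c) (B c) \<alpha> (w \<alpha>) i)" for i
  proof (rule is_qp_cong[OF _ open_chart(2)[OF c]])
    show "is_qp (chart_image c) F (\<lambda>z. (\<Sum>k\<in>UNIV. S c (base_coords z) $ i $ k * partial_deriv (Some k) ?g z)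
        + B c (base_coords z) $ i * weight_op ?g z)
      (\<lambda>\<alpha> x. (\<Sum>k\<in>UNIV. S c x $ i $ k * partial_deriv k (w \<alpha>) x) + B c x $ i * (\<alpha> * w \<alpha> x))"
      by (intro is_qp_rules g)
  qed (simp_all add: contract_differential_def block_tensor_mult weight_op_def flux_def)
  \<comment> \<open>Division by t, which is positive on the half space, turns the
    \<partial>/\<partial>t component into the coefficient of w.\<close>
  have X0: "is_qp (chart_image c) F (\<lambda>z. ?X z $ None / z $ None) (\<lambda>\<alpha>. flux0 (B c) (C c) \<alpha> (w \<alpha>))"
  proof (rule is_qp_cong[OF _ open_chart(2)[OF c]])
    show "is_qp (chart_image c) F (\<lambda>z. (\<Sum>k\<in>UNIV. B c (base_coords z) $ k * partial_deriv (Some k) ?g z)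
        + C c (base_coords z) * weight_op ?g z)
      (\<lambda>\<alpha> x. (\<Sum>k\<in>UNIV. B c x $ k * partial_deriv k (w \<alpha>) x) + C c x * (\<alpha> * w \<alpha> x))"
      by (intro is_qp_rules g)
  qed (simp_all add: contract_differential_def block_tensor_mult weight_op_def flux0_def half_space_def)
  show ?thesis
  proof (rule is_qp_cong[OF _ open_chart(2)[OF c]])
    show "is_qp (chart_image c) F (\<lambda>y. (\<Sum>i\<in>UNIV. partial_deriv (Some i) (\<lambda>z. ?X z $ Some i) y)
        + weight_op (\<lambda>z. ?X z $ None / z $ None) y - ?X y $ None / y $ None)
      (\<lambda>\<alpha> x. (\<Sum>i\<in>UNIV. partial_deriv i (flux (S c) (B c) \<alpha> (w \<alpha>) i) x)
        + \<alpha> * flux0 (B c) (C c) \<alpha> (w \<alpha>) x - flux0 (B c) (C c) \<alpha> (w \<alpha>) x)"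
      by (intro is_qp_rules X X0)
  qed (simp_all add: local_divergence_def Let_def canon_def algebra_simps)
qed

end

section \<open>Differentials of densities under changes of extended charts\<close>

context atlas begin

definition grad :: "('a, 'n) chart \<Rightarrow> (('a, 'n) ext_point \<Rightarrow> real) \<Rightarrow> real^('n option) \<Rightarrow> real^('n option)" where
  "grad c s y = (\<chi> j. partial_deriv j (local_rep (ext_chart A c) s) y)"

lemma ext_transition:
  assumes c: "c \<in> A" and d: "d \<in> A" and x: "x \<in> overlap c d" and t: "t > 0"
  shows "transition (ext_chart A c) (ext_chart A d) (ext_coords x t)
    = ext_coords (transition c d x) (\<bar>jdet c d x\<bar> * t)"
    and "local_rep (ext_chart A c) s (ext_coords x t)
    = local_rep (ext_chart A d) s (ext_coords (transition c d x) (\<bar>jdet c d x\<bar> * t))"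
proof -
  obtain p where p: "p \<in> fst c" "p \<in> fst d" "x = snd c p" using x by (auto simp: overlap_def)
  have f: "frame c p t = frame d p (\<bar>jdet c d x\<bar> * t)"
    using ext_point_eq_frame[OF frame_in_ext_manifold[OF c p(1) t, unfolded frame_def] d p(2)] p d
    by (simp add: frame_def)
  have jt: "\<bar>jdet c d x\<bar> * t > 0" using jdet_nonzero_overlap[OF c d x] t by simp
  show "transition (ext_chart A c) (ext_chart A d) (ext_coords x t)
    = ext_coords (transition c d x) (\<bar>jdet c d x\<bar> * t)"
    using chart_inv_ext_chart[OF c p(1) t] snd_ext_chart_frame[OF d p(2)] f p c
    by (simp add: transition_def[of "ext_chart A c"] transition_chart)
  show "local_rep (ext_chart A c) s (ext_coords x t)
    = local_rep (ext_chart A d) s (ext_coords (transition c d x) (\<bar>jdet c d x\<bar> * t))"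
    using local_rep_frame[OF c p(1) t, of s] local_rep_frame[OF d p(2) jt, of s] f p c
    by (simp add: transition_chart)
qed

lemma ext_overlap:
  assumes c: "c \<in> A" and d: "d \<in> A"
  shows "snd (ext_chart A c) ` (fst (ext_chart A c) \<inter> fst (ext_chart A d)) = half_space (overlap c d)"
proof (intro equalityI subsetI)
  fix y assume "y \<in> snd (ext_chart A c) ` (fst (ext_chart A c) \<inter> fst (ext_chart A d))"
  then obtain q where q: "q \<in> ext_manifold A" "fst q \<in> fst c" "fst q \<in> fst d" "y = snd (ext_chart A c) q"
    by (auto simp: fst_ext_chart)
  from ext_point_cases[OF q(1) c q(2)] obtain t where "t > 0" "q = frame c (fst q) t" .
  then show "y \<in> half_space (overlap c d)"
    using q snd_ext_chart_frame[OF c q(2), of t] by (auto simp: overlap_def)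
next
  fix y assume "y \<in> half_space (overlap c d)"
  then obtain x t where y: "y = ext_coords x t" "x \<in> overlap c d" "t > 0" by (rule half_space_cases)
  then obtain p where p: "p \<in> fst c" "p \<in> fst d" "x = snd c p" by (auto simp: overlap_def)
  show "y \<in> snd (ext_chart A c) ` (fst (ext_chart A c) \<inter> fst (ext_chart A d))"
  proof (rule image_eqI[of _ _ "frame c p t"])
    show "y = snd (ext_chart A c) (frame c p t)" using y p snd_ext_chart_frame[OF c p(1)] by simp
    show "frame c p t \<in> fst (ext_chart A c) \<inter> fst (ext_chart A d)"
      using frame_in_ext_manifold[OF c p(1) y(3)] p by (simp add: fst_ext_chart)
  qed
qed

text \<open>The transition map is itself quasipolynomial: its x-components have weight 0, and its
  t-component |J| t has weight 1.\<close>

lemma differentiable_ext_transition: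
  assumes c: "c \<in> A" and d: "d \<in> A" and y: "y \<in> half_space (overlap c d)"
  shows "transition (ext_chart A c) (ext_chart A d) differentiable at y"
proof (rule differentiable_vec_components)
  let ?\<phi> = "transition (ext_chart A c) (ext_chart A d)"
  fix j
  have "\<exists>F w. is_qp (overlap c d) F (\<lambda>y. ?\<phi> y $ j) w"
  proof (cases j)
    case None
    have "smooth_on (overlap c d) (\<lambda>x. \<bar>jdet c d x\<bar>)"
      using smooth_abs_jdet_powr[OF c d, of 1] by simp
    then have "is_qp (overlap c d) {1} (\<lambda>y. ?\<phi> y $ j) (\<lambda>_ x. \<bar>jdet c d x\<bar>)"
      unfolding is_qp_def qp_def None using ext_transition(1)[OF c d]
      by (auto elim!: half_space_cases)
    then show ?thesis by blast
  next
    case (Some i)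
    have "is_qp (overlap c d) {0} (\<lambda>y. ?\<phi> y $ j) (\<lambda>_ x. transition c d x $ i)"
      unfolding is_qp_def qp_def Some using ext_transition(1)[OF c d] smooth_transition[OF c d]
      by (auto elim!: half_space_cases)
    then show ?thesis by blast
  qed
  then show "(\<lambda>y. ?\<phi> y $ j) differentiable at y"
    using is_qp_differentiable[OF _ open_overlap[OF c d] y] by blast
qed

lemma grad_transition:
  assumes c: "c \<in> A" and d: "d \<in> A" and y: "y \<in> half_space (overlap c d)"
    and s: "local_rep (ext_chart A d) s differentiable at (transition (ext_chart A c) (ext_chart A d) y)"
  shows "grad c s y = transpose (jacobian (transition (ext_chart A c) (ext_chart A d)) (at y)) *v
    grad d s (transition (ext_chart A c) (ext_chart A d) y)"
proof -
  let ?\<phi> = "transition (ext_chart A c) (ext_chart A d)"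
  note d\<phi> = differentiable_ext_transition[OF c d y]
  have "partial_deriv j (local_rep (ext_chart A c) s) y
    = (\<Sum>l\<in>UNIV. partial_deriv l (local_rep (ext_chart A d) s) (?\<phi> y) * partial_deriv j (\<lambda>y. ?\<phi> y $ l) y)" for j
  proof -
    have "partial_deriv j (local_rep (ext_chart A c) s) y
      = partial_deriv j (\<lambda>y. local_rep (ext_chart A d) s (?\<phi> y)) y"
    proof (rule partial_deriv_cong[OF open_half_space[OF open_overlap[OF c d]] y])
      fix z assume "z \<in> half_space (overlap c d)"
      then obtain x t where "z = ext_coords x t" "x \<in> overlap c d" "t > 0" by (rule half_space_cases)
      then show "local_rep (ext_chart A c) s z = local_rep (ext_chart A d) s (?\<phi> z)"
        using ext_transition[OF c d, of x t] by simp
    qed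
    then show ?thesis using partial_deriv_compose[OF d\<phi> s] by simp
  qed
  then show ?thesis
    by (simp add: grad_def vec_eq_iff matrix_vector_mult_def transpose_def jacobian_component[OF d\<phi>] mult.commute)
qed

lemma is_qp_density:
  assumes "\<And>\<alpha>. \<alpha> \<in> F \<Longrightarrow> h \<alpha> \<in> densities A \<alpha>" "c \<in> A"
  shows "is_qp (chart_image c) F (local_rep (ext_chart A c) (\<lambda>q. \<Sum>\<alpha>\<in>F. h \<alpha> q)) (\<lambda>\<alpha>. coef c (h \<alpha>))"
  unfolding is_qp_def
proof (intro conjI ballI)
  show "smooth_on (chart_image c) (coef c (h \<alpha>))" if "\<alpha> \<in> F" for \<alpha> using assms that smooth_coef by blast
  show "local_rep (ext_chart A c) (\<lambda>q. \<Sum>\<alpha>\<in>F. h \<alpha> q) y = qp F (\<lambda>\<alpha>. coef c (h \<alpha>)) y"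
    if y: "y \<in> half_space (chart_image c)" for y
  proof -
    have "local_rep (ext_chart A c) (\<lambda>q. \<Sum>\<alpha>\<in>F. h \<alpha> q) y = (\<Sum>\<alpha>\<in>F. local_rep (ext_chart A c) (h \<alpha>) y)"
      by (simp add: local_rep_def)
    moreover obtain x t where "y = ext_coords x t" "x \<in> chart_image c" "t > 0"
      using y by (rule half_space_cases)
    ultimately show ?thesis
      using local_rep_density[OF assms(1) assms(2), of _ x t] by (simp add: qp_def)
  qed
qed

lemma is_qp_single_density:
  assumes "s \<in> densities A \<alpha>" "c \<in> A"
  shows "is_qp (chart_image c) {\<alpha>} (local_rep (ext_chart A c) s) (\<lambda>_. coef c s)"
  using is_qp_density[of "{\<alpha>}" "\<lambda>_. s" c] assms by simp

lemma grad_density: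
  assumes s: "s \<in> densities A \<alpha>" and c: "c \<in> A" and x: "x \<in> chart_image c" and t: "t > 0"
  shows "grad c s (ext_coords x t) $ Some i = partial_deriv i (coef c s) x * t powr \<alpha>"
    "t * grad c s (ext_coords x t) $ None = \<alpha> * coef c s x * t powr \<alpha>"
  using is_qp_partial_deriv[OF is_qp_single_density[OF s c] open_chart(2)[OF c], THEN is_qp_value, OF x t]
  by (simp_all add: grad_def weight_op_def)

lemma differentiable_local_rep_density:
  assumes s: "s \<in> densities A \<alpha>" and c: "c \<in> A" and y: "y \<in> half_space (chart_image c)"
  shows "local_rep (ext_chart A c) s differentiable at y"
  by (rule is_qp_differentiable[OF is_qp_single_density[OF s c] open_chart(2)[OF c] y])

end

context weight_zero_coefficients begin

text \<open>The factors t in \<open>block_tensor\<close> combine with \<partial>/\<partial>t to w,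
  which acts on the two densities by their weights; all terms then carry the same power of
  t.\<close>

lemma inner_grad:
  assumes f: "f \<in> densities A \<alpha>" and g: "g \<in> densities A \<beta>" and c: "c \<in> A" and x: "x \<in> chart_image c" and t: "t > 0"
  shows "grad c g (ext_coords x t) \<bullet> (T c (ext_coords x t) *v grad c f (ext_coords x t))
    = form (S c) (B c) (C c) \<alpha> (coef c f) \<beta> (coef c g) x * t powr (\<alpha> + \<beta>)"
proof -
  let ?y = "ext_coords x t"
  note gf = grad_density[OF f c x t] and gg = grad_density[OF g c x t]
  have 1: "(T c ?y *v grad c f ?y) $ Some i = flux (S c) (B c) \<alpha> (coef c f) i x * t powr \<alpha>" for i
    by (simp add: block_tensor_mult gf flux_def sum_distrib_left sum_distrib_right algebra_simps)
  have 2: "(T c ?y *v grad c f ?y) $ None = t * (flux0 (B c) (C c) \<alpha> (coef c f) x * t powr \<alpha>)"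
    by (simp add: block_tensor_mult gf flux0_def sum_distrib_left sum_distrib_right algebra_simps)
  have "grad c g ?y \<bullet> (T c ?y *v grad c f ?y)
    = (t * grad c g ?y $ None) * (flux0 (B c) (C c) \<alpha> (coef c f) x * t powr \<alpha>)
    + (\<Sum>i\<in>UNIV. grad c g ?y $ Some i * (flux (S c) (B c) \<alpha> (coef c f) i x * t powr \<alpha>))"
    by (simp add: inner_vec_def sum_option 1 2)
  also have "\<dots> = form (S c) (B c) (C c) \<alpha> (coef c f) \<beta> (coef c g) x * t powr (\<alpha> + \<beta>)"
    by (simp only: gg) (simp add: form_def powr_add sum_distrib_left sum_distrib_right algebra_simps)
  finally show ?thesis .
qed

end

locale weight_zero_tensor_field = weight_zero_coefficients A S B C
  for A :: "('a::{t2_space, second_countable_topology}, 'n::finite) chart set" and S B C +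
  assumes contravariant: "contravariant_2_tensor A T"
begin

text \<open>The Jacobian matrices in the tensor law and in the two gradients match up, so S(df, dg)
  has the same value in both charts. The power of |jdet| only accounts for the t-coordinate in
  \<open>d\<close> of the point with t = 1 in \<open>c\<close>.\<close>

lemma form_transition:
  assumes f: "f \<in> densities A \<alpha>" and g: "g \<in> densities A \<beta>" and c: "c \<in> A" and d: "d \<in> A" and x: "x \<in> overlap c d"
  shows "form (S c) (B c) (C c) \<alpha> (coef c f) \<beta> (coef c g) x =
    \<bar>jdet c d x\<bar> powr (\<alpha> + \<beta>) * form (S d) (B d) (C d) \<alpha> (coef d f) \<beta> (coef d g) (transition c d x)"
proof -
  let ?y = "ext_coords x 1"
  let ?\<phi> = "transition (ext_chart A c) (ext_chart A d)"
  let ?J = "jacobian ?\<phi> (at ?y)"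
  have y: "?y \<in> half_space (overlap c d)" using x by simp
  have \<phi>y: "?\<phi> ?y = ext_coords (transition c d x) \<bar>jdet c d x\<bar>" using ext_transition(1)[OF c d x, of 1] by simp
  have j: "\<bar>jdet c d x\<bar> > 0" using jdet_nonzero_overlap[OF c d x] by simp
  have xc: "x \<in> chart_image c" and xd: "transition c d x \<in> chart_image d"
    using x overlap_subset transition_overlap[OF c x] by blast+
  have yd: "?\<phi> ?y \<in> half_space (chart_image d)" using xd j by (simp add: \<phi>y)
  have Td: "T d (?\<phi> ?y) = ?J ** T c ?y ** transpose ?J"
    using contravariant c d y ext_overlap[OF c d] unfolding contravariant_2_tensor_def Let_def by blast
  note gt = grad_transition[OF c d y differentiable_local_rep_density[OF _ d yd]]
  have "grad c g ?y \<bullet> (T c ?y *v grad c f ?y) = grad d g (?\<phi> ?y) \<bullet> (T d (?\<phi> ?y) *v grad d f (?\<phi> ?y))"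
    unfolding Td gt[OF f] gt[OF g]
    by (simp add: transpose_matrix_vector dot_lmul_matrix matrix_vector_mul_assoc[symmetric])
  then show ?thesis
    using inner_grad[OF f g c xc, of 1] inner_grad[OF f g d xd j] by (simp add: \<phi>y mult.commute)
qed

text \<open>Both sides have the same integrals against densities of weight \<open>1 - \<alpha>\<close> that are supported in the
  overlap: integrated by parts, these become integrals of the invariant \<open>S(ds, dg)\<close>. No derivative of
  the Jacobian determinant occurs.\<close>

lemma canon_transition:
  assumes s: "s \<in> densities A \<alpha>" and c: "c \<in> A" and d: "d \<in> A" and x: "x \<in> overlap c d"
  shows "K c \<alpha> s x = \<bar>jdet c d x\<bar> powr \<alpha> * K d \<alpha> s (transition c d x)"
proof -
  interpret c: smooth_coefficients "chart_image c" "S c" "B c" "C c" by (rule smooth_coefficients[OF c])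
  interpret d: smooth_coefficients "chart_image d" "S d" "B d" "C d" by (rule smooth_coefficients[OF d])
  let ?O = "overlap c d"
  let ?R = "\<lambda>x. \<bar>jdet c d x\<bar> powr \<alpha> * K d \<alpha> s (transition c d x)"
  note sc = smooth_coef[OF s c] and sd = smooth_coef[OF s d]
  have cK: "continuous_on ?O (K c \<alpha> s)"
    using smooth_on_continuous[OF c.smooth_canon[OF sc]] overlap_subset continuous_on_subset by blast
  have tr: "continuous_on ?O (transition c d)"
    using differentiable_transition[OF c d] by (meson differentiable_imp_continuous_within continuous_at_imp_continuous_on)
  have cR: "continuous_on ?O ?R"
  proof (intro continuous_on_mult)
    show "continuous_on ?O (\<lambda>x. \<bar>jdet c d x\<bar> powr \<alpha>)"
      using smooth_on_continuous[OF smooth_abs_jdet_powr[OF c d]] .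
    show "continuous_on ?O (\<lambda>x. K d \<alpha> s (transition c d x))"
      using transition_image[OF c d] overlap_subset[of d c]
      by (intro continuous_on_compose2[OF smooth_on_continuous[OF d.smooth_canon[OF sd]] tr]) auto
  qed
  have "K c \<alpha> s x - ?R x = 0"
  proof (rule fundamental_lemma[OF open_overlap[OF c d] _ _ x])
    show "continuous_on ?O (\<lambda>x. K c \<alpha> s x - ?R x)" by (intro continuous_on_diff cK cR)
    fix \<phi> :: "real^'n \<Rightarrow> real" assume \<phi>: "smooth_on UNIV \<phi>" "compact_support ?O \<phi>"
    let ?v = "\<lambda>x. \<phi> x * \<phi> x"
    obtain L where L: "compact L" "L \<subseteq> ?O" "\<forall>x\<in>?O - L. \<phi> x = 0" using \<phi>(2) unfolding compact_support_def by metis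
    \<comment> \<open>\<phi> may be non-zero outside the overlap. The cut-off is still smooth and
      vanishes off \<open>L\<close>, so it can serve as a coefficient on the whole image of
      \<open>c\<close>.\<close>
    define \<phi>' where "\<phi>' x = (if x \<in> ?O then \<phi> x else 0)" for x
    have \<phi>': "smooth_on UNIV \<phi>'"
      unfolding \<phi>'_def[abs_def] using \<phi>(1) L compact_imp_closed open_overlap[OF c d] smooth_on_subset
      by (intro smooth_on_extend_zero[of _ _ L]) blast+
    let ?w = "\<lambda>x. \<phi>' x * \<phi>' x"
    have w: "smooth_on (chart_image c) ?w"
      using smooth_on_mult[OF open_UNIV \<phi>' \<phi>'] smooth_on_subset by blast
    have w0: "?w x = 0" if "x \<notin> L" for x using L(3) that by (auto simp: \<phi>'_def)
    let ?M = "chart_inv c ` L"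
    have Lc: "L \<subseteq> chart_image c" using L(2) overlap_subset by blast
    have M: "compact ?M" "?M \<subseteq> fst c" "?M \<subseteq> fst d" "snd c ` ?M = L"
      using compact_chart_inv_image[OF c L(1) Lc] L(2) overlap_iff[OF c, of _ d] chart_chart_inv[OF c] Lc
      by (auto simp: image_image subset_iff)
    define g where "g = lift_density c (1 - \<alpha>) ?w"
    have csw: "compact_support (chart_image c) ?w"
      unfolding compact_support_def using L(1) Lc w0 by blast
    have g: "g \<in> densities A (1 - \<alpha>)" unfolding g_def by (rule lift_density[OF c w csw])
    have supp: "base_support g \<subseteq> ?M"
      unfolding g_def using M w0 by (intro lift_density_support[OF c M(2,1)]) auto
    have csupp: "compact (base_support g)" using supp M(1) compact_base_support_subset by blast
    have supp_cd: "base_support g \<subseteq> fst c" "base_support g \<subseteq> fst d" using supp M by blast+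
    have gc: "coef c g x = ?w x" if "x \<in> chart_image c" for x
      unfolding g_def by (rule coef_lift_density[OF c that])
    note sgc = smooth_coef[OF g c] and sgd = smooth_coef[OF g d]
    note csc = compact_support_coef[OF c csupp supp_cd(1)] and csd = compact_support_coef[OF d csupp supp_cd(2)]
    \<comment> \<open>\<open>form\<close> contains derivatives of the coefficient of
      \<open>g\<close>; they vanish off the support because the complement is open.\<close>
    have form0: "form (S e) (B e) (C e) \<alpha> (coef e s) (1 - \<alpha>) (coef e g) y = 0"
      if e: "e \<in> A" "base_support g \<subseteq> fst e" and y: "y \<in> chart_image e - snd e ` base_support g" for e y
    proof -
      have op: "open (chart_image e - snd e ` base_support g)"
        using e csupp by (intro open_Diff open_chart compact_imp_closed compact_chart_image)
      have "partial_deriv i (coef e g) y = partial_deriv i (\<lambda>_. 0) y" for i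
        by (rule partial_deriv_cong[OF op y]) (rule coef_outside_base_support[OF e(1)])
      then show ?thesis
        using coef_outside_base_support[OF e(1) y] by (simp add: form_def partial_deriv_const)
    qed
    let ?fc = "form (S c) (B c) (C c) \<alpha> (coef c s) (1 - \<alpha>) (coef c g)"
    let ?fd = "form (S d) (B d) (C d) \<alpha> (coef d s) (1 - \<alpha>) (coef d g)"
    have "integral (chart_image d) ?fd = integral ?O (\<lambda>x. \<bar>jdet c d x\<bar> * ?fd (transition c d x))"
      using smooth_on_continuous[OF d.smooth_form[OF sd sgd]] form0[OF d supp_cd(2)]
      by (rule integral_chart_change[OF c d _ csupp supp_cd])
    \<comment> \<open>The total weight is 1, so the factor in \<open>form_transition\<close> is the
      Jacobian factor of the substitution.\<close>
    also have "\<dots> = integral ?O ?fc"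
      using form_transition[OF s g c d] by (intro integral_cong) simp
    also have "\<dots> = integral (chart_image c) ?fc"
      by (rule integral_eq_support[symmetric, OF overlap_subset], rule form0[OF c supp_cd(1)])
        (use supp_cd in \<open>auto simp: overlap_def\<close>)
    finally have forms: "integral (chart_image d) ?fd = integral (chart_image c) ?fc" .
    have "integral ?O (\<lambda>x. K c \<alpha> s x * ?v x) = integral ?O (\<lambda>x. K c \<alpha> s x * coef c g x)"
      using gc overlap_subset[of c d] by (intro integral_cong) (auto simp: \<phi>'_def)
    also have "\<dots> = integral (chart_image c) (\<lambda>x. K c \<alpha> s x * coef c g x)"
    proof (rule integral_eq_support[symmetric, OF overlap_subset])
      fix x assume "x \<in> chart_image c - ?O"
      then have "x \<in> chart_image c - snd c ` base_support g" using supp_cd by (auto simp: overlap_def)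
      then show "K c \<alpha> s x * coef c g x = 0" by (simp add: coef_outside_base_support[OF c])
    qed
    also have "\<dots> = - integral (chart_image c) ?fc"
      using c.integral_canon_mult[OF sc sgc] csc by blast
    also have "\<dots> = - integral (chart_image d) ?fd" by (simp add: forms)
    also have "\<dots> = integral (chart_image d) (\<lambda>y. K d \<alpha> s y * coef d g y)"
      using d.integral_canon_mult[OF sd sgd] csd by simp
    also have "\<dots> = integral ?O (\<lambda>x. \<bar>jdet c d x\<bar> * (K d \<alpha> s (transition c d x) * coef d g (transition c d x)))"
    proof (rule integral_chart_change[OF c d _ csupp supp_cd])
      show "continuous_on (chart_image d) (\<lambda>y. K d \<alpha> s y * coef d g y)"
        by (intro continuous_on_mult smooth_on_continuous d.smooth_canon sd sgd)
    qed (use coef_outside_base_support[OF d] in simp)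
    \<comment> \<open>The Jacobian factor splits into the powers \<alpha> and 1 - \<alpha>; the
      second converts the coefficient of \<open>g\<close> in \<open>d\<close> to the one in
      \<open>c\<close>, the first belongs to \<open>?R\<close>.\<close>
    also have "\<dots> = integral ?O (\<lambda>x. ?R x * ?v x)"
    proof (rule integral_cong)
      fix x assume x: "x \<in> ?O"
      have "?v x = coef d g (transition c d x) * \<bar>jdet c d x\<bar> powr (1 - \<alpha>)"
        using gc[of x] x overlap_subset[of c d] coef_transition[OF g c d x] by (auto simp: \<phi>'_def)
      moreover have "\<bar>jdet c d x\<bar> powr \<alpha> * \<bar>jdet c d x\<bar> powr (1 - \<alpha>) = \<bar>jdet c d x\<bar>"
        using jdet_nonzero_overlap[OF c d x] by (simp add: powr_add[symmetric])
      ultimately show "\<bar>jdet c d x\<bar> * (K d \<alpha> s (transition c d x) * coef d g (transition c d x)) = ?R x * ?v x"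
        by (simp add: mult_ac)
    qed
    finally have eq: "integral ?O (\<lambda>x. K c \<alpha> s x * ?v x) = integral ?O (\<lambda>x. ?R x * ?v x)" .
    have int: "(\<lambda>x. h x * ?v x) integrable_on ?O" if "continuous_on ?O h" for h
    proof (rule integrable_compact_support)
      have "continuous_on ?O \<phi>" using smooth_on_continuous[OF \<phi>(1)] continuous_on_subset by blast
      then show "continuous_on ?O (\<lambda>x. h x * ?v x)" using that by (intro continuous_on_mult)
      show "compact_support ?O (\<lambda>x. h x * ?v x)"
        by (rule compact_support_mult(2)[OF compact_support_mult(1)[OF \<phi>(2)]])
    qed
    show "integral ?O (\<lambda>x. (K c \<alpha> s x - ?R x) * ?v x) = 0"
      using integral_diff[OF int[OF cK] int[OF cR]] eq by (simp add: left_diff_distrib)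
  qed
  then show ?thesis by simp
qed

text \<open>\<open>divergence\<close> uses an unspecified chart around the point;
  \<open>canon_transition\<close> carries the value over to the given chart
  \<open>c\<close>.\<close>

lemma canonical_op_eq:
  assumes h: "\<And>\<alpha>. \<alpha> \<in> F \<Longrightarrow> h \<alpha> \<in> densities A \<alpha>" and q: "q \<in> ext_manifold A" and c: "c \<in> A" "fst q \<in> fst c"
  shows "canonical_op A T (\<lambda>q. \<Sum>\<alpha>\<in>F. h \<alpha> q) q = (\<Sum>\<alpha>\<in>F. K c \<alpha> (h \<alpha>) (snd c (fst q)) * snd q c powr \<alpha>)"
proof -
  define d where "d = (SOME c. c \<in> A \<and> fst q \<in> fst c)"
  have d: "d \<in> A" "fst q \<in> fst d"
    using someI[of "\<lambda>c. c \<in> A \<and> fst q \<in> fst c" c] c unfolding d_def by auto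
  obtain t where t: "t > 0" "q = frame d (fst q) t" using ext_point_cases[OF q d] .
  have td: "snd q d = t" using t(2) frame_coord[OF d, of t] by metis
  have "canonical_op A T (\<lambda>q. \<Sum>\<alpha>\<in>F. h \<alpha> q) q
    = local_divergence (contract_differential A T (\<lambda>q. \<Sum>\<alpha>\<in>F. h \<alpha> q) d) (snd (ext_chart A d) q)"
    using q by (simp add: canonical_op_def divergence_def d_def Let_def)
  also have "snd (ext_chart A d) q = ext_coords (snd d (fst q)) t"
    using snd_ext_chart_frame[OF d, of t] t(2) by simp
  also have "local_divergence (contract_differential A T (\<lambda>q. \<Sum>\<alpha>\<in>F. h \<alpha> q) d) (ext_coords (snd d (fst q)) t)
    = (\<Sum>\<alpha>\<in>F. K d \<alpha> (h \<alpha>) (snd d (fst q)) * t powr \<alpha>)"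
    using d t(1) by (intro is_qp_value[OF is_qp_divergence[OF d(1) is_qp_density[OF h d(1)]]]) auto
  also have "\<dots> = (\<Sum>\<alpha>\<in>F. K c \<alpha> (h \<alpha>) (snd c (fst q)) * snd q c powr \<alpha>)"
  proof (rule sum.cong[OF refl])
    fix \<alpha> assume \<alpha>: "\<alpha> \<in> F"
    have o: "snd c (fst q) \<in> overlap c d" using c d by (auto simp: overlap_def)
    have "snd q d = \<bar>jdet c d (snd c (fst q))\<bar> * snd q c"
      using ext_manifoldD(2)[of "fst q" "snd q" c d] q c d by simp
    moreover have "snd q c > 0" using ext_manifoldD(1)[of "fst q" "snd q" c] q c by simp
    ultimately show "K d \<alpha> (h \<alpha>) (snd d (fst q)) * t powr \<alpha> = K c \<alpha> (h \<alpha>) (snd c (fst q)) * snd q c powr \<alpha>"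
      using canon_transition[OF h[OF \<alpha>] c(1) d(1) o] c by (simp add: td[symmetric] transition_chart powr_mult)
  qed
  finally show ?thesis .
qed

lemma canonical_op_outside: "q \<notin> ext_manifold A \<Longrightarrow> canonical_op A T s q = 0"
  by (simp add: canonical_op_def divergence_def)

lemma canonical_op_density_eq:
  assumes "s \<in> densities A \<alpha>" "q \<in> ext_manifold A" "c \<in> A" "fst q \<in> fst c"
  shows "canonical_op A T s q = K c \<alpha> s (snd c (fst q)) * snd q c powr \<alpha>"
  using canonical_op_eq[of "{\<alpha>}" "\<lambda>_. s" q c] assms by simp

lemma canonical_op_density:
  assumes s: "s \<in> densities A \<alpha>"
  shows "canonical_op A T s \<in> densities A \<alpha>"
proof (rule densitiesI[OF canonical_op_outside])
  show "smooth_on (chart_image c) (K c \<alpha> s)" if "c \<in> A" for c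
    by (rule smooth_coefficients.smooth_canon[OF smooth_coefficients[OF that] smooth_coef[OF s that]])
qed (use canonical_op_density_eq[OF s] in auto)

lemma coef_canonical_op:
  assumes s: "s \<in> densities A \<alpha>" and c: "c \<in> A" and x: "x \<in> chart_image c"
  shows "coef c (canonical_op A T s) x = K c \<alpha> s x"
proof -
  obtain p where p: "p \<in> fst c" "x = snd c p" using x by blast
  show ?thesis
    using canonical_op_density_eq[OF s frame_in_ext_manifold[OF c p(1), of 1] c] frame_coord[OF c p(1), of 1] p c
    by (simp add: coef_chart)
qed

lemma canonical_op_sum:
  assumes "\<And>\<alpha>. \<alpha> \<in> F \<Longrightarrow> h \<alpha> \<in> densities A \<alpha>"
  shows "canonical_op A T (\<lambda>q. \<Sum>\<alpha>\<in>F. h \<alpha> q) = (\<lambda>q. \<Sum>\<alpha>\<in>F. canonical_op A T (h \<alpha>) q)"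
proof
  fix q
  show "canonical_op A T (\<lambda>q. \<Sum>\<alpha>\<in>F. h \<alpha> q) q = (\<Sum>\<alpha>\<in>F. canonical_op A T (h \<alpha>) q)"
  proof (cases "q \<in> ext_manifold A")
    case True
    obtain c where c: "c \<in> A" "fst q \<in> fst c" by (rule chart_cover)
    show ?thesis using canonical_op_eq[OF assms True c] canonical_op_density_eq[OF assms True c] by simp
  qed (simp add: canonical_op_outside)
qed

lemma local_rep_canonical_op:
  assumes h: "\<And>\<alpha>. \<alpha> \<in> F \<Longrightarrow> h \<alpha> \<in> densities A \<alpha>" and c: "c \<in> A" and y: "y \<in> chart_image (ext_chart A c)"
  shows "local_rep (ext_chart A c) (canonical_op A T (\<lambda>q. \<Sum>\<alpha>\<in>F. h \<alpha> q)) y =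
    canonical_local_operator (S c) (B c) (C c) (local_rep (ext_chart A c) (\<lambda>q. \<Sum>\<alpha>\<in>F. h \<alpha> q)) y"
proof -
  interpret c: smooth_coefficients "chart_image c" "S c" "B c" "C c" by (rule smooth_coefficients[OF c])
  obtain x t where y': "y = ext_coords x t" "x \<in> chart_image c" "t > 0"
    using y unfolding ext_chart_image[OF c] by (rule half_space_cases)
  then obtain p where p: "p \<in> fst c" "x = snd c p" by blast
  have "local_rep (ext_chart A c) (canonical_op A T (\<lambda>q. \<Sum>\<alpha>\<in>F. h \<alpha> q)) y = (\<Sum>\<alpha>\<in>F. K c \<alpha> (h \<alpha>) x * t powr \<alpha>)"
    using canonical_op_eq[OF h frame_in_ext_manifold[OF c p(1) y'(3)] c] p y'(3) frame_coord[OF c p(1)] c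
    by (simp add: y'(1) local_rep_frame)
  also have "\<dots> = canonical_local_operator (S c) (B c) (C c) (local_rep (ext_chart A c) (\<lambda>q. \<Sum>\<alpha>\<in>F. h \<alpha> q)) y"
    unfolding y'(1)
    by (rule is_qp_value[symmetric, OF c.is_qp_canonical_local_operator[OF is_qp_density[OF h c]] y'(2,3)])
  finally show ?thesis .
qed

end

section \<open>Decomposition into homogeneous densities\<close>

text \<open>Divide by t^m for the largest exponent m with non-zero coefficient and let t tend to
  infinity: only the coefficient of t^m survives.\<close>

lemma powr_combination_eq_0:
  fixes a :: "real \<Rightarrow> real"
  assumes F: "finite F" and z: "\<And>t. t > 0 \<Longrightarrow> (\<Sum>\<alpha>\<in>F. a \<alpha> * t powr \<alpha>) = 0" and \<beta>: "\<beta> \<in> F"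
  shows "a \<beta> = 0"
proof (rule ccontr)
  assume "a \<beta> \<noteq> 0"
  define G where "G = {\<alpha> \<in> F. a \<alpha> \<noteq> 0}"
  have G: "finite G" "G \<noteq> {}" using F \<beta> \<open>a \<beta> \<noteq> 0\<close> by (auto simp: G_def)
  define m where "m = Max G"
  have m: "m \<in> G" "\<And>\<alpha>. \<alpha> \<in> G \<Longrightarrow> \<alpha> \<le> m" using G by (auto simp: m_def)
  have lim: "((\<lambda>t. \<Sum>\<alpha>\<in>G. a \<alpha> * t powr (\<alpha> - m)) \<longlongrightarrow> (\<Sum>\<alpha>\<in>G. a \<alpha> * (if \<alpha> = m then 1 else 0))) at_top"
  proof (intro tendsto_sum tendsto_mult tendsto_const)
    fix \<alpha> assume \<alpha>: "\<alpha> \<in> G"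
    show "((\<lambda>t. t powr (\<alpha> - m)) \<longlongrightarrow> (if \<alpha> = m then 1 else 0)) at_top"
    proof (cases "\<alpha> = m")
      case True
      have "\<forall>\<^sub>F t::real in at_top. 1 = t powr (\<alpha> - m)"
        using eventually_gt_at_top[of "0::real"] by eventually_elim (simp add: True)
      from Lim_transform_eventually[OF tendsto_const this] show ?thesis using True by simp
    next
      case False
      then have "\<alpha> - m < 0" using m(2)[OF \<alpha>] by simp
      then show ?thesis using False by (simp add: tendsto_neg_powr filterlim_ident)
    qed
  qed
  have am: "(\<Sum>\<alpha>\<in>G. a \<alpha> * (if \<alpha> = m then 1 else 0)) = a m"
    using G m(1) by (simp add: if_distrib[of "(*) _"] cong: if_cong)
  have "\<forall>\<^sub>F t in at_top. (\<Sum>\<alpha>\<in>G. a \<alpha> * t powr (\<alpha> - m)) = 0"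
    using eventually_gt_at_top[of "0::real"]
  proof eventually_elim
    fix t :: real assume t: "0 < t"
    have "(\<Sum>\<alpha>\<in>G. a \<alpha> * t powr (\<alpha> - m)) = (\<Sum>\<alpha>\<in>G. a \<alpha> * t powr \<alpha>) * t powr (- m)"
      by (simp add: sum_distrib_right powr_diff powr_minus divide_inverse mult.assoc)
    also have "(\<Sum>\<alpha>\<in>G. a \<alpha> * t powr \<alpha>) = (\<Sum>\<alpha>\<in>F. a \<alpha> * t powr \<alpha>)"
      using F by (intro sum.mono_neutral_left) (auto simp: G_def)
    finally show "(\<Sum>\<alpha>\<in>G. a \<alpha> * t powr (\<alpha> - m)) = 0" using z[OF t] by simp
  qed
  from Lim_transform_eventually[OF lim this] have "((\<lambda>_::real. 0) \<longlongrightarrow> a m) at_top"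
    unfolding am .
  then have "a m = 0" by (simp add: tendsto_const_iff)
  then show False using m(1) by (simp add: G_def)
qed

context atlas begin

text \<open>Over one base point the coordinate t runs through all positive reals, so the powers of t
  already separate the weights on a single fibre.\<close>

lemma density_sum_eq_0:
  assumes F: "finite F" and h: "\<And>\<alpha>. \<alpha> \<in> F \<Longrightarrow> h \<alpha> \<in> densities A \<alpha>"
    and z: "\<And>\<tau>. (\<Sum>\<alpha>\<in>F. h \<alpha> (p, \<tau>)) = 0" and \<beta>: "\<beta> \<in> F"
  shows "h \<beta> (p, \<tau>) = 0"
proof (cases "(p, \<tau>) \<in> ext_manifold A")
  case True
  obtain c where c: "c \<in> A" "p \<in> fst c" by (rule chart_cover)
  have "(\<Sum>\<alpha>\<in>F. coef c (h \<alpha>) (snd c p) * t powr \<alpha>) = 0" if "t > 0" for t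
    using z[of "snd (frame c p t)"] density_frame[OF h c that] by (simp add: frame_def)
  then have "coef c (h \<beta>) (snd c p) = 0"
    by (rule powr_combination_eq_0[OF F _ \<beta>])
  then show ?thesis using density_eq[OF h[OF \<beta>] c(1) True] c(2) by simp
qed (use density_outside h \<beta> in blast)

text \<open>Two decompositions of the same function differ by a finite sum of homogeneous densities
  that is 0, and \<open>density_sum_eq_0\<close> applies to its terms.\<close>

lemma component_eq:
  assumes F: "finite F" and h: "\<And>\<alpha>. \<alpha> \<in> F \<Longrightarrow> h \<alpha> \<in> densities A \<alpha>"
  shows "component A (\<lambda>q. \<Sum>\<alpha>\<in>F. h \<alpha> q) = (\<lambda>\<alpha>. if \<alpha> \<in> F then h \<alpha> else (\<lambda>_. 0))" (is "component A ?s = ?k")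
proof -
  have dec: "is_decomposition A ?s ?k"
    unfolding is_decomposition_def
  proof (intro conjI allI)
    show "?k \<alpha> \<in> densities A \<alpha>" for \<alpha> using h densities_0 by simp
    have sub: "{\<alpha>. ?k \<alpha> \<noteq> (\<lambda>_. 0)} \<subseteq> F" by auto
    then show "finite {\<alpha>. ?k \<alpha> \<noteq> (\<lambda>_. 0)}" using F finite_subset by blast
    show "?s = (\<lambda>q. \<Sum>\<alpha> | ?k \<alpha> \<noteq> (\<lambda>_. 0). ?k \<alpha> q)"
    proof
      fix q
      have "(\<Sum>\<alpha> | ?k \<alpha> \<noteq> (\<lambda>_. 0). ?k \<alpha> q) = (\<Sum>\<alpha>\<in>F. ?k \<alpha> q)"
        by (rule sum.mono_neutral_left[OF F sub]) (auto dest: fun_cong[of _ _ q])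
      then show "?s q = (\<Sum>\<alpha> | ?k \<alpha> \<noteq> (\<lambda>_. 0). ?k \<alpha> q)" by simp
    qed
  qed
  have "k = ?k" if k: "is_decomposition A ?s k" for k
  proof (intro ext)
    fix \<alpha> and q :: "('a, 'n) ext_point"
    let ?supp = "{\<alpha>. k \<alpha> \<noteq> (\<lambda>_. 0)}"
    \<comment> \<open>Including \<alpha> itself covers the weights at which neither decomposition
      has a component.\<close>
    let ?G = "insert \<alpha> (F \<union> ?supp)"
    have G: "finite ?G" using F k by (simp add: is_decomposition_def)
    have "(\<Sum>\<beta>\<in>?G. ?k \<beta> q' + (-1) * k \<beta> q') = 0" for q'
    proof -
      have "(\<Sum>\<beta>\<in>?G. k \<beta> q') = (\<Sum>\<beta>\<in>?supp. k \<beta> q')"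
        by (rule sum.mono_neutral_right[OF G]) (auto dest: fun_cong[of _ _ q'])
      moreover have "(\<Sum>\<beta>\<in>?G. ?k \<beta> q') = (\<Sum>\<beta>\<in>F. ?k \<beta> q')"
        by (rule sum.mono_neutral_right[OF G]) auto
      moreover have "?s q' = (\<Sum>\<beta>\<in>?supp. k \<beta> q')"
        using k unfolding is_decomposition_def by (metis (no_types, lifting))
      ultimately show ?thesis by (simp add: sum_subtractf)
    qed
    moreover have "(\<lambda>q. ?k \<beta> q + (-1) * k \<beta> q) \<in> densities A \<beta>" for \<beta>
      using k dec unfolding is_decomposition_def by (intro densities_add densities_cmult) auto
    ultimately have "?k \<alpha> (fst q, snd q) + (-1) * k \<alpha> (fst q, snd q) = 0"
      by (intro density_sum_eq_0[OF G, of "\<lambda>\<beta> q. ?k \<beta> q + (-1) * k \<beta> q"]) auto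
    then show "k \<alpha> q = ?k \<alpha> q" by simp
  qed
  with dec show ?thesis unfolding component_def by (intro the_equality)
qed

lemma density_algebraI:
  assumes "finite F" "\<And>\<alpha>. \<alpha> \<in> F \<Longrightarrow> h \<alpha> \<in> densities A \<alpha>"
  shows "(\<lambda>q. \<Sum>\<alpha>\<in>F. h \<alpha> q) \<in> density_algebra A"
proof -
  let ?k = "\<lambda>\<alpha>. if \<alpha> \<in> F then h \<alpha> else (\<lambda>_. 0)"
  have sub: "{\<alpha>. ?k \<alpha> \<noteq> (\<lambda>_. 0)} \<subseteq> F" by auto
  have "(\<Sum>\<alpha>\<in>F. h \<alpha> q) = (\<Sum>\<alpha> | ?k \<alpha> \<noteq> (\<lambda>_. 0). ?k \<alpha> q)" for q
  proof -
    have "(\<Sum>\<alpha> | ?k \<alpha> \<noteq> (\<lambda>_. 0). ?k \<alpha> q) = (\<Sum>\<alpha>\<in>F. ?k \<alpha> q)"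
      by (rule sum.mono_neutral_left[OF assms(1) sub]) (auto dest: fun_cong[of _ _ q])
    then show ?thesis by simp
  qed
  then have "is_decomposition A (\<lambda>q. \<Sum>\<alpha>\<in>F. h \<alpha> q) ?k"
    unfolding is_decomposition_def using assms sub finite_subset[OF sub] densities_0 by auto
  then show ?thesis unfolding density_algebra_def by blast
qed

lemma density_in_algebra: "s \<in> densities A \<alpha> \<Longrightarrow> s \<in> density_algebra A"
  using density_algebraI[of "{\<alpha>}" "\<lambda>_. s"] by simp

lemma density_algebra_cases:
  assumes "s \<in> density_algebra A"
  shows "\<exists>F h. finite F \<and> (\<forall>\<alpha>. h \<alpha> \<in> densities A \<alpha>) \<and> (\<forall>\<alpha>. \<alpha> \<notin> F \<longrightarrow> h \<alpha> = (\<lambda>_. 0)) \<and>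
    s = (\<lambda>q. \<Sum>\<alpha>\<in>F. h \<alpha> q)"
proof -
  from assms obtain h where h: "\<forall>\<alpha>. h \<alpha> \<in> densities A \<alpha>" "finite {\<alpha>. h \<alpha> \<noteq> (\<lambda>_. 0)}"
    "s = (\<lambda>q. \<Sum>\<alpha> | h \<alpha> \<noteq> (\<lambda>_. 0). h \<alpha> q)"
    unfolding density_algebra_def is_decomposition_def by blast
  then show ?thesis by (intro exI[of _ "{\<alpha>. h \<alpha> \<noteq> (\<lambda>_. 0)}"] exI[of _ h]) simp
qed

text \<open>Components of different weights cannot cancel on a whole fibre, so each of them vanishes
  over every point where the sum does.\<close>

lemma base_support_homogeneous:
  assumes "finite F" "\<And>\<alpha>. \<alpha> \<in> F \<Longrightarrow> h \<alpha> \<in> densities A \<alpha>" "\<beta> \<in> F"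
  shows "base_support (h \<beta>) \<subseteq> base_support (\<lambda>q. \<Sum>\<alpha>\<in>F. h \<alpha> q)"
  by (rule base_support_mono) (use density_sum_eq_0[OF assms(1,2) _ assms(3)] in blast)

lemma density_integral_0: "density_integral A (\<lambda>_. 0) = 0"
  using density_integral_sum[of "{}" "\<lambda>_ _. 0"] by simp

text \<open>The definition sums over exactly the non-zero components; other finite index sets only
  add or omit integrals of 0. This makes it unnecessary to know which components of the image under
  an operator happen to vanish.\<close>

lemma scalar_product_eq:
  assumes F: "finite F" "\<And>\<alpha>. \<alpha> \<in> F \<Longrightarrow> h \<alpha> \<in> densities A \<alpha>"
    and G: "finite G" "\<And>\<alpha>. \<alpha> \<in> G \<Longrightarrow> k \<alpha> \<in> densities A \<alpha>"
  shows "scalar_product A (\<lambda>q. \<Sum>\<alpha>\<in>F. h \<alpha> q) (\<lambda>q. \<Sum>\<alpha>\<in>G. k \<alpha> q) =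
    (\<Sum>\<alpha>\<in>F. \<Sum>\<beta>\<in>G. if \<alpha> + \<beta> = 1 then density_integral A (\<lambda>q. h \<alpha> q * k \<beta> q) else 0)"
proof -
  let ?h = "\<lambda>\<alpha>. if \<alpha> \<in> F then h \<alpha> else (\<lambda>_. 0)" and ?k = "\<lambda>\<alpha>. if \<alpha> \<in> G then k \<alpha> else (\<lambda>_. 0)"
  let ?I = "\<lambda>\<alpha> \<beta>. if \<alpha> + \<beta> = 1 then density_integral A (\<lambda>q. ?h \<alpha> q * ?k \<beta> q) else 0"
  have I0: "?I \<alpha> \<beta> = 0" if "?h \<alpha> = (\<lambda>_. 0) \<or> ?k \<beta> = (\<lambda>_. 0)" for \<alpha> \<beta>
  proof -
    have "(\<lambda>q. ?h \<alpha> q * ?k \<beta> q) = (\<lambda>_. 0)"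
    proof
      show "?h \<alpha> q * ?k \<beta> q = 0" for q using that fun_cong[of "?h \<alpha>" _ q] fun_cong[of "?k \<beta>" _ q] by auto
    qed
    then show ?thesis by (simp only: density_integral_0) simp
  qed
  have "(\<Sum>\<alpha> | ?h \<alpha> \<noteq> (\<lambda>_. 0). \<Sum>\<beta> | ?k \<beta> \<noteq> (\<lambda>_. 0). ?I \<alpha> \<beta>)
    = (\<Sum>\<alpha> | ?h \<alpha> \<noteq> (\<lambda>_. 0). \<Sum>\<beta>\<in>G. ?I \<alpha> \<beta>)"
    using G(1) by (intro sum.cong refl sum.mono_neutral_left ballI I0) (auto split: if_splits)
  also have "\<dots> = (\<Sum>\<alpha>\<in>F. \<Sum>\<beta>\<in>G. ?I \<alpha> \<beta>)"
    using F(1) by (intro sum.mono_neutral_left sum.neutral ballI I0) (auto split: if_splits)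
  also have "\<dots> = (\<Sum>\<alpha>\<in>F. \<Sum>\<beta>\<in>G. if \<alpha> + \<beta> = 1 then density_integral A (\<lambda>q. h \<alpha> q * k \<beta> q) else 0)"
    by (intro sum.cong refl) auto
  finally have "(\<Sum>\<alpha> | ?h \<alpha> \<noteq> (\<lambda>_. 0). \<Sum>\<beta> | ?k \<beta> \<noteq> (\<lambda>_. 0). ?I \<alpha> \<beta>) =
    (\<Sum>\<alpha>\<in>F. \<Sum>\<beta>\<in>G. if \<alpha> + \<beta> = 1 then density_integral A (\<lambda>q. h \<alpha> q * k \<beta> q) else 0)" .
  moreover have "component A (\<lambda>q. \<Sum>\<alpha>\<in>F. h \<alpha> q) = ?h" by (rule component_eq[OF F])
  moreover have "component A (\<lambda>q. \<Sum>\<alpha>\<in>G. k \<alpha> q) = ?k" by (rule component_eq[OF G])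
  ultimately show ?thesis
    unfolding scalar_product_def by (simp only:)
qed

lemma scalar_product_homogeneous:
  assumes "s \<in> densities A \<alpha>" "s' \<in> densities A (1 - \<alpha>)"
  shows "scalar_product A s s' = density_integral A (\<lambda>q. s q * s' q)"
  using scalar_product_eq[of "{\<alpha>}" "\<lambda>_. s" "{1 - \<alpha>}" "\<lambda>_. s'"] assms by simp

lemma densities_mult_dual: "s \<in> densities A \<alpha> \<Longrightarrow> s' \<in> densities A (1 - \<alpha>) \<Longrightarrow> (\<lambda>q. s q * s' q) \<in> densities A 1"
  using densities_mult[of s \<alpha> s' "1 - \<alpha>"] by simp

lemma base_support_mult:
  "base_support (\<lambda>q. s q * s' q) \<subseteq> base_support s" "base_support (\<lambda>q. s q * s' q) \<subseteq> base_support s'"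
  for s s' :: "('a, 'n) ext_point \<Rightarrow> real"
  by (rule base_support_mono; auto)+

end


section \<open>Self-adjointness of the canonical operator\<close>

context smooth_coefficients begin

lemma canon_add:
  assumes u: "smooth_on V u" and v: "smooth_on V v" and x: "x \<in> V"
  shows "canon S B C \<alpha> (\<lambda>x. u x + v x) x = canon S B C \<alpha> u x + canon S B C \<alpha> v x"
proof -
  have p: "partial_deriv k (\<lambda>x. u x + v x) x = partial_deriv k u x + partial_deriv k v x" if "x \<in> V" for k x
    using u v V that by (intro partial_deriv_add) (auto intro: smooth_on_differentiable_at)
  have "partial_deriv i (flux S B \<alpha> (\<lambda>x. u x + v x) i) x
    = partial_deriv i (\<lambda>x. flux S B \<alpha> u i x + flux S B \<alpha> v i x) x" for i
    by (rule partial_deriv_cong[OF V x]) (simp add: flux_def p sum.distrib algebra_simps)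
  also have "\<dots> i = partial_deriv i (flux S B \<alpha> u i) x + partial_deriv i (flux S B \<alpha> v i) x" for i
    using u v V x by (intro partial_deriv_add) (auto intro: smooth_on_differentiable_at smooth_flux)
  finally show ?thesis
    using x by (simp add: canon_def flux0_def p sum.distrib algebra_simps)
qed

lemma canon_cmult:
  assumes u: "smooth_on V u" and x: "x \<in> V"
  shows "canon S B C \<alpha> (\<lambda>x. a * u x) x = a * canon S B C \<alpha> u x"
proof -
  have p: "partial_deriv k (\<lambda>x. a * u x) x = a * partial_deriv k u x" if "x \<in> V" for k x
    using u V that by (intro partial_deriv_cmult) (auto intro: smooth_on_differentiable_at)
  have "partial_deriv i (flux S B \<alpha> (\<lambda>x. a * u x) i) x
    = partial_deriv i (\<lambda>x. a * flux S B \<alpha> u i x) x" for i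
    by (rule partial_deriv_cong[OF V x]) (simp add: flux_def p sum_distrib_left algebra_simps)
  also have "\<dots> i = a * partial_deriv i (flux S B \<alpha> u i) x" for i
    using u V x by (intro partial_deriv_cmult) (auto intro: smooth_on_differentiable_at smooth_flux)
  finally show ?thesis
    using x by (simp add: canon_def flux0_def p sum_distrib_left algebra_simps)
qed

lemma canon_eq_0:
  assumes "open W" "x \<in> W" "\<And>y. y \<in> W \<Longrightarrow> u y = 0"
  shows "canon S B C \<alpha> u x = 0"
proof -
  have p: "partial_deriv k u y = 0" if "y \<in> W" for k y
    using partial_deriv_cong[OF assms(1) that, of u "\<lambda>_. 0"] assms(3) by (simp add: partial_deriv_const)
  have "partial_deriv i (flux S B \<alpha> u i) x = partial_deriv i (\<lambda>_. 0) x" for i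
    by (rule partial_deriv_cong[OF assms(1,2)]) (simp add: flux_def p assms(3))
  then show ?thesis using assms(2,3) by (simp add: canon_def flux0_def p partial_deriv_const)
qed

end

context weight_zero_tensor_field begin

lemma canonical_op_add:
  assumes s: "s \<in> densities A \<alpha>" and s': "s' \<in> densities A \<alpha>"
  shows "canonical_op A T (\<lambda>q. s q + s' q) = (\<lambda>q. canonical_op A T s q + canonical_op A T s' q)"
proof
  fix q
  show "canonical_op A T (\<lambda>q. s q + s' q) q = canonical_op A T s q + canonical_op A T s' q"
  proof (cases "q \<in> ext_manifold A")
    case True
    obtain c where c: "c \<in> A" "fst q \<in> fst c" by (rule chart_cover)
    have "coef c (\<lambda>q. s q + s' q) = (\<lambda>x. coef c s x + coef c s' x)" by (simp add: coef_add fun_eq_iff)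
    then show ?thesis
      using smooth_coefficients.canon_add[OF smooth_coefficients[OF c(1)] smooth_coef[OF s c(1)] smooth_coef[OF s' c(1)]] c
      by (simp add: canonical_op_density_eq[OF densities_add[OF s s'] True c]
          canonical_op_density_eq[OF s True c] canonical_op_density_eq[OF s' True c] distrib_right)
  qed (simp add: canonical_op_outside)
qed

lemma canonical_op_cmult:
  assumes s: "s \<in> densities A \<alpha>"
  shows "canonical_op A T (\<lambda>q. a * s q) = (\<lambda>q. a * canonical_op A T s q)"
proof
  fix q
  show "canonical_op A T (\<lambda>q. a * s q) q = a * canonical_op A T s q"
  proof (cases "q \<in> ext_manifold A")
    case True
    obtain c where c: "c \<in> A" "fst q \<in> fst c" by (rule chart_cover)
    have "coef c (\<lambda>q. a * s q) = (\<lambda>x. a * coef c s x)" by (simp add: coef_cmult fun_eq_iff)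
    then show ?thesis
      using smooth_coefficients.canon_cmult[OF smooth_coefficients[OF c(1)] smooth_coef[OF s c(1)]] c
      by (simp add: canonical_op_density_eq[OF densities_cmult[OF s] True c] canonical_op_density_eq[OF s True c])
  qed (simp add: canonical_op_outside)
qed

lemma canonical_op_0: "canonical_op A T (\<lambda>_. 0) = (\<lambda>_. 0)"
  using canonical_op_cmult[OF densities_0, where a = 0] by simp

lemma canonical_op_sum_homogeneous:
  assumes "finite J" "\<And>j. j \<in> J \<Longrightarrow> \<sigma> j \<in> densities A \<alpha>"
  shows "canonical_op A T (\<lambda>q. \<Sum>j\<in>J. \<sigma> j q) = (\<lambda>q. \<Sum>j\<in>J. canonical_op A T (\<sigma> j) q)"
  using assms
proof (induction J rule: finite_induct)
  case (insert j J)
  then have "canonical_op A T (\<lambda>q. \<sigma> j q + (\<Sum>j\<in>J. \<sigma> j q))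
    = (\<lambda>q. canonical_op A T (\<sigma> j) q + canonical_op A T (\<lambda>q. \<Sum>j\<in>J. \<sigma> j q) q)"
    by (intro canonical_op_add densities_sum) auto
  then show ?case using insert by simp
qed (simp add: canonical_op_0)

text \<open>The open complement of the support is a neighbourhood on which the coefficient, and with
  it all its derivatives, is 0.\<close>

lemma base_support_canonical_op:
  assumes s: "s \<in> densities A \<alpha>"
  shows "base_support (canonical_op A T s) \<subseteq> base_support s"
proof (rule base_support_subset_closed[OF closed_base_support])
  fix p \<tau> assume p: "p \<notin> base_support s"
  show "canonical_op A T s (p, \<tau>) = 0"
  proof (cases "(p, \<tau>) \<in> ext_manifold A")
    case True
    obtain c where c: "c \<in> A" "p \<in> fst c" by (rule chart_cover)
    let ?W = "{x \<in> chart_image c. chart_inv c x \<in> - base_support s}"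
    have "K c \<alpha> s (snd c p) = 0"
    proof (rule smooth_coefficients.canon_eq_0[OF smooth_coefficients[OF c(1)]])
      show "open ?W" by (rule open_preimage_chart_inv[OF c(1)]) (simp add: open_Compl closed_base_support)
      show "snd c p \<in> ?W" using c p chart_inv_chart by auto
      fix y assume "y \<in> ?W"
      then obtain p' where "p' \<in> fst c" "y = snd c p'" "p' \<notin> base_support s" by (auto simp: chart_inv_chart[OF c(1)])
      then show "coef c s y = 0" using not_in_base_support[of p' s] c(1) by (simp add: coef_chart frame_def)
    qed
    then show ?thesis using canonical_op_density_eq[OF s True c(1)] c(2) by simp
  qed (simp add: canonical_op_outside)
qed

text \<open>Both integrands are supported where \<sigma> is, so both integrals can be computed in
  \<open>c\<close>, where \<open>integral_canon_self_adjoint\<close> applies with \<open>s\<close>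
  of arbitrary support.\<close>

lemma canonical_op_self_adjoint_chart:
  assumes \<sigma>: "\<sigma> \<in> densities A \<alpha>" and s: "s \<in> densities A (1 - \<alpha>)" and c: "c \<in> A"
    and supp: "compact (base_support \<sigma>)" "base_support \<sigma> \<subseteq> fst c"
  shows "density_integral A (\<lambda>q. canonical_op A T \<sigma> q * s q) = density_integral A (\<lambda>q. \<sigma> q * canonical_op A T s q)"
proof -
  interpret c: smooth_coefficients "chart_image c" "S c" "B c" "C c" by (rule smooth_coefficients[OF c])
  have 1: "base_support (\<lambda>q. canonical_op A T \<sigma> q * s q) \<subseteq> base_support \<sigma>"
    using base_support_mult(1) base_support_canonical_op[OF \<sigma>] by blast
  have 2: "base_support (\<lambda>q. \<sigma> q * canonical_op A T s q) \<subseteq> base_support \<sigma>"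
    by (rule base_support_mult(1))
  have "density_integral A (\<lambda>q. canonical_op A T \<sigma> q * s q)
    = integral (chart_image c) (coef c (\<lambda>q. canonical_op A T \<sigma> q * s q))"
    using 1 supp compact_base_support_subset[OF 1]
    by (intro density_integral_single_chart[OF c] densities_mult_dual[OF canonical_op_density s] \<sigma>) auto
  also have "\<dots> = integral (chart_image c) (\<lambda>x. K c \<alpha> \<sigma> x * coef c s x)"
    by (intro integral_cong) (simp add: coef_mult coef_canonical_op[OF \<sigma> c])
  also have "\<dots> = integral (chart_image c) (\<lambda>x. coef c \<sigma> x * K c (1 - \<alpha>) s x)"
    using compact_support_coef[OF c supp] S_sym[OF c]
    by (intro c.integral_canon_self_adjoint smooth_coef[OF \<sigma> c] smooth_coef[OF s c]) auto
  also have "\<dots> = integral (chart_image c) (coef c (\<lambda>q. \<sigma> q * canonical_op A T s q))"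
    by (intro integral_cong) (simp add: coef_mult coef_canonical_op[OF s c])
  also have "\<dots> = density_integral A (\<lambda>q. \<sigma> q * canonical_op A T s q)"
    using 2 supp compact_base_support_subset[OF 2]
    by (intro density_integral_single_chart[OF c, symmetric] densities_mult_dual[OF \<sigma> canonical_op_density] s) auto
  finally show ?thesis .
qed

text \<open>The partition of unity is multiplied into the first argument before the operator is
  applied, so no derivative ever has to be taken of its functions; linearity does the rest.\<close>

lemma canonical_op_self_adjoint_homogeneous:
  assumes s: "s \<in> densities A \<alpha>" and s': "s' \<in> densities A (1 - \<alpha>)" and supp: "compact (base_support s)"
  shows "density_integral A (\<lambda>q. canonical_op A T s q * s' q) = density_integral A (\<lambda>q. s q * canonical_op A T s' q)"
proof -
  obtain I \<theta> where I: "partition_on (base_support s) I \<theta>"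
    using partition_of_unity[OF supp order_refl] chart_cover by (metis UN_I subsetI)
  define \<sigma> where "\<sigma> = (\<lambda>c q. \<theta> c (fst q) * s q)"
  have fin: "finite I" using I by (simp add: partition_on_def)
  have \<sigma>: "\<sigma> c \<in> densities A \<alpha>" "compact (base_support (\<sigma> c))" "base_support (\<sigma> c) \<subseteq> fst c" "c \<in> A" if "c \<in> I" for c
    using I that base_support_subordinate_mult[of c "\<theta> c" s]
    unfolding \<sigma>_def partition_on_def by (auto intro!: densities_smooth_function_mult s simp: subordinate_def)
  have sum: "s = (\<lambda>q. \<Sum>c\<in>I. \<sigma> c q)"
  proof
    fix q
    have "(\<Sum>c\<in>I. \<sigma> c q) = (\<Sum>c\<in>I. \<theta> c (fst q)) * s q" by (simp add: \<sigma>_def sum_distrib_right)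
    moreover have "s q = 0" if "fst q \<notin> base_support s" using not_in_base_support[OF that, of "snd q"] by simp
    ultimately show "s q = (\<Sum>c\<in>I. \<sigma> c q)" using I by (cases "fst q \<in> base_support s") (auto simp: partition_on_def)
  qed
  have 1: "compact (base_support (\<lambda>q. canonical_op A T (\<sigma> c) q * s' q))" if "c \<in> I" for c
    using compact_base_support_subset[OF order_trans[OF base_support_mult(1) base_support_canonical_op[OF \<sigma>(1)[OF that]]] \<sigma>(2)[OF that]] .
  have 2: "compact (base_support (\<lambda>q. \<sigma> c q * canonical_op A T s' q))" if "c \<in> I" for c
    using compact_base_support_subset[OF base_support_mult(1) \<sigma>(2)[OF that]] .
  have "canonical_op A T s = (\<lambda>q. \<Sum>c\<in>I. canonical_op A T (\<sigma> c) q)"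
    by (subst sum) (rule canonical_op_sum_homogeneous[OF fin \<sigma>(1)])
  then have "(\<lambda>q. canonical_op A T s q * s' q) = (\<lambda>q. \<Sum>c\<in>I. canonical_op A T (\<sigma> c) q * s' q)"
    by (simp add: sum_distrib_right)
  then have "density_integral A (\<lambda>q. canonical_op A T s q * s' q)
    = (\<Sum>c\<in>I. density_integral A (\<lambda>q. canonical_op A T (\<sigma> c) q * s' q))"
    using density_integral_sum[OF fin densities_mult_dual[OF canonical_op_density[OF \<sigma>(1)] s'] 1] by simp
  also have "\<dots> = (\<Sum>c\<in>I. density_integral A (\<lambda>q. \<sigma> c q * canonical_op A T s' q))"
    using \<sigma> by (intro sum.cong refl canonical_op_self_adjoint_chart[OF _ s'])
  also have "\<dots> = density_integral A (\<lambda>q. \<Sum>c\<in>I. \<sigma> c q * canonical_op A T s' q)"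
    using density_integral_sum[OF fin densities_mult_dual[OF \<sigma>(1) canonical_op_density[OF s']] 2] by simp
  also have "(\<lambda>q. \<Sum>c\<in>I. \<sigma> c q * canonical_op A T s' q) = (\<lambda>q. s q * canonical_op A T s' q)"
    by (simp add: sum_distrib_right[symmetric] fun_cong[OF sum, symmetric])
  finally show ?thesis .
qed

lemma linear_canonical_op: "linear_op A (canonical_op A T)"
  unfolding linear_op_def
proof (intro conjI ballI allI)
  fix s assume s_in: "s \<in> density_algebra A"
  obtain F h where s: "finite F" "\<And>\<alpha>. h \<alpha> \<in> densities A \<alpha>"
    "\<And>\<alpha>. \<alpha> \<notin> F \<Longrightarrow> h \<alpha> = (\<lambda>_. 0)" "s = (\<lambda>q. \<Sum>\<alpha>\<in>F. h \<alpha> q)"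
    using density_algebra_cases[OF s_in] by blast
  show "canonical_op A T s \<in> density_algebra A"
    unfolding s(4) canonical_op_sum[OF s(2)] by (rule density_algebraI[OF s(1) canonical_op_density[OF s(2)]])
  show "canonical_op A T (\<lambda>q. a * s q) = (\<lambda>q. a * canonical_op A T s q)" for a
  proof -
    have "(\<lambda>q. a * s q) = (\<lambda>q. \<Sum>\<alpha>\<in>F. a * h \<alpha> q)" by (simp add: s(4) sum_distrib_left)
    then show ?thesis
      using canonical_op_sum[of F "\<lambda>\<alpha> q. a * h \<alpha> q"] canonical_op_sum[OF s(2), of F]
      by (simp add: densities_cmult s(2) canonical_op_cmult[OF s(2)] s(4) sum_distrib_left)
  qed
  fix s' assume s'_in: "s' \<in> density_algebra A"
  obtain F' h' where s': "finite F'" "\<And>\<alpha>. h' \<alpha> \<in> densities A \<alpha>"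
    "\<And>\<alpha>. \<alpha> \<notin> F' \<Longrightarrow> h' \<alpha> = (\<lambda>_. 0)" "s' = (\<lambda>q. \<Sum>\<alpha>\<in>F'. h' \<alpha> q)"
    using density_algebra_cases[OF s'_in] by blast
  \<comment> \<open>Both decompositions have zero components outside their index sets, so they can
    run over a common one.\<close>
  let ?G = "F \<union> F'"
  have e: "s = (\<lambda>q. \<Sum>\<alpha>\<in>?G. h \<alpha> q)" "s' = (\<lambda>q. \<Sum>\<alpha>\<in>?G. h' \<alpha> q)"
    unfolding s(4) s'(4) using s(1,3) s'(1,3) by (auto intro!: sum.mono_neutral_left)
  have "(\<lambda>q. s q + s' q) = (\<lambda>q. \<Sum>\<alpha>\<in>?G. h \<alpha> q + h' \<alpha> q)"
    unfolding e by (simp add: sum.distrib)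
  then have "canonical_op A T (\<lambda>q. s q + s' q) = (\<lambda>q. \<Sum>\<alpha>\<in>?G. canonical_op A T (\<lambda>q. h \<alpha> q + h' \<alpha> q) q)"
    using canonical_op_sum[of ?G "\<lambda>\<alpha> q. h \<alpha> q + h' \<alpha> q"] by (simp add: densities_add s(2) s'(2))
  also have "\<dots> = (\<lambda>q. (\<Sum>\<alpha>\<in>?G. canonical_op A T (h \<alpha>) q) + (\<Sum>\<alpha>\<in>?G. canonical_op A T (h' \<alpha>) q))"
    by (simp add: canonical_op_add[OF s(2) s'(2)] sum.distrib)
  also have "\<dots> = (\<lambda>q. canonical_op A T s q + canonical_op A T s' q)"
    unfolding e canonical_op_sum[OF s(2)] canonical_op_sum[OF s'(2)] ..
  finally show "canonical_op A T (\<lambda>q. s q + s' q) = (\<lambda>q. canonical_op A T s q + canonical_op A T s' q)" .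
qed

lemma self_adjoint_canonical_op: "self_adjoint A (canonical_op A T)"
  unfolding self_adjoint_def is_adjoint_def
proof (intro conjI linear_canonical_op ballI impI)
  fix s s' assume s_in: "s \<in> density_algebra A" and s'_in: "s' \<in> density_algebra A"
    and supp: "compact (base_support s)"
  obtain F h where s: "finite F" "\<And>\<alpha>. h \<alpha> \<in> densities A \<alpha>" "s = (\<lambda>q. \<Sum>\<alpha>\<in>F. h \<alpha> q)"
    using density_algebra_cases[OF s_in] by blast
  obtain F' h' where s': "finite F'" "\<And>\<alpha>. h' \<alpha> \<in> densities A \<alpha>" "s' = (\<lambda>q. \<Sum>\<alpha>\<in>F'. h' \<alpha> q)"
    using density_algebra_cases[OF s'_in] by blast
  have cs: "compact (base_support (h \<alpha>))" if "\<alpha> \<in> F" for \<alpha>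
    using compact_base_support_subset[OF base_support_homogeneous[OF s(1,2) that]] supp s(3) by simp
  show "scalar_product A (canonical_op A T s) s' = scalar_product A s (canonical_op A T s')"
    unfolding s(3) s'(3) canonical_op_sum[OF s(2)] canonical_op_sum[OF s'(2)]
      scalar_product_eq[OF s(1) canonical_op_density[OF s(2)] s'(1,2)]
      scalar_product_eq[OF s(1,2) s'(1) canonical_op_density[OF s'(2)]]
  proof (intro sum.cong refl if_cong)
    fix \<alpha> \<beta> :: real assume "\<alpha> \<in> F" "\<alpha> + \<beta> = 1"
    moreover from this have "\<beta> = 1 - \<alpha>" by simp
    ultimately show "density_integral A (\<lambda>q. canonical_op A T (h \<alpha>) q * h' \<beta> q)
      = density_integral A (\<lambda>q. h \<alpha> q * canonical_op A T (h' \<beta>) q)"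
      using s'(2)[of \<beta>] by (intro canonical_op_self_adjoint_homogeneous[OF s(2) _ cs]) simp_all
  qed
qed

text \<open>The coefficient is constantly 1 and the weight is 0, so both \<open>flux\<close> and
  \<open>flux0\<close> vanish.\<close>

lemma canonical_op_unit: "canonical_op A T (unit_density A) = (\<lambda>_. 0)"
proof
  fix q
  show "canonical_op A T (unit_density A) q = 0"
  proof (cases "q \<in> ext_manifold A")
    case True
    obtain c where c: "c \<in> A" "fst q \<in> fst c" by (rule chart_cover)
    have u: "coef c (unit_density A) x = 1" if "x \<in> chart_image c" for x
      using coef_unit_density c(1) that by blast
    have p: "partial_deriv k (coef c (unit_density A)) x = 0" if "x \<in> chart_image c" for k x
      using partial_deriv_cong[OF open_chart(2)[OF c(1)] that, of _ "\<lambda>_. 1"] u by (simp add: partial_deriv_const)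
    have "partial_deriv i (flux (S c) (B c) 0 (coef c (unit_density A)) i) x = 0" if "x \<in> chart_image c" for i x
      using partial_deriv_cong[OF open_chart(2)[OF c(1)] that, of _ "\<lambda>_. 0"] by (simp add: flux_def p partial_deriv_const)
    then have "K c 0 (unit_density A) (snd c (fst q)) = 0"
      using c by (simp add: canon_def flux0_def p)
    then show ?thesis using canonical_op_density_eq[OF unit_density True c] by simp
  qed (simp add: canonical_op_outside)
qed

end

section \<open>Uniqueness\<close>

context smooth_coefficients begin

text \<open>The first order part is a derivation and drops out of the Leibniz defect. The second
  order part leaves twice the polarised symbol, with (\<alpha> + \<beta>)^2 - \<alpha>^2 - \<beta>^2
  = 2 \<alpha> \<beta> for the term in w^2. A zeroth order term would remain in the defect, hence
  the 0 in its place.\<close>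

lemma lop_mult:
  assumes u: "smooth_on V u" and v: "smooth_on V v" and x: "x \<in> V" and sym: "transpose (S x) = S x"
  shows "lop S B C D E (\<lambda>_. 0) (\<alpha> + \<beta>) (\<lambda>x. u x * v x) x =
    u x * lop S B C D E (\<lambda>_. 0) \<beta> v x + lop S B C D E (\<lambda>_. 0) \<alpha> u x * v x + 2 * form S B C \<alpha> u \<beta> v x"
proof -
  have du: "u differentiable at y" "partial_deriv k u differentiable at y"
    and dv: "v differentiable at y" "partial_deriv k v differentiable at y" if "y \<in> V" for y k
    using u v V that smooth_on_partial_deriv by (blast intro: smooth_on_differentiable_at)+
  have p: "partial_deriv k (\<lambda>x. u x * v x) y = u y * partial_deriv k v y + partial_deriv k u y * v y" if "y \<in> V" for k y
    using that by (simp add: partial_deriv_mult du dv)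
  have pp: "partial_deriv i (partial_deriv k (\<lambda>x. u x * v x)) x =
    u x * partial_deriv i (partial_deriv k v) x + partial_deriv i u x * partial_deriv k v x
    + (partial_deriv k u x * partial_deriv i v x + partial_deriv i (partial_deriv k u) x * v x)" for i k
  proof -
    have "partial_deriv i (partial_deriv k (\<lambda>x. u x * v x)) x
      = partial_deriv i (\<lambda>y. u y * partial_deriv k v y + partial_deriv k u y * v y) x"
      by (rule partial_deriv_cong[OF V x]) (rule p)
    then show ?thesis using x by (simp add: partial_deriv_add partial_deriv_mult du dv)
  qed
  have s: "S x $ i $ k = S x $ k $ i" for i k
    using arg_cong[OF sym, of "\<lambda>M. M $ k $ i"] by (simp add: transpose_def)
  have "(\<Sum>i\<in>UNIV. \<Sum>k\<in>UNIV. S x $ i $ k * (partial_deriv i u x * partial_deriv k v x))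
    = (\<Sum>i\<in>UNIV. \<Sum>k\<in>UNIV. S x $ i $ k * (partial_deriv k u x * partial_deriv i v x))"
    by (subst sum.swap) (intro sum.cong refl, simp add: s)
  then have SS: "(\<Sum>i\<in>UNIV. \<Sum>k\<in>UNIV. S x $ i $ k * partial_deriv i (partial_deriv k (\<lambda>x. u x * v x)) x)
    = u x * (\<Sum>i\<in>UNIV. \<Sum>k\<in>UNIV. S x $ i $ k * partial_deriv i (partial_deriv k v) x)
    + (\<Sum>i\<in>UNIV. \<Sum>k\<in>UNIV. S x $ i $ k * partial_deriv i (partial_deriv k u) x) * v x
    + 2 * (\<Sum>i\<in>UNIV. \<Sum>k\<in>UNIV. S x $ i $ k * (partial_deriv k u x * partial_deriv i v x))"
    by (simp add: pp distrib_left sum.distrib sum_distrib_left sum_distrib_right mult_ac)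
  have DD: "(\<Sum>i\<in>UNIV. a i * partial_deriv i (\<lambda>x. u x * v x) x)
    = u x * (\<Sum>i\<in>UNIV. a i * partial_deriv i v x) + (\<Sum>i\<in>UNIV. a i * partial_deriv i u x) * v x" for a
    using x by (simp add: p distrib_left sum.distrib sum_distrib_left sum_distrib_right mult_ac)
  have BB: "(\<Sum>i\<in>UNIV. B x $ i * (\<gamma> * partial_deriv i w x)) = \<gamma> * (\<Sum>i\<in>UNIV. B x $ i * partial_deriv i w x)" for \<gamma> w
    by (simp add: sum_distrib_left mult_ac)
  have F: "form S B C \<alpha> u \<beta> v x = (\<Sum>i\<in>UNIV. \<Sum>k\<in>UNIV. S x $ i $ k * (partial_deriv k u x * partial_deriv i v x))
    + \<alpha> * (u x * (\<Sum>i\<in>UNIV. B x $ i * partial_deriv i v x)) + \<beta> * (v x * (\<Sum>i\<in>UNIV. B x $ i * partial_deriv i u x))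
    + \<alpha> * \<beta> * C x * u x * v x"
    by (simp add: form_def flux_def flux0_def sum.distrib sum_distrib_left sum_distrib_right algebra_simps)
  show ?thesis
    unfolding lop_def SS BB DD F by (simp add: algebra_simps)
qed

text \<open>Formal self-adjointness of a first order operator \<open>D\<^sup>i \<partial>\<^sub>i + E w\<close>, tested on \<open>u = v = \<phi>\<close> in the weight
  \<open>1\<close> and on \<open>u = x\<^sup>j \<phi>\<close>, \<open>v = \<phi>\<close>.\<close>

lemma first_order_self_adjoint_eq_0:
  assumes D: "\<And>i. smooth_on V (D i)" and E: "smooth_on V E"
    and sa: "\<And>\<alpha> u v. smooth_on V u \<Longrightarrow> smooth_on V v \<Longrightarrow> compact_support V u \<Longrightarrow> compact_support V v \<Longrightarrow>
      integral V (\<lambda>x. ((\<Sum>i\<in>UNIV. D i x * partial_deriv i u x) + \<alpha> * (E x * u x)) * v x) =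
      integral V (\<lambda>x. u x * ((\<Sum>i\<in>UNIV. D i x * partial_deriv i v x) + (1 - \<alpha>) * (E x * v x)))"
    and x: "x \<in> V"
  shows "E x = 0" "D j x = 0"
proof -
  let ?D = "\<lambda>u x. \<Sum>i\<in>UNIV. D i x * partial_deriv i u x"
  have int: "(\<lambda>x. f x * v x) integrable_on V" if "smooth_on V f" "smooth_on V v" "compact_support V v" for f v
    by (intro integrable_compact_support compact_support_mult(2) that smooth_on_continuous smooth_on_mult V)
  have sD: "smooth_on V (?D u)" if "smooth_on V u" for u
    using that by (intro smooth_intros D)
  have E0: "E x = 0" if x: "x \<in> V" for x
  proof (rule fundamental_lemma[OF V smooth_on_continuous[OF E] _ x])
    fix \<phi> :: "real^'n \<Rightarrow> real" assume "smooth_on UNIV \<phi>" and cs: "compact_support V \<phi>"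
    then have \<phi>: "smooth_on V \<phi>" using smooth_on_subset by blast
    have 1: "(\<lambda>x. ?D \<phi> x * \<phi> x) integrable_on V" "(\<lambda>x. (E x * \<phi> x) * \<phi> x) integrable_on V"
      by (intro int sD \<phi> cs smooth_on_mult V E)+
    \<comment> \<open>In weight 1 the dual weight is 0, so \<open>E\<close> enters on the left only,
      while the D-terms coincide for equal arguments.\<close>
    have "integral V (\<lambda>x. (?D \<phi> x + 1 * (E x * \<phi> x)) * \<phi> x) = integral V (\<lambda>x. \<phi> x * (?D \<phi> x + (1 - 1) * (E x * \<phi> x)))"
      by (rule sa[OF \<phi> \<phi> cs cs])
    then have "integral V (\<lambda>x. ?D \<phi> x * \<phi> x + (E x * \<phi> x) * \<phi> x) = integral V (\<lambda>x. ?D \<phi> x * \<phi> x)"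
      by (simp add: distrib_left distrib_right mult.commute)
    then show "integral V (\<lambda>x. E x * (\<phi> x * \<phi> x)) = 0"
      using integral_add[OF 1] by (simp add: mult.assoc)
  qed
  show "E x = 0" by (rule E0[OF x])
  show "D j x = 0"
  proof (rule fundamental_lemma[OF V smooth_on_continuous[OF D] _ x])
    fix \<phi> :: "real^'n \<Rightarrow> real" assume "smooth_on UNIV \<phi>" and cs: "compact_support V \<phi>"
    then have \<phi>: "smooth_on V \<phi>" using smooth_on_subset by blast
    let ?u = "\<lambda>x. x $ j * \<phi> x"
    have u: "smooth_on V ?u" by (intro smooth_on_mult V smooth_on_nth \<phi>)
    have csu: "compact_support V ?u" by (rule compact_support_mult(2)[OF cs])
    \<comment> \<open>Weight 0 removes \<open>E\<close> on the left; on the right \<open>E\<close>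
      has just been shown to vanish.\<close>
    have "integral V (\<lambda>x. ?D ?u x * \<phi> x) = integral V (\<lambda>x. ((?D ?u x) + 0 * (E x * ?u x)) * \<phi> x)" by simp
    also have "\<dots> = integral V (\<lambda>x. ?u x * (?D \<phi> x + (1 - 0) * (E x * \<phi> x)))"
      by (rule sa[OF u \<phi> csu cs])
    also have "\<dots> = integral V (\<lambda>x. ?D \<phi> x * ?u x)"
      by (intro integral_cong) (simp add: E0 mult.commute)
    finally have eq: "integral V (\<lambda>x. ?D ?u x * \<phi> x) = integral V (\<lambda>x. ?D \<phi> x * ?u x)" .
    \<comment> \<open>The operator is now a derivation, and applying it to the coordinate x^j
      isolates its jth coefficient.\<close>
    have "?D ?u x * \<phi> x - ?D \<phi> x * ?u x = D j x * (\<phi> x * \<phi> x)" if x: "x \<in> V" for x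
    proof -
      have "partial_deriv i ?u x = x $ j * partial_deriv i \<phi> x + (if i = j then 1 else 0) * \<phi> x" for i
        using smooth_on_differentiable_at[OF smooth_on_nth V x, of j] smooth_on_differentiable_at[OF \<phi> V x]
        by (simp add: partial_deriv_mult partial_deriv_nth)
      then have "?D ?u x = (\<Sum>i\<in>UNIV. x $ j * (D i x * partial_deriv i \<phi> x) + (if i = j then D i x * \<phi> x else 0))"
        by (intro sum.cong refl) (simp add: algebra_simps)
      also have "\<dots> = x $ j * ?D \<phi> x + D j x * \<phi> x"
        by (simp add: sum.distrib sum_distrib_left)
      finally show ?thesis by (simp add: algebra_simps)
    qed
    then have "integral V (\<lambda>x. D j x * (\<phi> x * \<phi> x)) = integral V (\<lambda>x. ?D ?u x * \<phi> x - ?D \<phi> x * ?u x)"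
      by (intro integral_cong) simp
    also have "\<dots> = 0"
      using integral_diff[OF int[OF sD[OF u] \<phi> cs] int[OF sD[OF \<phi>] u csu]] eq by simp
    finally show "integral V (\<lambda>x. D j x * (\<phi> x * \<phi> x)) = 0" .
  qed
qed

end

section \<open>Recovering the tensor property from the invariance of \<open>form\<close>\<close>

context atlas begin

text \<open>Differentials of densities span the covectors at every point: dx^i comes from a
  coordinate function minus a constant, in weight 0, and dt from t itself, in weight 1. A bump
  function makes both globally defined.\<close>

lemma grad_axis:
  assumes d: "d \<in> A" and y: "y \<in> half_space (chart_image d)"
  obtains \<alpha> f where "f \<in> densities A \<alpha>" "grad d f y = axis j 1"
proof -
  obtain x t where xt: "y = ext_coords x t" "x \<in> chart_image d" "t > 0" using y by (rule half_space_cases)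
  obtain \<phi> r where \<phi>: "r > 0" "smooth_on UNIV \<phi>" "\<And>z. z \<in> cball x r \<Longrightarrow> \<phi> z = 1"
    "cball x (2 * r) \<subseteq> chart_image d" "\<And>z. z \<notin> cball x (2 * r) \<Longrightarrow> \<phi> z = 0"
    using bump_function[OF open_chart(2)[OF d] xt(2)] by metis
  have cs: "compact_support (chart_image d) \<phi>"
    unfolding compact_support_def using \<phi>(4,5) by (intro exI[of _ "cball x (2 * r)"]) auto
  have s\<phi>: "smooth_on (chart_image d) \<phi>" using \<phi>(2) smooth_on_subset by blast
  define \<alpha> :: real where "\<alpha> = (case j of None \<Rightarrow> 1 | Some i \<Rightarrow> 0)"
  define v where "v z = (case j of None \<Rightarrow> 1 | Some i \<Rightarrow> z $ i - x $ i)" for z :: "real^'n"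
  have sv: "smooth_on (chart_image d) v"
    unfolding v_def[abs_def] using open_chart(2)[OF d] by (cases j) (auto intro!: smooth_on_intros)
  let ?f = "lift_density d \<alpha> (\<lambda>z. v z * \<phi> z)"
  have f: "?f \<in> densities A \<alpha>"
    by (intro lift_density d smooth_on_mult open_chart sv s\<phi> compact_support_mult(2) cs)
  have ball: "ball x r \<subseteq> chart_image d" using \<phi>(1,4) by force
  have cf: "coef d ?f z = v z" if "z \<in> ball x r" for z
    using that ball \<phi>(3)[of z] by (subst coef_lift_density[OF d]) auto
  have pv: "partial_deriv i (coef d ?f) x = partial_deriv i v x" for i
    by (rule partial_deriv_cong[OF open_ball _ cf]) (use \<phi>(1) in auto)
  have pv': "partial_deriv i v x = (if j = Some i then 1 else 0)" for i
  proof (cases j)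
    case None
    then show ?thesis by (simp add: v_def[abs_def] partial_deriv_const)
  next
    case (Some k)
    have "partial_deriv i (\<lambda>z. z $ k + - (x $ k)) x = (if i = k then 1 else 0)"
      using smooth_on_differentiable_at[OF smooth_on_nth open_UNIV, of x k]
      by (subst partial_deriv_add) (auto simp: partial_deriv_nth partial_deriv_const)
    then show ?thesis using Some by (auto simp: v_def[abs_def])
  qed
  note g = grad_density[OF f d xt(2,3)]
  have "grad d ?f y $ l = axis j 1 $ l" for l
  proof (cases l)
    case (Some i)
    show ?thesis
    proof (cases j)
      case None
      then show ?thesis using Some g(1)[of i] pv[of i] pv'[of i] xt(1) by (simp add: axis_def)
    next
      case (Some k)
      then show ?thesis using \<open>l = Some i\<close> g(1)[of i] pv[of i] pv'[of i] xt by (simp add: axis_def \<alpha>_def)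
    qed
  next
    case None
    have "t * grad d ?f y $ None = \<alpha> * v x * t powr \<alpha>" using g(2) cf[of x] \<phi>(1) xt(1) by simp
    then show ?thesis using None xt(3) by (cases j) (auto simp: \<alpha>_def v_def axis_def)
  qed
  then have "grad d ?f y = axis j 1" by (simp add: vec_eq_iff)
  with f show ?thesis by (rule that)
qed

end

context weight_zero_coefficients begin

text \<open>Converse of \<open>form_transition\<close>: the entries of a matrix are its values on
  pairs of basis covectors, and by \<open>grad_axis\<close> these are gradients of
  densities.\<close>

lemma contravariant_if_form_transition:
  assumes ft: "\<And>\<alpha> \<beta> f g c d x. f \<in> densities A \<alpha> \<Longrightarrow> g \<in> densities A \<beta> \<Longrightarrow> c \<in> A \<Longrightarrow> d \<in> A \<Longrightarrow> x \<in> overlap c d \<Longrightarrow>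
    form (S c) (B c) (C c) \<alpha> (coef c f) \<beta> (coef c g) x =
    \<bar>jdet c d x\<bar> powr (\<alpha> + \<beta>) * form (S d) (B d) (C d) \<alpha> (coef d f) \<beta> (coef d g) (transition c d x)"
  shows "contravariant_2_tensor A T"
  unfolding contravariant_2_tensor_def Let_def
proof (intro ballI)
  fix c d y assume c: "c \<in> A" and d: "d \<in> A"
    and "y \<in> snd (ext_chart A c) ` (fst (ext_chart A c) \<inter> fst (ext_chart A d))"
  then have y: "y \<in> half_space (overlap c d)" using ext_overlap by blast
  let ?\<phi> = "transition (ext_chart A c) (ext_chart A d)"
  let ?J = "jacobian ?\<phi> (at y)"
  obtain x t where xt: "y = ext_coords x t" "x \<in> overlap c d" "t > 0" using y by (rule half_space_cases)
  have \<phi>y: "?\<phi> y = ext_coords (transition c d x) (\<bar>jdet c d x\<bar> * t)"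
    using ext_transition(1)[OF c d xt(2,3)] xt(1) by simp
  have j: "\<bar>jdet c d x\<bar> > 0" using jdet_nonzero_overlap[OF c d xt(2)] by simp
  have jt: "\<bar>jdet c d x\<bar> * t > 0" using j xt(3) by simp
  have xc: "x \<in> chart_image c" and xd: "transition c d x \<in> chart_image d"
    using xt(2) overlap_subset transition_overlap[OF c xt(2)] by blast+
  have yd: "?\<phi> y \<in> half_space (chart_image d)" using xd jt by (simp add: \<phi>y)
  have inv: "grad d g (?\<phi> y) \<bullet> ((?J ** T c y ** transpose ?J) *v grad d f (?\<phi> y))
    = grad d g (?\<phi> y) \<bullet> (T d (?\<phi> y) *v grad d f (?\<phi> y))"
    if f: "f \<in> densities A \<alpha>" and g: "g \<in> densities A \<beta>" for f g \<alpha> \<beta>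
  proof -
    note gt = grad_transition[OF c d y differentiable_local_rep_density[OF _ d yd]]
    have "grad d g (?\<phi> y) \<bullet> ((?J ** T c y ** transpose ?J) *v grad d f (?\<phi> y)) = grad c g y \<bullet> (T c y *v grad c f y)"
      unfolding gt[OF f] gt[OF g]
      by (simp add: transpose_matrix_vector dot_lmul_matrix matrix_vector_mul_assoc[symmetric])
    also have "\<dots> = form (S c) (B c) (C c) \<alpha> (coef c f) \<beta> (coef c g) x * t powr (\<alpha> + \<beta>)"
      unfolding xt(1) by (rule inner_grad[OF f g c xc xt(3)])
    also have "\<dots> = grad d g (?\<phi> y) \<bullet> (T d (?\<phi> y) *v grad d f (?\<phi> y))"
      unfolding \<phi>y inner_grad[OF f g d xd jt] using ft[OF f g c d xt(2)] xt(3) j by (simp add: powr_mult)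
    finally show ?thesis .
  qed
  have entry: "axis k 1 \<bullet> (M *v axis l 1) = M $ k $ l" for M :: "real^('n option)^('n option)" and k l
    by (simp add: inner_axis' matrix_vector_mul_component inner_axis)
  have "(?J ** T c y ** transpose ?J) $ k $ l = T d (?\<phi> y) $ k $ l" for k l
  proof -
    obtain \<beta> g where g: "g \<in> densities A \<beta>" "grad d g (?\<phi> y) = axis k 1" using grad_axis[OF d yd] .
    obtain \<alpha> f where f: "f \<in> densities A \<alpha>" "grad d f (?\<phi> y) = axis l 1" using grad_axis[OF d yd] .
    show ?thesis using inv[OF f(1) g(1)] unfolding f(2) g(2) entry .
  qed
  then show "T d (?\<phi> y) = ?J ** T c y ** transpose ?J" by (simp add: vec_eq_iff)
qed

section \<open>Lower order coefficients and symbol of a self-adjoint operator annihilating 1\<close>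

context
  fixes L :: "('a, 'n) density_op" and D :: "('a, 'n) vector_coeff" and E F :: "('a, 'n) scalar_coeff"
  assumes adj: "self_adjoint A L" and wt: "weight_zero A L" and unit: "L (unit_density A) = (\<lambda>_. 0)"
    and D: "smooth_vector A D" and E: "smooth_scalar A E" and F: "smooth_scalar A F"
    and local: "\<And>c s y. c \<in> A \<Longrightarrow> s \<in> density_algebra A \<Longrightarrow> y \<in> chart_image (ext_chart A c) \<Longrightarrow>
      local_rep (ext_chart A c) (L s) y =
      local_operator (S c) (B c) (C c) (D c) (E c) (F c) (local_rep (ext_chart A c) s) y"
begin

lemma is_qp_operator:
  assumes h: "finite G" "\<And>\<alpha>. \<alpha> \<in> G \<Longrightarrow> h \<alpha> \<in> densities A \<alpha>" and c: "c \<in> A"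
  shows "is_qp (chart_image c) G (local_rep (ext_chart A c) (L (\<lambda>q. \<Sum>\<alpha>\<in>G. h \<alpha> q)))
    (\<lambda>\<alpha>. lop (S c) (B c) (C c) (D c) (E c) (F c) \<alpha> (coef c (h \<alpha>)))"
proof -
  interpret c: smooth_coefficients "chart_image c" "S c" "B c" "C c" by (rule smooth_coefficients[OF c])
  have "is_qp (chart_image c) G (local_operator (S c) (B c) (C c) (D c) (E c) (F c)
      (local_rep (ext_chart A c) (\<lambda>q. \<Sum>\<alpha>\<in>G. h \<alpha> q)))
    (\<lambda>\<alpha>. lop (S c) (B c) (C c) (D c) (E c) (F c) \<alpha> (coef c (h \<alpha>)))"
    using D E F c unfolding smooth_vector_def smooth_scalar_def
    by (intro c.is_qp_local_operator is_qp_density h) auto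
  then show ?thesis
    by (rule is_qp_cong[OF _ open_chart(2)[OF c]])
      (simp_all add: local[OF c density_algebraI[OF h]] ext_chart_image[OF c])
qed

lemma coef_operator:
  assumes s: "s \<in> densities A \<alpha>" and c: "c \<in> A" and x: "x \<in> chart_image c"
  shows "coef c (L s) x = lop (S c) (B c) (C c) (D c) (E c) (F c) \<alpha> (coef c s) x"
  using is_qp_value[OF is_qp_operator[of "{\<alpha>}" "\<lambda>_. s" c] x, of 1] s c by (simp add: coef_def)

text \<open>\<open>F\<close> is read off from the image of the unit density. Both the operator and
  \<open>canon\<close> are symmetric under integration in the chart, the former by assumption and
  the latter by \<open>integral_canon_self_adjoint\<close>. Their difference is symmetric of first
  order, and \<open>first_order_self_adjoint_eq_0\<close> shows that it is zero.\<close>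

lemma lower_order_coefficients:
  assumes c: "c \<in> A" and x: "x \<in> chart_image c"
  shows "F c x = 0"
    and "E c x = (\<Sum>k\<in>UNIV. partial_deriv k (\<lambda>x. B c x $ k) x) - C c x"
    and "D c x $ j = (\<Sum>k\<in>UNIV. partial_deriv k (\<lambda>x. S c x $ k $ j) x) - B c x $ j"
proof -
  let ?V = "chart_image c"
  interpret c: smooth_coefficients ?V "S c" "B c" "C c" by (rule smooth_coefficients[OF c])
  have F0: "F c x = 0" if x: "x \<in> ?V" for x
  proof -
    let ?u = "coef c (unit_density A)"
    have p: "partial_deriv k ?u y = 0" if "y \<in> ?V" for k y
      using partial_deriv_cong[OF open_chart(2)[OF c] that, of ?u "\<lambda>_. 1"] coef_unit_density[OF c]
      by (simp add: partial_deriv_const)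
    have pp: "partial_deriv i (partial_deriv k ?u) x = 0" for i k
      using partial_deriv_cong[OF open_chart(2)[OF c] x, of "partial_deriv k ?u" "\<lambda>_. 0"] p
      by (simp add: partial_deriv_const)
    have "lop (S c) (B c) (C c) (D c) (E c) (F c) 0 ?u x = F c x"
      using coef_unit_density[OF c x] by (simp add: lop_def p[OF x] pp)
    then show ?thesis
      using coef_operator[OF unit_density c x] by (simp add: unit coef_def local_rep_def)
  qed
  show "F c x = 0" by (rule F0[OF x])
  \<comment> \<open>Deviations of the coefficients from those in
    \<open>canon_expand\<close>.\<close>
  define D' where "D' i x = D c x $ i - ((\<Sum>k\<in>UNIV. partial_deriv k (\<lambda>x. S c x $ k $ i) x) - B c x $ i)" for i x
  define E' where "E' x = E c x - ((\<Sum>k\<in>UNIV. partial_deriv k (\<lambda>x. B c x $ k) x) - C c x)" for x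
  have sD: "smooth_on ?V (D' i)" for i
    unfolding D'_def[abs_def] using D c by (intro c.smooth_intros) (auto simp: smooth_vector_def)
  have sE: "smooth_on ?V E'"
    unfolding E'_def[abs_def] using E c by (intro c.smooth_intros) (auto simp: smooth_scalar_def)
  have lop: "lop (S c) (B c) (C c) (D c) (E c) (F c) \<alpha> u x =
      canon (S c) (B c) (C c) \<alpha> u x + ((\<Sum>i\<in>UNIV. D' i x * partial_deriv i u x) + \<alpha> * (E' x * u x))"
    if "smooth_on ?V u" "x \<in> ?V" for \<alpha> u x
  proof -
    have "(\<Sum>i\<in>UNIV. D' i x * partial_deriv i u x) = (\<Sum>i\<in>UNIV. D c x $ i * partial_deriv i u x)
      - (\<Sum>i\<in>UNIV. ((\<Sum>k\<in>UNIV. partial_deriv k (\<lambda>x. S c x $ k $ i) x) - B c x $ i) * partial_deriv i u x)"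
      by (simp add: D'_def left_diff_distrib sum_subtractf)
    then show ?thesis
      unfolding c.canon_expand[OF that] lop_def using F0[OF that(2)] by (simp add: E'_def algebra_simps)
  qed
  have sa: "integral ?V (\<lambda>x. ((\<Sum>i\<in>UNIV. D' i x * partial_deriv i u x) + \<alpha> * (E' x * u x)) * v x)
      = integral ?V (\<lambda>x. u x * ((\<Sum>i\<in>UNIV. D' i x * partial_deriv i v x) + (1 - \<alpha>) * (E' x * v x)))"
    if u0: "smooth_on ?V u" and v0: "smooth_on ?V v" and cu: "compact_support ?V u" and cv: "compact_support ?V v"
    for \<alpha> u v
  proof -
    note u = u0 cu and v = v0 cv
    let ?P = "\<lambda>\<alpha> u x. (\<Sum>i\<in>UNIV. D' i x * partial_deriv i u x) + \<alpha> * (E' x * u x)"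
    let ?K = "\<lambda>\<alpha> u. canon (S c) (B c) (C c) \<alpha> u"
    \<comment> \<open>Self-adjointness concerns global densities, so the local test functions are
      extended by zero, with complementary weights.\<close>
    let ?s = "lift_density c \<alpha> u" and ?s' = "lift_density c (1 - \<alpha>) v"
    have s: "?s \<in> densities A \<alpha>" and s': "?s' \<in> densities A (1 - \<alpha>)"
      by (intro lift_density c u v)+
    have supp: "compact (base_support (lift_density c \<beta> w)) \<and> base_support (lift_density c \<beta> w) \<subseteq> fst c"
      if w: "compact_support ?V w" for \<beta> w
    proof -
      obtain M where M: "compact M" "M \<subseteq> ?V" "\<forall>x\<in>?V - M. w x = 0" using w unfolding compact_support_def by metis
      note cM = compact_chart_inv_image[OF c M(1,2)]
      have "snd c ` chart_inv c ` M = M" using M(2) chart_chart_inv[OF c] by (force simp: image_image)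
      then have "base_support (lift_density c \<beta> w) \<subseteq> chart_inv c ` M"
        using M(3) by (intro lift_density_support[OF c cM(2,1)]) simp
      then show ?thesis using cM compact_base_support_subset by blast
    qed
    \<comment> \<open>Weight 0 keeps the images homogeneous, which reduces each scalar product to a
      single integral.\<close>
    have Ls: "L ?s \<in> densities A \<alpha>" and Ls': "L ?s' \<in> densities A (1 - \<alpha>)"
      using wt s s' unfolding weight_zero_def by blast+
    have coefu: "coef c (lift_density c \<beta> w) x = w x" if "x \<in> ?V" for \<beta> w x using that by (rule coef_lift_density[OF c])
    have lift_lop: "lop (S c) (B c) (C c) (D c) (E c) (F c) \<beta> (coef c (lift_density c \<beta>' w)) x = ?K \<beta> w x + ?P \<beta> w x"
      if x: "x \<in> ?V" and w: "smooth_on ?V w" for \<beta> \<beta>' w x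
    proof -
      have p: "partial_deriv k (coef c (lift_density c \<beta>' w)) y = partial_deriv k w y" if "y \<in> ?V" for k y
        by (rule partial_deriv_cong[OF open_chart(2)[OF c] that coefu])
      have pp: "partial_deriv i (partial_deriv k (coef c (lift_density c \<beta>' w))) x = partial_deriv i (partial_deriv k w) x" for i k
        by (rule partial_deriv_cong[OF open_chart(2)[OF c] x p])
      have "lop (S c) (B c) (C c) (D c) (E c) (F c) \<beta> (coef c (lift_density c \<beta>' w)) x
        = lop (S c) (B c) (C c) (D c) (E c) (F c) \<beta> w x"
        by (simp add: lop_def p[OF x] pp coefu[OF x])
      then show ?thesis using lop[OF w x] by simp
    qed
    have "integral ?V (\<lambda>x. (?K \<alpha> u x + ?P \<alpha> u x) * v x) = integral ?V (coef c (\<lambda>q. L ?s q * ?s' q))"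
      by (intro integral_cong) (simp add: coef_mult coefu coef_operator[OF s c] lift_lop u)
    also have "\<dots> = density_integral A (\<lambda>q. L ?s q * ?s' q)"
      using supp[OF v(2), of "1 - \<alpha>"] compact_base_support_subset[OF base_support_mult(2)] base_support_mult(2)[of "L ?s" ?s']
      by (intro density_integral_single_chart[symmetric, OF c densities_mult_dual[OF Ls s']]) blast+
    also have "\<dots> = scalar_product A (L ?s) ?s'"
      by (rule scalar_product_homogeneous[symmetric, OF Ls s'])
    also have "\<dots> = scalar_product A ?s (L ?s')"
      using adj supp[OF u(2), of \<alpha>] supp[OF v(2), of "1 - \<alpha>"] density_in_algebra[OF s] density_in_algebra[OF s']
      unfolding self_adjoint_def is_adjoint_def by blast
    also have "\<dots> = density_integral A (\<lambda>q. ?s q * L ?s' q)"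
      by (rule scalar_product_homogeneous[OF s Ls'])
    also have "\<dots> = integral ?V (coef c (\<lambda>q. ?s q * L ?s' q))"
      using supp[OF u(2), of \<alpha>] compact_base_support_subset[OF base_support_mult(1)] base_support_mult(1)[of ?s "L ?s'"]
      by (intro density_integral_single_chart[OF c densities_mult_dual[OF s Ls']]) blast+
    also have "\<dots> = integral ?V (\<lambda>x. u x * (?K (1 - \<alpha>) v x + ?P (1 - \<alpha>) v x))"
      by (intro integral_cong) (simp add: coef_mult coefu coef_operator[OF s' c] lift_lop v)
    finally have eq: "integral ?V (\<lambda>x. (?K \<alpha> u x + ?P \<alpha> u x) * v x)
      = integral ?V (\<lambda>x. u x * (?K (1 - \<alpha>) v x + ?P (1 - \<alpha>) v x))" .
    have sP: "smooth_on ?V (?P \<beta> w)" if "smooth_on ?V w" for \<beta> w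
      using that by (intro c.smooth_intros sD sE)
    have int: "(\<lambda>x. f x * g x) integrable_on ?V"
      if "smooth_on ?V f" "smooth_on ?V g" "compact_support ?V (\<lambda>x. f x * g x)" for f g
      using that open_chart(2)[OF c] by (intro integrable_compact_support smooth_on_continuous smooth_on_mult)
    have i1: "(\<lambda>x. ?K \<alpha> u x * v x) integrable_on ?V" "(\<lambda>x. ?P \<alpha> u x * v x) integrable_on ?V"
      by (intro int c.smooth_canon sP u v compact_support_mult(2))+
    have i2: "(\<lambda>x. u x * ?K (1 - \<alpha>) v x) integrable_on ?V" "(\<lambda>x. u x * ?P (1 - \<alpha>) v x) integrable_on ?V"
      by (intro int c.smooth_canon sP u v compact_support_mult(1))+
    have "integral ?V (\<lambda>x. ?K \<alpha> u x * v x) = integral ?V (\<lambda>x. u x * ?K (1 - \<alpha>) v x)"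
      using u v S_sym[OF c] by (intro c.integral_canon_self_adjoint) auto
    moreover have "integral ?V (\<lambda>x. (?K \<alpha> u x + ?P \<alpha> u x) * v x)
      = integral ?V (\<lambda>x. ?K \<alpha> u x * v x) + integral ?V (\<lambda>x. ?P \<alpha> u x * v x)"
      by (subst integral_add[OF i1, symmetric]) (simp add: distrib_right)
    moreover have "integral ?V (\<lambda>x. u x * (?K (1 - \<alpha>) v x + ?P (1 - \<alpha>) v x))
      = integral ?V (\<lambda>x. u x * ?K (1 - \<alpha>) v x) + integral ?V (\<lambda>x. u x * ?P (1 - \<alpha>) v x)"
      by (subst integral_add[OF i2, symmetric]) (simp add: distrib_left)
    ultimately show "integral ?V (\<lambda>x. ?P \<alpha> u x * v x) = integral ?V (\<lambda>x. u x * ?P (1 - \<alpha>) v x)"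
      using eq by simp
  qed
  have "E' x = 0" "D' j x = 0"
    using c.first_order_self_adjoint_eq_0[OF sD sE sa x] by blast+
  then show "E c x = (\<Sum>k\<in>UNIV. partial_deriv k (\<lambda>x. B c x $ k) x) - C c x"
    "D c x $ j = (\<Sum>k\<in>UNIV. partial_deriv k (\<lambda>x. S c x $ k $ j) x) - B c x $ j"
    by (simp_all add: E'_def D'_def)
qed

lemma lop_eq_canon:
  assumes c: "c \<in> A" and x: "x \<in> chart_image c" and u: "smooth_on (chart_image c) u"
  shows "lop (S c) (B c) (C c) (D c) (E c) (F c) \<alpha> u x = canon (S c) (B c) (C c) \<alpha> u x"
proof -
  interpret c: smooth_coefficients "chart_image c" "S c" "B c" "C c" by (rule smooth_coefficients[OF c])
  show ?thesis
    unfolding c.canon_expand[OF u x] lop_def by (simp add: lower_order_coefficients[OF c x])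
qed

text \<open>\<open>L (f g) - f L g - g L f = 2 S(df, dg)\<close> does not depend on the chart.\<close>

lemma contravariant_symbol: "contravariant_2_tensor A T"
proof (rule contravariant_if_form_transition)
  fix \<alpha> \<beta> f g c d x
  assume f: "f \<in> densities A \<alpha>" and g: "g \<in> densities A \<beta>" and c: "c \<in> A" and d: "d \<in> A" and x: "x \<in> overlap c d"
  \<comment> \<open>The defect is a density of weight \<alpha> + \<beta>, so its coefficients obey
    the transformation law that is wanted for \<open>form\<close>. Subtraction is written as
    multiplication by -1 to fit the closure rules of \<open>densities\<close>.\<close>
  define \<rho> where "\<rho> = (\<lambda>q. L (\<lambda>q. f q * g q) q + (-1) * (f q * L g q + L f q * g q))"
  note fg = densities_mult[OF f g]
  have L: "L f \<in> densities A \<alpha>" "L g \<in> densities A \<beta>" "L (\<lambda>q. f q * g q) \<in> densities A (\<alpha> + \<beta>)"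
    using wt f g fg unfolding weight_zero_def by blast+
  have \<rho>: "\<rho> \<in> densities A (\<alpha> + \<beta>)"
    unfolding \<rho>_def by (intro densities_add densities_cmult densities_mult L f g)
  have coef: "coef e \<rho> z = 2 * form (S e) (B e) (C e) \<alpha> (coef e f) \<beta> (coef e g) z"
    if e: "e \<in> A" and z: "z \<in> chart_image e" for e z
  proof -
    interpret e: smooth_coefficients "chart_image e" "S e" "B e" "C e" by (rule smooth_coefficients[OF e])
    let ?lop = "\<lambda>F. lop (S e) (B e) (C e) (D e) (E e) F"
    \<comment> \<open>The vanishing of \<open>F\<close> is essential here: otherwise the defect
      would contain the extra term - F f g.\<close>
    have F0: "?lop (F e) \<gamma> u z = ?lop (\<lambda>_. 0) \<gamma> u z" for \<gamma> u
      by (simp add: lop_def lower_order_coefficients(1)[OF e z])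
    have fgc: "coef e (\<lambda>q. f q * g q) = (\<lambda>x. coef e f x * coef e g x)" by (simp add: coef_mult fun_eq_iff)
    have Lfg: "coef e (L (\<lambda>q. f q * g q)) z = ?lop (\<lambda>_. 0) (\<alpha> + \<beta>) (\<lambda>x. coef e f x * coef e g x) z"
      by (simp only: coef_operator[OF fg e z] F0 fgc)
    show ?thesis
      using e.lop_mult[OF smooth_coef[OF f e] smooth_coef[OF g e] z S_sym[OF e z], of "D e" "E e" \<alpha> \<beta>]
      unfolding \<rho>_def coef_add coef_cmult coef_mult
      by (simp add: coef_operator[OF f e z] coef_operator[OF g e z] Lfg F0)
  qed
  have "x \<in> chart_image c" "transition c d x \<in> chart_image d"
    using x overlap_subset transition_overlap[OF c x] by blast+
  then show "form (S c) (B c) (C c) \<alpha> (coef c f) \<beta> (coef c g) x =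
    \<bar>jdet c d x\<bar> powr (\<alpha> + \<beta>) * form (S d) (B d) (C d) \<alpha> (coef d f) \<beta> (coef d g) (transition c d x)"
    using coef_transition[OF \<rho> c d x] coef[OF c] coef[OF d] by simp
qed

lemma operator_eq_canonical_op:
  assumes "s \<in> density_algebra A"
  shows "L s = canonical_op A T s"
proof
  fix q
  interpret weight_zero_tensor_field A S B C
    by unfold_locales (rule contravariant_symbol)
  obtain G h where s: "finite G" "\<And>\<alpha>. h \<alpha> \<in> densities A \<alpha>" "s = (\<lambda>q. \<Sum>\<alpha>\<in>G. h \<alpha> q)"
    using density_algebra_cases[OF assms] by blast
  show "L s q = canonical_op A T s q"
  proof (cases "q \<in> ext_manifold A")
    case True
    obtain c where c: "c \<in> A" "fst q \<in> fst c" by (rule chart_cover)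
    obtain t where t: "t > 0" "q = frame c (fst q) t" using ext_point_cases[OF True c] .
    have "L s q = local_rep (ext_chart A c) (L s) (ext_coords (snd c (fst q)) t)"
      using local_rep_frame[OF c t(1), of "L s"] t(2) by simp
    also have "\<dots> = (\<Sum>\<alpha>\<in>G. lop (S c) (B c) (C c) (D c) (E c) (F c) \<alpha> (coef c (h \<alpha>)) (snd c (fst q)) * t powr \<alpha>)"
      unfolding s(3) using c t(1) by (intro is_qp_value[OF is_qp_operator[OF s(1,2) c(1)]]) auto
    also have "\<dots> = (\<Sum>\<alpha>\<in>G. K c \<alpha> (h \<alpha>) (snd c (fst q)) * t powr \<alpha>)"
      using c by (simp add: lop_eq_canon smooth_coef[OF s(2)])
    also have "\<dots> = canonical_op A T s q"
      unfolding s(3) canonical_op_eq[OF s(2) True c] using frame_coord[OF c, of t] t(2) by simp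
    finally show ?thesis .
  next
    case False
    \<comment> \<open>Elements of the algebra are extended by 0 beyond the extended manifold, which
      settles the points outside it.\<close>
    have "L s \<in> density_algebra A"
      using adj assms unfolding self_adjoint_def is_adjoint_def linear_op_def by blast
    then obtain G' h' where h': "\<And>\<alpha>. h' \<alpha> \<in> densities A \<alpha>" and Ls: "L s = (\<lambda>q. \<Sum>\<alpha>\<in>(G' :: real set). h' \<alpha> q)"
      using density_algebra_cases by blast
    have "L s q = 0" unfolding Ls using density_outside[OF h' False] by simp
    then show ?thesis using False by (simp add: canonical_op_outside)
  qed
qed

end

end

text \<open>\<open>has_principal_symbol\<close> describes the top coefficients chart by chart, so
  the tensor property of the symbol is part of the conclusion. Equality with an operator built from
  \<open>S\<close>, \<open>B\<close> and \<open>C\<close> alone contains the uniqueness; it is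
  asserted on \<open>density_algebra A\<close> because values of operators elsewhere are
  arbitrary.\<close>

theorem proposition1:
  fixes A :: "('a::{t2_space, second_countable_topology}, 'n::finite) chart set"
  assumes "smooth_atlas A"
  shows "(\<forall>S B C. weight_zero_tensor A S B C \<longrightarrow>
            (\<forall>c\<in>A. \<forall>s\<in>density_algebra A. \<forall>y\<in>chart_image (ext_chart A c).
               local_rep (ext_chart A c) (canonical_op A (block_tensor S B C) s) y =
               canonical_local_operator (S c) (B c) (C c) (local_rep (ext_chart A c) s) y) \<and>
            self_adjoint A (canonical_op A (block_tensor S B C)) \<and>
            canonical_op A (block_tensor S B C) (unit_density A) = (\<lambda>_. 0)) \<and>
         (\<forall>\<Delta>. second_order_weight_zero A \<Delta> \<and> self_adjoint A \<Delta> \<and> \<Delta> (unit_density A) = (\<lambda>_. 0) \<longrightarrow>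
            (\<forall>S B C. has_principal_symbol A \<Delta> S B C \<longrightarrow>
               weight_zero_tensor A S B C \<and>
               (\<forall>s\<in>density_algebra A. \<Delta> s = canonical_op A (block_tensor S B C) s)))"
proof (intro conjI allI impI)
  interpret atlas A by unfold_locales (rule assms)
  {
    fix S B C assume w: "weight_zero_tensor A S B C"
    interpret weight_zero_tensor_field A S B C
      using w unfolding weight_zero_tensor_def by unfold_locales auto
    show "\<forall>c\<in>A. \<forall>s\<in>density_algebra A. \<forall>y\<in>chart_image (ext_chart A c).
       local_rep (ext_chart A c) (canonical_op A (block_tensor S B C) s) y =
       canonical_local_operator (S c) (B c) (C c) (local_rep (ext_chart A c) s) y"
    proof (intro ballI)
      fix c s y assume c: "c \<in> A" and s: "s \<in> density_algebra A" and y: "y \<in> chart_image (ext_chart A c)"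
      obtain F h where "\<And>\<alpha>. h \<alpha> \<in> densities A \<alpha>" "s = (\<lambda>q. \<Sum>\<alpha>\<in>(F :: real set). h \<alpha> q)"
        using density_algebra_cases[OF s] by blast
      then show "local_rep (ext_chart A c) (canonical_op A (block_tensor S B C) s) y =
         canonical_local_operator (S c) (B c) (C c) (local_rep (ext_chart A c) s) y"
        using local_rep_canonical_op[OF _ c y, of F h] by simp
    qed
    show "self_adjoint A (canonical_op A (block_tensor S B C))" by (rule self_adjoint_canonical_op)
    show "canonical_op A (block_tensor S B C) (unit_density A) = (\<lambda>_. 0)" by (rule canonical_op_unit)
  }
  fix \<Delta> S B C
  assume \<Delta>: "second_order_weight_zero A \<Delta> \<and> self_adjoint A \<Delta> \<and> \<Delta> (unit_density A) = (\<lambda>_. 0)"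
    and P: "has_principal_symbol A \<Delta> S B C"
  interpret weight_zero_coefficients A S B C
    using P unfolding has_principal_symbol_def by unfold_locales auto
  obtain D E F where DEF: "smooth_vector A D" "smooth_scalar A E" "smooth_scalar A F"
    and local: "\<And>c s y. c \<in> A \<Longrightarrow> s \<in> density_algebra A \<Longrightarrow> y \<in> chart_image (ext_chart A c) \<Longrightarrow>
      local_rep (ext_chart A c) (\<Delta> s) y =
      local_operator (S c) (B c) (C c) (D c) (E c) (F c) (local_rep (ext_chart A c) s) y"
    using P unfolding has_principal_symbol_def by blast
  have adj: "self_adjoint A \<Delta>" and wt: "weight_zero A \<Delta>" and unit: "\<Delta> (unit_density A) = (\<lambda>_. 0)"
    using \<Delta> by (auto simp: second_order_weight_zero_def)
  show "weight_zero_tensor A S B C"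
    unfolding weight_zero_tensor_def
    using S B C contravariant_symbol[OF adj wt unit DEF local] by blast
  show "\<forall>s\<in>density_algebra A. \<Delta> s = canonical_op A (block_tensor S B C) s"
    using operator_eq_canonical_op[OF adj wt unit DEF local] by blast
qed

end
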